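(* For all $a>0$ and $r>0$ (arbitrarily small) there exist constants $\alpha,\mu,\delta,R$ with $0<\alpha,\mu,\delta,R<\infty$ (and $\delta\le R$) such that the Poisson-Poisson cluster point process with annular clusters $\Phi_\alpha^{R,\delta,\mu}$ on the plane $\mathbb{R}^2$ has intensity $\alpha\mu=a$ and critical radius for percolation $r_c(\Phi_\alpha^{R,\delta,\mu})\le r$. Moreover, for any $a>0$ there exists a point process $\Phi$ on $\mathbb{R}^2$ of intensity $a$ which is $dcx$-larger than the homogeneous Poisson point process $\Phi_a$ of intensity $a$ (i.e. $\Phi_a\le_{dcx}\Phi$), and which percolates for any radius $r>0$, i.e. $r_c(\Phi)=0$.
   Context: A point process is a random locally finite counting measure with Radon mean measure. For $0<\delta\le R<\infty$ and $\alpha,\mu>0$, $\Phi_\alpha^{R,\delta,\mu}$ is defined as follows: let $\Phi_\alpha$ be the homogeneous Poisson point process of intensity $\alpha$ on $\mathbb{R}^2$ (cluster centers); independently for each $X\in\Phi_\alpha$, replace $X$ by a Poisson($\mu$) number of points $X+Y_{iX}$, where the $Y_{iX}$ are i.i.d. (and independent of the numbers of points) uniform on the annulus $B_O(R)\setminus B_O(R-\delta)$; here $B_x(r)$ denotes the ball of radius $r$ centered at $x$ and $O$ the origin. For a point process $\Phi$, $C(\Phi,r)=\bigcup_{X\in\Phi}B_X(r)$, and $r_c(\Phi)=\inf\{r>0:\mathsf{P}(C(\Phi,r)\text{ has an unbounded connected subset})>0\}$. A Lebesgue-measurable $f:\mathbb{R}^k\to\mathbb{R}$ is directionally convex ($dcx$)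 if for all $x,y,p,q\in\mathbb{R}^k$ with $p\le x\le q$, $p\le y\le q$ (coordinatewise) and $x+y=p+q$ one has $f(x)+f(y)\le f(p)+f(q)$. $\Phi_1\le_{dcx}\Phi_2$ means that for every $k\ge1$ and all bounded Borel $B_1,\dots,B_k$, $\mathsf{E}f(\Phi_1(B_1),\dots,\Phi_1(B_k))\le\mathsf{E}f(\Phi_2(B_1),\dots,\Phi_2(B_k))$ for all $dcx$ functions $f$ for which both expectations are finite. *)

theory Defs
  imports "HOL-Probability.Probability"
begin

type_synonym plane = "real^2"

section \<open>Point processes\<close>

text \<open>Multiple points are allowed; \<open>X\<close> is a point of \<open>N\<close> iff \<open>N {X} > 0\<close>.\<close>

definition counting_measures :: "plane measure set" where
  "counting_measures =
     {N. sets N = sets borel \<and>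
         (\<forall>B\<in>sets borel. bounded B \<longrightarrow> (\<exists>n::nat. emeasure N B = of_nat n))}"

text \<open>The sigma-algebra generated by the evaluations \<open>N \<mapsto> N(B)\<close>. Only the space and the
  sigma-algebra of this object matter; it is used as the codomain of random elements
  (compare \<^const>\<open>subprob_algebra\<close>).\<close>

definition config_space :: "plane measure measure" where
  "config_space =
     (SUP B \<in> sets (borel :: plane measure).
        vimage_algebra counting_measures (\<lambda>N. emeasure N B) borel)"

definition mean_measure :: "plane measure measure \<Rightarrow> plane set \<Rightarrow> ennreal" where
  "mean_measure P B = (\<integral>\<^sup>+ N. emeasure N B \<partial>P)"

text \<open>A point process is represented by its law \<open>P\<close> on the configuration space. On the plane, a
  Borel measure is Radon iff it is finite on bounded Borel sets.\<close>

definition point_process :: "plane measure measure \<Rightarrow> bool" where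
  "point_process P \<longleftrightarrow>
     prob_space P \<and> sets P = sets config_space \<and>
     (\<forall>B\<in>sets borel. bounded B \<longrightarrow> mean_measure P B < \<infinity>)"

definition has_intensity :: "plane measure measure \<Rightarrow> real \<Rightarrow> bool" where
  "has_intensity P a \<longleftrightarrow>
     (\<forall>B\<in>sets borel. mean_measure P B = ennreal a * emeasure lborel B)"

definition homogeneous_poisson :: "real \<Rightarrow> plane measure measure \<Rightarrow> bool" where
  "homogeneous_poisson a P \<longleftrightarrow>
     point_process P \<and>
     (\<forall>B\<in>sets borel. bounded B \<longrightarrow>
        (\<forall>n::nat. measure P {N \<in> space P. emeasure N B = of_nat n} =
           (a * measure lborel B) ^ n / fact n * exp (- (a * measure lborel B)))) \<and>
     (\<forall>(k::nat) B. (\<forall>i<k. B i \<in> sets borel \<and> bounded (B i)) \<longrightarrow>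
        disjoint_family_on B {..<k} \<longrightarrow>
        prob_space.indep_vars P (\<lambda>_. borel) (\<lambda>i N. emeasure N (B i)) {..<k})"


section \<open>Annular cluster processes\<close>

text \<open>The counting measure \<open>\<Sum>j\<in>J. \<delta>(f j)\<close>.\<close>

definition dirac_sum :: "'j set \<Rightarrow> ('j \<Rightarrow> plane) \<Rightarrow> plane measure" where
  "dirac_sum J f = distr (count_space J) borel f"

text \<open>\<open>P\<close> is the law of the random measure \<open>\<Phi>\<close>, which needs to be a locally finite counting
  measure only almost surely.\<close>

definition law_of :: "'w measure \<Rightarrow> ('w \<Rightarrow> plane measure) \<Rightarrow> plane measure measure \<Rightarrow> bool" where
  "law_of M \<Phi> P \<longleftrightarrow>
     (\<exists>\<Phi>' \<in> measurable M config_space.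
        (AE \<omega> in M. \<Phi>' \<omega> = \<Phi> \<omega>) \<and> P = distr M config_space \<Phi>')"

definition annulus :: "real \<Rightarrow> real \<Rightarrow> plane set" where
  "annulus R \<delta> = ball 0 R - ball 0 (R - \<delta>)"

text \<open>The mark of a cluster centre: a Poisson number of points together with an independent i.i.d.
  sequence of displacements, of which as many as that number are used.\<close>

definition mark_law :: "real \<Rightarrow> real \<Rightarrow> real \<Rightarrow> (nat \<times> (nat \<Rightarrow> plane)) measure" where
  "mark_law R \<delta> \<mu> =
     measure_pmf (poisson_pmf \<mu>) \<Otimes>\<^sub>M
     (\<Pi>\<^sub>M i\<in>(UNIV::nat set). uniform_measure lborel (annulus R \<delta>))"

text \<open>\<open>X 0, X 1, \<dots>\<close> is a (random) enumeration of the homogeneous Poisson process of centres, which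
  almost surely has infinitely many points; \<open>Z n\<close> is the mark of \<open>X n\<close>. The last equation says that
  the marks are i.i.d. with law \<open>mark_law R \<delta> \<mu>\<close> and independent of the sequence of centres.\<close>

definition marked_centres ::
    "real \<Rightarrow> real \<Rightarrow> real \<Rightarrow> real \<Rightarrow> 'w measure \<Rightarrow> (nat \<Rightarrow> 'w \<Rightarrow> plane) \<Rightarrow>
     (nat \<Rightarrow> 'w \<Rightarrow> nat \<times> (nat \<Rightarrow> plane)) \<Rightarrow> bool" where
  "marked_centres \<alpha> R \<delta> \<mu> M X Z \<longleftrightarrow>
     prob_space M \<and>
     (\<exists>P\<^sub>0. homogeneous_poisson \<alpha> P\<^sub>0 \<and> law_of M (\<lambda>\<omega>. dirac_sum UNIV (\<lambda>n. X n \<omega>)) P\<^sub>0) \<and>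
     (\<lambda>\<omega> n. X n \<omega>) \<in> measurable M (\<Pi>\<^sub>M n\<in>UNIV. borel) \<and>
     (\<lambda>\<omega> n. Z n \<omega>) \<in> measurable M (\<Pi>\<^sub>M n\<in>UNIV. mark_law R \<delta> \<mu>) \<and>
     distr M ((\<Pi>\<^sub>M n\<in>UNIV. borel) \<Otimes>\<^sub>M (\<Pi>\<^sub>M n\<in>UNIV. mark_law R \<delta> \<mu>))
         (\<lambda>\<omega>. (\<lambda>n. X n \<omega>, \<lambda>n. Z n \<omega>)) =
       distr M (\<Pi>\<^sub>M n\<in>UNIV. borel) (\<lambda>\<omega> n. X n \<omega>) \<Otimes>\<^sub>M (\<Pi>\<^sub>M n\<in>UNIV. mark_law R \<delta> \<mu>)"

definition cluster_points ::
    "(nat \<Rightarrow> 'w \<Rightarrow> plane) \<Rightarrow> (nat \<Rightarrow> 'w \<Rightarrow> nat \<times> (nat \<Rightarrow> plane)) \<Rightarrow> 'w \<Rightarrow> plane measure" where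
  "cluster_points X Z \<omega> =
     dirac_sum {(n, i). i < fst (Z n \<omega>)} (\<lambda>(n, i). X n \<omega> + snd (Z n \<omega>) i)"

text \<open>\<open>P\<close> is the law of the annular cluster process. The sample space is taken to be the type of
  sequences of marked centres, on which every law of \<open>(X, Z)\<close> can be realised.\<close>

definition annular_cluster_process ::
    "real \<Rightarrow> real \<Rightarrow> real \<Rightarrow> real \<Rightarrow> plane measure measure \<Rightarrow> bool" where
  "annular_cluster_process \<alpha> R \<delta> \<mu> P \<longleftrightarrow>
     (\<exists>(M :: (nat \<Rightarrow> plane \<times> (nat \<times> (nat \<Rightarrow> plane))) measure) X Z.
        marked_centres \<alpha> R \<delta> \<mu> M X Z \<and> law_of M (cluster_points X Z) P)"


section \<open>Percolation\<close>

definition coverage :: "plane measure \<Rightarrow> real \<Rightarrow> plane set" where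
  "coverage N r = (\<Union>X \<in> {X. emeasure N {X} > 0}. ball X r)"

definition percolates :: "plane measure measure \<Rightarrow> real \<Rightarrow> bool" where
  "percolates P r \<longleftrightarrow>
     measure P {N \<in> space P. \<exists>U. U \<subseteq> coverage N r \<and> connected U \<and> \<not> bounded U} > 0"

text \<open>Extended-real valued, so that the infimum of the empty set is \<open>\<infinity>\<close>.\<close>

definition critical_radius :: "plane measure measure \<Rightarrow> ereal" where
  "critical_radius P = (INF r \<in> {r. r > 0 \<and> percolates P r}. ereal r)"


section \<open>Directionally convex order\<close>

text \<open>\<open>\<real>\<^sup>k\<close> is rendered as the functions on \<open>{..<k}\<close> that are \<open>undefined\<close> elsewhere, the
  space of the k-fold product of \<^const>\<open>lborel\<close>; its completion carries the Lebesgue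
  sigma-algebra.\<close>

definition dcx :: "nat \<Rightarrow> ((nat \<Rightarrow> real) \<Rightarrow> real) \<Rightarrow> bool" where
  "dcx k f \<longleftrightarrow>
     f \<in> borel_measurable (completion (\<Pi>\<^sub>M i\<in>{..<k}. lborel)) \<and>
     (\<forall>x\<in>extensional {..<k}. \<forall>y\<in>extensional {..<k}.
      \<forall>p\<in>extensional {..<k}. \<forall>q\<in>extensional {..<k}.
        (\<forall>i<k. p i \<le> x i \<and> x i \<le> q i \<and> p i \<le> y i \<and> y i \<le> q i \<and> x i + y i = p i + q i) \<longrightarrow>
        f x + f y \<le> f p + f q)"

definition counts :: "nat \<Rightarrow> (nat \<Rightarrow> plane set) \<Rightarrow> plane measure \<Rightarrow> (nat \<Rightarrow> real)" where
  "counts k B N = (\<lambda>i\<in>{..<k}. measure N (B i))"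

definition dcx_le :: "plane measure measure \<Rightarrow> plane measure measure \<Rightarrow> bool"
  (infix \<open>\<le>\<^sub>d\<^sub>c\<^sub>x\<close> 50) where
  "P \<le>\<^sub>d\<^sub>c\<^sub>x Q \<longleftrightarrow>
     (\<forall>k\<ge>1. \<forall>B. (\<forall>i<k. B i \<in> sets borel \<and> bounded (B i)) \<longrightarrow>
        (\<forall>f. dcx k f \<longrightarrow>
             integrable P (\<lambda>N. f (counts k B N)) \<longrightarrow>
             integrable Q (\<lambda>N. f (counts k B N)) \<longrightarrow>
             (\<integral>N. f (counts k B N) \<partial>P) \<le> (\<integral>N. f (counts k B N) \<partial>Q)))"

end

theory Submission
  imports Defs "HOL-Real_Asymp.Real_Asymp"
begin

text \<open>Both percolation statements come from a renormalisation by three-by-three blocks of squares: a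
  block is good if at most one of its nine sub-blocks is bad, so that the probability \<open>q n\<close> of a bad
  block of level \<open>n\<close> satisfies \<open>q (n + 1) \<le> 36 * q n ^ 2\<close>. Removing one sub-block leaves a block connected, and
  adjacent good blocks are linked, so an unbounded cluster exists as soon as all the nested blocks at the
  origin are good, which has positive probability once \<open>q 0\<close> is small.

  In the annular process a square is good if it contains a centre whose cluster, thickened by \<open>r\<close>, covers
  a circle of radius \<open>R - r / 2\<close>; circles of this radius around centres of adjacent squares of side \<open>R / 3\<close>
  intersect. With \<open>\<delta> = r\<close>, \<open>R = t ^ 2\<close>, \<open>\<mu> = t ^ 3\<close>, \<open>\<alpha> = a / t ^ 3\<close> and large \<open>t\<close>, a cluster has far more points than
  the order \<open>R\<close> needed to cover such a circle, while the mean number of centres in a square, of order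
  \<open>\<alpha> * R ^ 2\<close>, still tends to infinity.

  The \<open>dcx\<close>-larger process is the sum of \<open>\<xi>\<close> independent copies of the Poisson process of intensity \<open>a\<close>,
  with \<open>\<xi>\<close> independent of them and Poisson of mean 1. If \<open>h m\<close> is the expectation of a \<open>dcx\<close> function of the
  counts of \<open>m\<close> copies, then \<open>h\<close> is convex, and Jensen's inequality gives \<open>h 1 \<le> E h(\<xi>)\<close>. For every radius,
  some value of \<open>\<xi>\<close> makes the process dense enough to percolate.\<close>

text \<open>The only probabilistic input to the renormalisation is that all sites of a finite set
  \<open>F\<close> are bad with probability at most \<open>q ^ card F\<close>. This form reproduces
  itself when passing from sites to blocks, so independence is used just once, through void
  probabilities of unions of squares. The threshold 1/144 makes \<open>36 * q\<close> at most 1/4,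
  and then the failure probabilities of all levels sum to less than 1.

  The processes are specified by properties of their laws. Claims about every such law would be
  empty without existence, so a Poisson process is constructed and its points are arranged in a
  sequence. Generating functions do the main work there: they show that the constructed counts are
  Poisson and independent, and they give the void probability of centres with a full cluster.

  In the \<open>dcx\<close> comparison, finiteness is given only for the Poisson process and for the
  mixture. Every value of \<open>\<xi>\<close> has positive weight, so finiteness for the mixture
  already makes every \<open>h m\<close> an expectation of an integrable function.\<close>

section \<open>Atoms of counting measures and measurability of the percolation event\<close>

lemma space_config_space: "space config_space = counting_measures"
  unfolding config_space_def by (auto simp: space_Sup_eq_UN)

lemma measurable_emeasure_config [measurable]:
  "B \<in> sets borel \<Longrightarrow> (\<lambda>N. emeasure N B) \<in> borel_measurable config_space"
  unfolding config_space_def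
  by (auto intro!: measurable_Sup1 measurable_vimage_algebra1)

lemma measurable_measure_config [measurable]:
  "B \<in> sets borel \<Longrightarrow> (\<lambda>N. measure N B) \<in> borel_measurable config_space"
  unfolding measure_def
  by (intro borel_measurable_enn2real measurable_emeasure_config)

lemma measurable_into_config:
  assumes "\<And>x. x \<in> space M \<Longrightarrow> K x \<in> counting_measures"
    and "\<And>B. B \<in> sets borel \<Longrightarrow> (\<lambda>x. emeasure (K x) B) \<in> borel_measurable M"
  shows "K \<in> measurable M config_space"
  unfolding config_space_def
  by (rule measurable_Sup2) (use assms in \<open>auto intro!: measurable_vimage_algebra2 simp: Pi_iff\<close>)

lemma counting_measuresD:
  assumes "N \<in> counting_measures"
  shows "sets N = sets borel"
    and "B \<in> sets borel \<Longrightarrow> bounded B \<Longrightarrow> \<exists>n::nat. emeasure N B = of_nat n"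
  using assms by (auto simp: counting_measures_def)

lemma counting_measures_finite:
  assumes "N \<in> counting_measures" "B \<in> sets borel" "bounded B"
  shows "emeasure N B < \<infinity>"
  using counting_measuresD(2)[OF assms] by (auto simp: ennreal_of_nat_eq_real_of_nat)

text \<open>Compactness: without atoms every point of the closure of \<open>B\<close> has a
  neighbourhood carrying no mass in \<open>B\<close>, and finitely many of these cover
  \<open>B\<close>. This recovers actual points from a measure that is only known to be
  integer-valued on bounded sets.\<close>

lemma counting_measures_atom:
  assumes N: "N \<in> counting_measures" and B: "B \<in> sets borel" "bounded B" "emeasure N B > 0"
  shows "\<exists>x\<in>B. emeasure N {x} > 0"
proof (rule ccontr)
  assume "\<not> ?thesis"
  then have no: "\<And>x. x \<in> B \<Longrightarrow> emeasure N {x} = 0"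
    by auto
  note [simp] = counting_measuresD(1)[OF N]
  have [measurable]: "B \<in> sets borel" by fact
  \<comment> \<open>An integer-valued sequence converging to zero is eventually zero.\<close>
  have "\<exists>e>0. emeasure N (ball x e \<inter> B) = 0" for x
  proof -
    define A where "A n = ball x (1 / Suc n) \<inter> B" for n
    have A: "A n \<in> sets borel" "bounded (A n)" for n
      using B by (auto simp: A_def intro: bounded_subset)
    have dec: "decseq A"
      unfolding A_def decseq_def
      by (intro allI impI Int_mono subset_ball) (auto simp: field_simps)
    have "(\<Inter>n. A n) = {x} \<inter> B"
    proof (intro equalityI subsetI)
      fix y assume "y \<in> (\<Inter>n. A n)"
      then have y: "dist x y < 1 / Suc n" "y \<in> B" for n
        by (auto simp: A_def)
      have "dist x y = 0"
      proof (rule ccontr)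
        assume "dist x y \<noteq> 0"
        then obtain n where "1 / real (Suc n) < dist x y"
          using nat_approx_posE zero_less_dist_iff by (metis dist_eq_0_iff)
        with y(1)[of n] show False by simp
      qed
      with y show "y \<in> {x} \<inter> B" by auto
    qed (auto simp: A_def)
    moreover have "(\<lambda>n. emeasure N (A n)) \<longlonglongrightarrow> emeasure N (\<Inter>n. A n)"
      by (rule Lim_emeasure_decseq)
         (use A dec counting_measures_finite[OF N A] in \<open>auto simp: less_top\<close>)
    moreover have "emeasure N ({x} \<inter> B) = 0"
      using no[of x] by (cases "x \<in> B") auto
    ultimately have "(\<lambda>n. emeasure N (A n)) \<longlonglongrightarrow> 0"
      by simp
    then have "\<forall>\<^sub>F n in sequentially. emeasure N (A n) < 1"
      by (rule order_tendstoD) auto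
    then obtain n where n: "emeasure N (A n) < 1"
      by (auto simp: eventually_sequentially)
    obtain m :: nat where "emeasure N (A n) = of_nat m"
      using counting_measuresD(2)[OF N A] by auto
    with n have "emeasure N (A n) = 0"
      by (cases m) (auto simp: ennreal_of_nat_eq_real_of_nat)
    then show ?thesis
      by (intro exI[of _ "1 / Suc n"]) (auto simp: A_def)
  qed
  then obtain e where e: "\<And>x. e x > 0" "\<And>x. emeasure N (ball x (e x) \<inter> B) = 0"
    by metis
  have "compact (closure B)"
    using B by (simp add: compact_closure)
  moreover have "closure B \<subseteq> (\<Union>x\<in>closure B. ball x (e x))"
    using e by force
  ultimately obtain C where C: "C \<subseteq> closure B" "finite C" "closure B \<subseteq> (\<Union>x\<in>C. ball x (e x))"
    using compactE_image[of "closure B" "closure B" "\<lambda>x. ball x (e x)"] by (metis open_ball)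
  have "emeasure N B \<le> emeasure N (\<Union>x\<in>C. ball x (e x) \<inter> B)"
    using C closure_subset[of B] by (intro emeasure_mono) (auto intro!: sets.finite_UN)
  also have "\<dots> \<le> (\<Sum>x\<in>C. emeasure N (ball x (e x) \<inter> B))"
    using C by (intro emeasure_subadditive_finite) auto
  also have "\<dots> = 0"
    using e by simp
  finally show False
    using B by simp
qed

text \<open>Two points are adjacent if a single ball of the coverage contains both; within a countable dense
  set, adjacency is decided by countably many evaluations of the counting measure.\<close>

definition covered_together :: "plane measure \<Rightarrow> real \<Rightarrow> plane set \<Rightarrow> (plane \<times> plane) set" where
  "covered_together N r D = {(p, q). p \<in> D \<and> q \<in> D \<and> emeasure N (ball p r \<inter> ball q r) > 0}"

lemma covered_together_atom:
  assumes "N \<in> counting_measures" "(p, q) \<in> covered_together N r D"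
  obtains X where "emeasure N {X} > 0" "p \<in> ball X r" "q \<in> ball X r"
proof -
  from assms obtain X where "X \<in> ball p r \<inter> ball q r" "emeasure N {X} > 0"
    using counting_measures_atom[of N "ball p r \<inter> ball q r"]
    by (auto simp: covered_together_def bounded_Int simp del: Int_iff)
  with that[of X] show ?thesis by (auto simp: dist_commute)
qed

lemma covered_togetherI:
  assumes "N \<in> counting_measures" "p \<in> D" "q \<in> D" "emeasure N {X} > 0" "p \<in> ball X r" "q \<in> ball X r"
  shows "(p, q) \<in> covered_together N r D"
proof -
  have "emeasure N {X} \<le> emeasure N (ball p r \<inter> ball q r)"
    using assms counting_measuresD(1)[of N] by (intro emeasure_mono) (auto simp: dist_commute)
  with assms show ?thesis
    by (auto simp: covered_together_def)
qed

text \<open>Trades the uncountable quantification over \<open>U\<close> for chains in a countable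
  dense set. Forwards, the balls reachable from \<open>q\<close> and the remaining balls form two
  disjoint open sets, so a connected \<open>U\<close> that meets the first lies in it. Backwards,
  each link of a chain stays inside one ball of the coverage.\<close>

lemma unbounded_component_iff:
  fixes D :: "plane set"
  assumes N: "N \<in> counting_measures" and dense: "\<And>S. open S \<Longrightarrow> S \<noteq> {} \<Longrightarrow> \<exists>d\<in>D. d \<in> S"
  shows "(\<exists>U. U \<subseteq> coverage N r \<and> connected U \<and> \<not> bounded U) \<longleftrightarrow>
    (\<exists>q\<in>D. \<forall>n::nat. \<exists>p\<in>D. norm p > n \<and> (q, p) \<in> (covered_together N r D)\<^sup>+)"
    (is "?L = ?R")
proof
  assume ?L
  then obtain U where U: "U \<subseteq> coverage N r" "connected U" "\<not> bounded U" by blast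
  define At where "At = {X. emeasure N {X} > 0}"
  have cov: "coverage N r = (\<Union>X\<in>At. ball X r)"
    by (simp add: coverage_def At_def)
  from U(3) obtain u where u: "u \<in> U"
    by (metis bounded_empty ex_in_conv)
  with U cov obtain X0 where X0: "X0 \<in> At" "u \<in> ball X0 r"
    by auto
  then obtain q where q: "q \<in> D" "q \<in> ball X0 r"
    using dense[of "ball X0 r"] by (metis empty_iff open_ball)
  define G where "G = {X\<in>At. \<exists>p\<in>D. p \<in> ball X r \<and> (q, p) \<in> (covered_together N r D)\<^sup>+}"
  have qq: "(q, q) \<in> covered_together N r D"
    using X0 q N by (intro covered_togetherI[of N q D q X0]) (auto simp: At_def)
  have "X0 \<in> G"
    using X0 q qq by (auto simp: G_def)
  let ?S = "\<Union>X\<in>G. ball X r" and ?T = "\<Union>X\<in>At - G. ball X r"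
  have "?S \<inter> ?T = {}"
  proof (rule ccontr)
    assume "?S \<inter> ?T \<noteq> {}"
    then obtain X Y where XY: "X \<in> G" "Y \<in> At" "Y \<notin> G" "ball X r \<inter> ball Y r \<noteq> {}"
      by blast
    \<comment> \<open>Overlapping open balls share a point of \<open>D\<close>, so reachability
      passes from the ball of \<open>X\<close> to that of \<open>Y\<close>.\<close>
    then obtain d where d: "d \<in> D" "d \<in> ball X r" "d \<in> ball Y r"
      using dense[of "ball X r \<inter> ball Y r"] by auto
    from XY obtain p where p: "p \<in> D" "p \<in> ball X r" "(q, p) \<in> (covered_together N r D)\<^sup>+"
      by (auto simp: G_def)
    have "(p, d) \<in> covered_together N r D"
      using XY p d N by (intro covered_togetherI[of N p D d X]) (auto simp: G_def At_def)
    with p have "(q, d) \<in> (covered_together N r D)\<^sup>+"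
      by (auto intro: trancl_into_trancl)
    with d XY show False
      by (auto simp: G_def)
  qed
  moreover have "U \<subseteq> ?S \<union> ?T"
    using U cov by blast
  moreover have "open ?S" "open ?T" by auto
  ultimately have "?S \<inter> U = {} \<or> ?T \<inter> U = {}"
    using connectedD[OF U(2), of ?S ?T] by blast
  then have US: "U \<subseteq> ?S"
    using u X0 \<open>X0 \<in> G\<close> \<open>U \<subseteq> ?S \<union> ?T\<close> by blast
  have "\<exists>p\<in>D. norm p > n \<and> (q, p) \<in> (covered_together N r D)\<^sup>+" for n :: nat
  proof -
    \<comment> \<open>The extra 1 pays for replacing \<open>v\<close> by a point of \<open>D\<close>
      at distance less than 1.\<close>
    from U(3) obtain v where v: "v \<in> U" "norm v > n + 1"
      by (auto simp: bounded_iff not_le)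
    then obtain X where X: "X \<in> G" "v \<in> ball X r"
      using US by auto
    then obtain d where d: "d \<in> D" "d \<in> ball X r \<inter> ball v 1"
      using dense[of "ball X r \<inter> ball v 1"] by (auto simp del: Int_iff) force
    from X obtain p where p: "p \<in> D" "p \<in> ball X r" "(q, p) \<in> (covered_together N r D)\<^sup>+"
      by (auto simp: G_def)
    have "(p, d) \<in> covered_together N r D"
      using X p d N by (intro covered_togetherI[of N p D d X]) (auto simp: G_def At_def)
    moreover have "norm d > n"
      using d v norm_triangle_ineq2[of v d] by (auto simp: dist_norm)
    ultimately show ?thesis
      using p d by (auto intro: trancl_into_trancl)
  qed
  with q show ?R by auto
next
  assume ?R
  then obtain q where q: "q \<in> D"
    "\<And>n::nat. \<exists>p\<in>D. norm p > n \<and> (q, p) \<in> (covered_together N r D)\<^sup>+"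
    by auto
  let ?U = "connected_component_set (coverage N r) q"
  have step: "connected_component (coverage N r) p p'"
    if "(p, p') \<in> covered_together N r D" for p p'
  proof -
    from covered_together_atom[OF N that] obtain X where
      X: "emeasure N {X} > 0" "p \<in> ball X r" "p' \<in> ball X r" by blast
    then have "ball X r \<subseteq> coverage N r"
      by (auto simp: coverage_def)
    then show ?thesis
      unfolding connected_component_def using X by (intro exI[of _ "ball X r"]) simp
  qed
  have chain: "connected_component (coverage N r) q p" if "(q, p) \<in> (covered_together N r D)\<^sup>+" for p
    using that by induction (auto intro: step connected_component_trans)
  have "\<not> bounded ?U"
  proof
    assume "bounded ?U"
    then obtain b where b: "\<And>x. x \<in> ?U \<Longrightarrow> norm x \<le> b"
      by (auto simp: bounded_iff)
    obtain n :: nat where "n > b" using reals_Archimedean2 by blast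
    with q(2)[of n] b chain show False by force
  qed
  then show ?L
    by (intro exI[of _ ?U]) (auto simp: connected_component_subset connected_connected_component)
qed

text \<open>Without this, \<^const>\<open>percolates\<close> could fail for the trivial reason that \<^const>\<open>measure\<close> vanishes
  on non-measurable sets.\<close>

lemma sets_percolation [measurable]:
  "{N \<in> space config_space. \<exists>U. U \<subseteq> coverage N r \<and> connected U \<and> \<not> bounded U} \<in> sets config_space"
proof -
  obtain D :: "plane set" where D: "countable D" "\<And>S. open S \<Longrightarrow> S \<noteq> {} \<Longrightarrow> \<exists>d\<in>D. d \<in> S"
    using countable_dense_setE by blast
  have [measurable]: "Measurable.pred config_space (\<lambda>N. (p, q) \<in> covered_together N r D)" for p q
    unfolding covered_together_def by simp
  \<comment> \<open>Induction on the length of the chain; the last intermediate point ranges over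
    the countable set \<open>D\<close>, so each step is a countable union.\<close>
  have pow: "Measurable.pred config_space (\<lambda>N. (p, q) \<in> covered_together N r D ^^ n)" for p q n
  proof (induction n arbitrary: q)
    case (Suc n)
    have "(p, q) \<in> covered_together N r D ^^ Suc n \<longleftrightarrow>
       (\<exists>s\<in>D. (p, s) \<in> covered_together N r D ^^ n \<and> (s, q) \<in> covered_together N r D)" for N
      by (auto simp: covered_together_def)
    moreover have "Measurable.pred config_space (\<lambda>N. \<exists>s\<in>D. (p, s) \<in> covered_together N r D ^^ n \<and>
        (s, q) \<in> covered_together N r D)"
      unfolding pred_def
      by (intro sets.sets_Collect_countable_Ex' D(1) sets.sets_Collect_conj Suc[unfolded pred_def]) measurable
    ultimately show ?case by (simp only:)
  qed simp
  have [measurable]: "Measurable.pred config_space (\<lambda>N. (p, q) \<in> (covered_together N r D)\<^sup>+)" for p q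
    unfolding trancl_power using pow by (intro pred_intros_countable) measurable
  have "Measurable.pred config_space (\<lambda>N.
      \<exists>q\<in>D. \<forall>n::nat. \<exists>p\<in>D. norm p > n \<and> (q, p) \<in> (covered_together N r D)\<^sup>+)"
    unfolding pred_def
    by (intro sets.sets_Collect_countable_Ex' sets.sets_Collect_countable_All D(1)) measurable
  then show ?thesis
    unfolding pred_def
    by (subst (asm) Collect_cong[OF conj_cong[OF refl unbounded_component_iff[OF _ D(2), symmetric]]])
       (auto simp: space_config_space)
qed

section \<open>Multiscale site percolation\<close>

type_synonym site = "nat \<times> nat"

definition sub_blocks :: "site \<Rightarrow> site set" where
  "sub_blocks b = {3 * fst b..<3 * fst b + 3} \<times> {3 * snd b..<3 * snd b + 3}"

text \<open>A block of level \<open>n\<close> stands for a square of \<open>3 ^ n\<close> by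
  \<open>3 ^ n\<close> sites of the quadrant; its index is the position in the grid of blocks of
  that level.\<close>

primrec good_block :: "(site \<Rightarrow> bool) \<Rightarrow> nat \<Rightarrow> site \<Rightarrow> bool" where
  "good_block G 0 b = G b"
| "good_block G (Suc n) b = (card {c \<in> sub_blocks b. \<not> good_block G n c} \<le> 1)"

text \<open>Only sites reached through good sub-blocks at every level contribute; a good site inside
  a bad sub-block is dropped, since nothing links it to the rest.\<close>

primrec block_union :: "(site \<Rightarrow> bool) \<Rightarrow> (site \<Rightarrow> 'a set) \<Rightarrow> nat \<Rightarrow> site \<Rightarrow> 'a set" where
  "block_union G C 0 b = C b"
| "block_union G C (Suc n) b = (\<Union>c \<in> {c \<in> sub_blocks b. good_block G n c}. block_union G C n c)"

text \<open>Oriented to the right or upwards; the reverse direction is supplied by the symmetry of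
  the relation that is being linked.\<close>

definition next_to :: "site \<Rightarrow> site \<Rightarrow> bool" where
  "next_to b c \<longleftrightarrow> c = (Suc (fst b), snd b) \<or> c = (fst b, Suc (snd b))"

lemma finite_sub_blocks [simp, intro]: "finite (sub_blocks b)"
  by (simp add: sub_blocks_def)

lemma card_sub_blocks [simp]: "card (sub_blocks b) = 9"
  by (simp add: sub_blocks_def card_cartesian_product)

lemma sub_blocks_disjoint:
  assumes "c \<in> sub_blocks b" "c \<in> sub_blocks b'" shows "b = b'"
proof -
  have "fst b = fst c div 3" "snd b = snd c div 3" "fst b' = fst c div 3" "snd b' = snd c div 3"
    using assms by (auto simp: sub_blocks_def)
  then show ?thesis by (simp add: prod_eq_iff)
qed

lemma card_le_1D: "card A \<le> 1 \<Longrightarrow> finite A \<Longrightarrow> x \<in> A \<Longrightarrow> y \<in> A \<Longrightarrow> x = y"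
  by (metis One_nat_def card_le_Suc0_iff_eq)

lemma line_linked:
  assumes trans: "\<And>x y z. r x y \<Longrightarrow> r y z \<Longrightarrow> r x z" and sym: "\<And>x y. r x y \<Longrightarrow> r y x"
    and step: "\<And>i. a \<le> i \<Longrightarrow> i < a + 2 \<Longrightarrow> r (f i) (f (Suc i))"
    and i: "a \<le> i" "i < a + 3" and j: "a \<le> j" "j < a + 3"
  shows "r (f i) (f j)"
proof -
  have s: "r (f a) (f (Suc a))" "r (f (Suc a)) (f (Suc (Suc a)))"
    using step[of a] step[of "Suc a"] by auto
  have "i = a \<or> i = Suc a \<or> i = Suc (Suc a)" "j = a \<or> j = Suc a \<or> j = Suc (Suc a)"
    using i j by auto
  then show ?thesis
    by (elim disjE) (use s sym trans in meson)+
qed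

text \<open>If the only bad sub-block is in column \<open>a\<close> and row \<open>b\<close>, then all other columns and rows are
  entirely good; each of these columns meets each of these rows, and every good sub-block lies in one
  of them.\<close>

lemma sub_blocks_linked:
  assumes card: "card {c \<in> sub_blocks b. \<not> g c} \<le> 1"
    and trans: "\<And>x y z. r x y \<Longrightarrow> r y z \<Longrightarrow> r x z" and sym: "\<And>x y. r x y \<Longrightarrow> r y x"
    and step: "\<And>c d. c \<in> sub_blocks b \<Longrightarrow> d \<in> sub_blocks b \<Longrightarrow> g c \<Longrightarrow> g d \<Longrightarrow> next_to c d \<Longrightarrow> r c d"
    and u: "u \<in> sub_blocks b" "g u" and v: "v \<in> sub_blocks b" "g v"
  shows "r u v"
proof -
  define x0 y0 where "x0 = 3 * fst b" and "y0 = 3 * snd b"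
  have sub: "(x, y) \<in> sub_blocks b \<longleftrightarrow> x0 \<le> x \<and> x < x0 + 3 \<and> y0 \<le> y \<and> y < y0 + 3" for x y
    by (auto simp: sub_blocks_def x0_def y0_def)
  \<comment> \<open>If there is no bad sub-block, any pair serves as the exceptional
    position.\<close>
  obtain wx wy where w: "\<And>c. c \<in> sub_blocks b \<Longrightarrow> c \<noteq> (wx, wy) \<Longrightarrow> g c"
  proof (cases "\<exists>c\<in>sub_blocks b. \<not> g c")
    case True
    then obtain c where c: "c \<in> sub_blocks b" "\<not> g c" by blast
    have "d \<in> sub_blocks b \<Longrightarrow> d \<noteq> c \<Longrightarrow> g d" for d
      using card_le_1D[OF card, of c d] c by auto
    with that[of "fst c" "snd c"] show ?thesis by auto
  qed (use that in auto)
  have col: "r (x, y) (x, y')" if "x \<noteq> wx" "x0 \<le> x" "x < x0 + 3" "y0 \<le> y" "y < y0 + 3" "y0 \<le> y'" "y' < y0 + 3"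
    for x y y'
    by (rule line_linked[of r y0 "\<lambda>y. (x, y)", OF trans sym])
       (use that in \<open>auto intro!: step w simp: sub next_to_def\<close>)
  have row: "r (x, y) (x', y)" if "y \<noteq> wy" "y0 \<le> y" "y < y0 + 3" "x0 \<le> x" "x < x0 + 3" "x0 \<le> x'" "x' < x0 + 3"
    for x x' y
    by (rule line_linked[of r x0 "\<lambda>x. (x, y)", OF trans sym])
       (use that in \<open>auto intro!: step w simp: sub next_to_def\<close>)
  \<comment> \<open>A column and a row that avoid the exceptional position; their crossing
    \<open>(p, q)\<close> is the hub to which every good sub-block is linked.\<close>
  obtain p where p: "p \<noteq> wx" "x0 \<le> p" "p < x0 + 3"
    using that[of x0] that[of "Suc x0"] by (cases "wx = x0") auto
  obtain q where q: "q \<noteq> wy" "y0 \<le> q" "q < y0 + 3"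
    using that[of y0] that[of "Suc y0"] by (cases "wy = y0") auto
  have centre: "r c (p, q)" if c: "c \<in> sub_blocks b" "g c" for c
  proof -
    obtain x y where xy: "c = (x, y)" by force
    show ?thesis
    proof (cases "x = wx")
      case False
      then show ?thesis
        using c p q xy col[of x y q] row[of q x p] trans by (auto simp: sub)
    next
      case True
      show ?thesis
      proof (cases "y = wy")
        case False
        then show ?thesis
          using c p q xy row[of y x p] col[of p y q] trans by (auto simp: sub)
      next
        \<comment> \<open>A good sub-block at the exceptional position means that no sub-block is
          bad, so even its own row can be used.\<close>
        case y: True
        have "c \<in> sub_blocks b" "g (x, y)" using c xy by auto
        then have all: "\<And>d. d \<in> sub_blocks b \<Longrightarrow> g d"
          using w True y by blast
        have "r (x, y) (p, y)"
          by (rule line_linked[of r x0 "\<lambda>x. (x, y)", OF trans sym])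
             (use c p xy in \<open>auto intro!: step all simp: sub next_to_def\<close>)
        then show ?thesis
          using c p q xy col[of p y q] trans by (auto simp: sub)
      qed
    qed
  qed
  show ?thesis
    using centre[OF u] centre[OF v] sym trans by blast
qed

lemma good_one_of_two:
  assumes "good_block G (Suc n) b" "c \<in> sub_blocks b" "d \<in> sub_blocks b" "c \<noteq> d"
  shows "good_block G n c \<or> good_block G n d"
  using assms card_le_1D[of "{c \<in> sub_blocks b. \<not> good_block G n c}" c d] by auto

text \<open>The last column has three sub-blocks, of which at most one is bad. Choosing there,
  rather than anywhere, moves away from the origin and later yields unboundedness.\<close>

lemma good_sub_block:
  assumes "good_block G (Suc n) b"
  obtains c where "c \<in> sub_blocks b" "good_block G n c" "fst c = 3 * fst b + 2"
proof -
  let ?c = "(3 * fst b + 2, 3 * snd b)" and ?d = "(3 * fst b + 2, Suc (3 * snd b))"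
  have "?c \<in> sub_blocks b" "?d \<in> sub_blocks b"
    by (simp_all add: sub_blocks_def)
  with good_one_of_two[OF assms, of ?c ?d] that[of ?c] that[of ?d] show ?thesis
    by auto
qed

text \<open>The two claims need a joint induction: connectedness of a block rests on the linking of
  adjacent sub-blocks one level below, and linking of adjacent blocks rests on a pair of good
  sub-blocks facing each other across the common side.\<close>

lemma block_union_connected:
  fixes C :: "site \<Rightarrow> 'a::topological_space set"
  assumes C: "\<And>b. G b \<Longrightarrow> connected (C b) \<and> C b \<noteq> {}"
    and meet: "\<And>b c. G b \<Longrightarrow> G c \<Longrightarrow> next_to b c \<Longrightarrow> C b \<inter> C c \<noteq> {}"
  shows "good_block G n b \<Longrightarrow> connected (block_union G C n b) \<and> block_union G C n b \<noteq> {}"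
    and "good_block G n b \<Longrightarrow> good_block G n c \<Longrightarrow> next_to b c \<Longrightarrow>
      connected (block_union G C n b \<union> block_union G C n c)"
proof (induction n arbitrary: b c)
  case 0
  {
    case 1
    then show ?case using C by simp
  next
    case 2
    then show ?case using C[of b] C[of c] meet[of b c] by (simp add: connected_Un)
  }
next
  case (Suc n)
  let ?S = "block_union G C n"
  have conn: "connected (block_union G C (Suc n) b) \<and> block_union G C (Suc n) b \<noteq> {}"
    if b: "good_block G (Suc n) b" for b
  proof -
    let ?T = "block_union G C (Suc n) b"
    \<comment> \<open>Nonemptiness is part of the relation because transitivity has to pass through
      a point of the middle set.\<close>
    define r where "r c d \<longleftrightarrow> (\<forall>x\<in>?S c. \<forall>y\<in>?S d. connected_component ?T x y) \<and> ?S c \<noteq> {} \<and> ?S d \<noteq> {}" for c d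
    have link: "r c d" if "c \<in> sub_blocks b" "d \<in> sub_blocks b" "good_block G n c" "good_block G n d" for c d
    proof (rule sub_blocks_linked[of b "good_block G n" r c d])
      show "card {c \<in> sub_blocks b. \<not> good_block G n c} \<le> 1"
        using b by simp
      show "r x z" if "r x y" "r y z" for x y z
        using that unfolding r_def by (metis connected_component_trans ex_in_conv)
      show "r y x" if "r x y" for x y
        using that unfolding r_def by (metis connected_component_sym)
      show "r x y" if "x \<in> sub_blocks b" "y \<in> sub_blocks b" "good_block G n x" "good_block G n y" "next_to x y" for x y
      proof -
        have "connected (?S x \<union> ?S y)" "?S x \<noteq> {}" "?S y \<noteq> {}"
          using Suc that by auto
        moreover have "?S x \<union> ?S y \<subseteq> ?T"
          using that by auto
        ultimately show ?thesis
          unfolding r_def by (auto intro!: connected_componentI[of "?S x \<union> ?S y"])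
      qed
    qed (use that in auto)
    have "connected ?T"
    proof (subst connected_iff_connected_component, intro ballI)
      fix x y assume "x \<in> ?T" "y \<in> ?T"
      then obtain c d where "c \<in> sub_blocks b" "good_block G n c" "x \<in> ?S c"
         "d \<in> sub_blocks b" "good_block G n d" "y \<in> ?S d"
        by auto
      with link[of c d] show "connected_component ?T x y"
        by (auto simp: r_def)
    qed
    moreover obtain c where c: "c \<in> sub_blocks b" "good_block G n c"
      using good_sub_block[OF b] by blast
    have "?T \<noteq> {}"
      using Suc(1)[OF c(2)] c by (simp only: block_union.simps) blast
    ultimately show ?thesis by simp
  qed
  {
    case 1
    with conn show ?case by blast
  next
    case 2
    note bc = 2
    obtain x y where b: "b = (x, y)" by force
    have bad_b: "d \<in> sub_blocks b \<Longrightarrow> d' \<in> sub_blocks b \<Longrightarrow> d \<noteq> d' \<Longrightarrow> good_block G n d \<or> good_block G n d'" for d d'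
      using good_one_of_two bc by blast
    have bad_c: "d \<in> sub_blocks c \<Longrightarrow> d' \<in> sub_blocks c \<Longrightarrow> d \<noteq> d' \<Longrightarrow> good_block G n d \<or> good_block G n d'" for d d'
      using good_one_of_two bc by blast
    \<comment> \<open>\<open>D i\<close> and \<open>E i\<close> are the sub-blocks facing each other
      across the common side, vertical in the first case and horizontal in the second.\<close>
    define D where "D i = (if c = (Suc x, y) then (3 * x + 2, 3 * y + i) else (3 * x + i, 3 * y + 2))" for i
    define E where "E i = (if c = (Suc x, y) then (3 * x + 3, 3 * y + i) else (3 * x + i, 3 * y + 3))" for i
    have DE: "i < 3 \<Longrightarrow> D i \<in> sub_blocks b" "i < 3 \<Longrightarrow> E i \<in> sub_blocks c" "next_to (D i) (E i)"
       "D i = D j \<longleftrightarrow> i = j" "E i = E j \<longleftrightarrow> i = j" for i j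
      using bc(3) by (auto simp: b D_def E_def sub_blocks_def next_to_def)
    \<comment> \<open>Each of the two blocks spoils at most one of the three facing pairs, so one
      pair survives.\<close>
    have "\<exists>i<3. good_block G n (D i) \<and> good_block G n (E i)"
      using bad_b[OF DE(1) DE(1), of 0 1] bad_b[OF DE(1) DE(1), of 0 2] bad_b[OF DE(1) DE(1), of 1 2]
        bad_c[OF DE(2) DE(2), of 0 1] bad_c[OF DE(2) DE(2), of 0 2] bad_c[OF DE(2) DE(2), of 1 2] DE(4,5)
      by (simp add: numeral_3_eq_3 numeral_2_eq_2 Ex_less_Suc) blast
    then have "\<exists>d e. d \<in> sub_blocks b \<and> e \<in> sub_blocks c \<and> next_to d e \<and> good_block G n d \<and> good_block G n e"
      using DE by blast
    then obtain d e where de: "d \<in> sub_blocks b" "e \<in> sub_blocks c" "next_to d e"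
      "good_block G n d" "good_block G n e" by blast
    let ?Tb = "block_union G C (Suc n) b" and ?Tc = "block_union G C (Suc n) c"
    have 3: "connected (?S d \<union> ?S e)" "?S d \<noteq> {}" "?S e \<noteq> {}"
      using Suc de by auto
    have sub: "?S d \<subseteq> ?Tb" "?S e \<subseteq> ?Tc"
      using de by auto
    have "connected (?Tb \<union> (?S d \<union> ?S e))"
      by (rule connected_Un[where s = ?Tb and t = "?S d \<union> ?S e"]) (use conn[OF bc(1)] 3 sub in blast)+
    then have "connected ((?Tb \<union> (?S d \<union> ?S e)) \<union> ?Tc)"
      by (rule connected_Un[where s = "?Tb \<union> (?S d \<union> ?S e)" and t = ?Tc]) (use conn[OF bc(2)] 3 sub in blast)+
    moreover have "(?Tb \<union> (?S d \<union> ?S e)) \<union> ?Tc = ?Tb \<union> ?Tc"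
      using sub by auto
    ultimately show ?case by simp
  }
qed

lemma block_union_subset:
  assumes "\<And>b. G b \<Longrightarrow> C b \<subseteq> A"
  shows "good_block G n b \<Longrightarrow> block_union G C n b \<subseteq> A"
  by (induction n arbitrary: b) (use assms in auto)

text \<open>The index is multiplied by at least 3 with each level of descent; a sub-block with
  positive first coordinate therefore contains sites arbitrarily far out as \<open>n\<close>
  grows.\<close>

lemma block_union_site:
  assumes "good_block G n b"
  shows "\<exists>c. G c \<and> fst c \<ge> 3 ^ n * fst b \<and> C c \<subseteq> block_union G C n b"
  using assms
proof (induction n arbitrary: b)
  case 0
  then show ?case by (intro exI[of _ b]) simp
next
  case (Suc n)
  obtain c where c: "c \<in> sub_blocks b" "good_block G n c"
    using good_sub_block[OF Suc.prems] by blast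
  obtain d where d: "G d" "3 ^ n * fst c \<le> fst d" "C d \<subseteq> block_union G C n c"
    using Suc.IH[OF c(2)] by blast
  have "3 ^ n * (3 * fst b) \<le> 3 ^ n * fst c"
    using c(1) by (intro mult_left_mono) (auto simp: sub_blocks_def)
  then have "3 ^ n * (3 * fst b) \<le> fst d"
    using d(2) by (rule order_trans)
  then have "3 ^ Suc n * fst b \<le> fst d"
    by (simp only: power_Suc2 mult.assoc)
  with c d show ?case
    by (intro exI[of _ d]) auto
qed

text \<open>The deterministic half of both percolation proofs. The sets \<open>C b\<close> will be
  circles in one case and balls in the other; \<open>D\<close> absorbs their radius, so that the
  distance from the origin still grows linearly with the site index.\<close>

lemma good_blocks_unbounded:
  fixes C :: "site \<Rightarrow> 'a::real_normed_vector set"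
  assumes C: "\<And>b. G b \<Longrightarrow> connected (C b) \<and> C b \<noteq> {} \<and> C b \<subseteq> A"
    and meet: "\<And>b c. G b \<Longrightarrow> G c \<Longrightarrow> next_to b c \<Longrightarrow> C b \<inter> C c \<noteq> {}"
    and far: "\<And>b x. G b \<Longrightarrow> x \<in> C b \<Longrightarrow> norm x \<ge> s * real (fst b) - D" and "s > 0"
    and good: "\<And>n. good_block G n (0, 0)"
  shows "\<exists>U. U \<subseteq> A \<and> connected U \<and> \<not> bounded U"
proof -
  let ?S = "\<lambda>n. block_union G C n (0, 0)"
  have S: "connected (?S n)" "?S n \<noteq> {}" for n
    using block_union_connected(1)[of G C n "(0, 0)"] C meet good by auto
  \<comment> \<open>The block at the origin is a sub-block of its successor with the same index,
    which makes the unions increasing in the level.\<close>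
  have "(0, 0) \<in> sub_blocks (0, 0)"
    by (simp add: sub_blocks_def)
  then have mono: "?S n \<subseteq> ?S (Suc n)" for n
    using good[of n] by auto
  have mono0: "?S 0 \<subseteq> ?S n" for n
    by (induction n) (use mono in blast)+
  have "connected (\<Union>n. ?S n)"
  proof (rule connected_Union)
    show "\<Inter> (range ?S) \<noteq> {}"
      using S(2)[of 0] mono0 by blast
  qed (use S in auto)
  moreover have "(\<Union>n. ?S n) \<subseteq> A"
    using block_union_subset[of G C A] C good by blast
  moreover have "\<not> bounded (\<Union>n. ?S n)"
  proof
    assume "bounded (\<Union>n. ?S n)"
    then obtain K where K: "\<And>n x. x \<in> ?S n \<Longrightarrow> norm x \<le> K"
      by (auto simp: bounded_iff)
    obtain n :: nat where n: "real n > (K + D) / s"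
      using reals_Archimedean2 by blast
    obtain c where c: "c \<in> sub_blocks (0, 0)" "good_block G n c" "fst c = 2"
      using good_sub_block[OF good, of n] by (metis fst_conv mult_zero_right add_0)
    obtain d where d: "G d" "3 ^ n * fst c \<le> fst d" "C d \<subseteq> block_union G C n c"
      using block_union_site[of G n c C, OF c(2)] by blast
    moreover have "block_union G C n c \<subseteq> ?S (Suc n)"
      unfolding block_union.simps using c by blast
    ultimately obtain x where x: "x \<in> C d" "x \<in> ?S (Suc n)"
      using C[OF d(1)] by blast
    have "n < 2 ^ n" "2 ^ n \<le> (3::nat) ^ n"
      by (rule less_exp, rule power_mono) simp_all
    then have "n \<le> 3 ^ n * fst c"
      unfolding c(3) by linarith
    with d have "real n \<le> real (fst d)"
      by linarith
    then have "s * real n \<le> s * real (fst d)"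
      using \<open>s > 0\<close> by simp
    moreover have "s * real n > K + D"
      using n \<open>s > 0\<close> by (simp add: field_simps)
    ultimately have "s * real (fst d) - D > K"
      by linarith
    with far[OF d(1) x(1)] K[OF x(2)] show False by simp
  qed
  ultimately show ?thesis by blast
qed

section \<open>Probability of bad blocks\<close>

text \<open>Solution of the recursion \<open>x (n + 1) = 36 * x n ^ 2\<close> with
  \<open>x 0 = q\<close>: the quantity \<open>36 * x n\<close> is squared at each level.\<close>

definition block_bound :: "real \<Rightarrow> nat \<Rightarrow> real" where
  "block_bound q n = (36 * q) ^ (2 ^ n) / 36"

lemma block_bound_Suc: "block_bound q (Suc n) = 36 * (block_bound q n)\<^sup>2"
  by (simp add: block_bound_def power_mult power_divide power2_eq_square mult_2 power_add)

text \<open>Since 1/144 is a quarter of 1/36, the base \<open>36 * q\<close> is at most 1/4; the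
  estimate \<open>2 ^ n \<ge> n + 1\<close> then weakens doubly exponential decay to a geometric
  series that is easy to sum.\<close>

lemma block_bound_le:
  assumes "0 \<le> q" "q \<le> 1 / 144"
  shows "block_bound q n \<le> (1 / 4) ^ Suc n / 36"
proof -
  have *: "(36 * q) ^ (2 ^ n) \<le> (1 / 4) ^ (2 ^ n)"
    using assms by (intro power_mono) auto
  also have "\<dots> \<le> (1 / 4) ^ Suc n"
    using less_exp[of n] by (intro power_decreasing) (auto simp: Suc_le_eq)
  finally show ?thesis
    unfolding block_bound_def by (rule divide_right_mono) simp
qed

context prob_space
begin

lemma sets_good_block:
  assumes "\<And>b. {\<omega> \<in> space M. G \<omega> b} \<in> events"
  shows "{\<omega> \<in> space M. good_block (G \<omega>) n b} \<in> events"
proof (induction n arbitrary: b)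
  case (Suc n)
  have "{\<omega> \<in> space M. good_block (G \<omega>) (Suc n) b} =
      {\<omega> \<in> space M. \<forall>c\<in>sub_blocks b. \<forall>d\<in>sub_blocks b. c \<noteq> d \<longrightarrow> good_block (G \<omega>) n c \<or> good_block (G \<omega>) n d}"
    by (auto simp: card_le_Suc0_iff_eq)
  also have "\<dots> \<in> events"
    using Suc by (intro sets.sets_Collect_finite_All) (auto intro!: sets.sets_Collect)
  finally show ?case .
qed (use assms in simp)

text \<open>A bad block contains two bad sub-blocks, which can be chosen in \<open>9 choose 2 = 36\<close> ways.\<close>

lemma prob_bad_blocks:
  assumes meas: "\<And>b. {\<omega> \<in> space M. G \<omega> b} \<in> events" and "q \<ge> 0"
    and bad: "\<And>F. finite F \<Longrightarrow> prob {\<omega> \<in> space M. \<forall>b\<in>F. \<not> G \<omega> b} \<le> q ^ card F"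
  shows "finite T \<Longrightarrow> prob {\<omega> \<in> space M. \<forall>b\<in>T. \<not> good_block (G \<omega>) n b} \<le> block_bound q n ^ card T"
proof (induction n arbitrary: T)
  case 0
  then show ?case using bad by (simp add: block_bound_def)
next
  case (Suc n)
  define Pr where "Pr b = {p. p \<subseteq> sub_blocks b \<and> card p = 2}" for b
  \<comment> \<open>All ways to name two bad sub-blocks in each block of \<open>T\<close>.
    Sub-blocks of different blocks are distinct, so every choice names \<open>2 * card T\<close> of
    them and the induction hypothesis applies to their union; this is why the bound is carried for
    all finite sets at once.\<close>
  define Ch where "Ch = PiE T Pr"
  have card_Pr: "card (Pr b) = 36" for b
  proof -
    have "card (Pr b) = 9 choose 2"
      unfolding Pr_def by (subst n_subsets) auto
    also have "\<dots> = 36" by (simp add: choose_two)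
    finally show ?thesis .
  qed
  have finPr: "finite (Pr b)" for b
    unfolding Pr_def by (rule finite_subset[of _ "Pow (sub_blocks b)"]) auto
  have finCh: "finite Ch"
    unfolding Ch_def using Suc finPr by (intro finite_PiE) auto
  have cardCh: "card Ch = 36 ^ card T"
    unfolding Ch_def using Suc by (simp add: card_PiE card_Pr)
  define Ev where "Ev f = {\<omega> \<in> space M. \<forall>c\<in>(\<Union>b\<in>T. f b). \<not> good_block (G \<omega>) n c}" for f :: "site \<Rightarrow> site set"
  have fin: "finite (\<Union>b\<in>T. f b)" and card2: "card (\<Union>b\<in>T. f b) = 2 * card T" if "f \<in> Ch" for f
  proof -
    have f: "f b \<subseteq> sub_blocks b" "card (f b) = 2" "finite (f b)" if "b \<in> T" for b
      using \<open>f \<in> Ch\<close> that finite_subset[OF _ finite_sub_blocks, of "f b" b]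
      by (auto simp: Ch_def Pr_def PiE_iff)
    then show "finite (\<Union>b\<in>T. f b)" using Suc by auto
    have "card (\<Union>b\<in>T. f b) = (\<Sum>b\<in>T. card (f b))"
      using f sub_blocks_disjoint Suc by (intro card_UN_disjoint) blast+
    then show "card (\<Union>b\<in>T. f b) = 2 * card T" using f by simp
  qed
  have Ev_meas: "Ev f \<in> events" if "f \<in> Ch" for f
    unfolding Ev_def using fin[OF that] sets_good_block[OF meas]
    by (intro sets.sets_Collect_finite_All) (auto intro!: sets.sets_Collect)
  have "{\<omega> \<in> space M. \<forall>b\<in>T. \<not> good_block (G \<omega>) (Suc n) b} \<subseteq> (\<Union>f\<in>Ch. Ev f)"
  proof safe
    fix \<omega> assume \<omega>: "\<omega> \<in> space M" "\<forall>b\<in>T. \<not> good_block (G \<omega>) (Suc n) b"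
    have "\<exists>p\<in>Pr b. \<forall>c\<in>p. \<not> good_block (G \<omega>) n c" if "b \<in> T" for b
    proof -
      have "2 \<le> card {c \<in> sub_blocks b. \<not> good_block (G \<omega>) n c}"
        using \<omega>(2) that by auto
      then obtain p where "p \<subseteq> {c \<in> sub_blocks b. \<not> good_block (G \<omega>) n c}" "card p = 2"
        by (rule obtain_subset_with_card_n)
      then show ?thesis by (intro bexI[of _ p]) (auto simp: Pr_def)
    qed
    then obtain f where f: "\<And>b. b \<in> T \<Longrightarrow> f b \<in> Pr b" "\<And>b c. b \<in> T \<Longrightarrow> c \<in> f b \<Longrightarrow> \<not> good_block (G \<omega>) n c"
      by metis
    then have "restrict f T \<in> Ch" "\<omega> \<in> Ev (restrict f T)"
      using \<omega> by (auto simp: Ch_def Ev_def)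
    then show "\<omega> \<in> (\<Union>f\<in>Ch. Ev f)" by blast
  qed
  then have "prob {\<omega> \<in> space M. \<forall>b\<in>T. \<not> good_block (G \<omega>) (Suc n) b} \<le> prob (\<Union>f\<in>Ch. Ev f)"
    using finCh Ev_meas by (intro finite_measure_mono) auto
  also have "\<dots> \<le> (\<Sum>f\<in>Ch. prob (Ev f))"
    using finCh Ev_meas by (intro measure_UNION_le) auto
  also have "\<dots> \<le> (\<Sum>f\<in>Ch. block_bound q n ^ (2 * card T))"
  proof (intro sum_mono)
    fix f assume "f \<in> Ch"
    show "prob (Ev f) \<le> block_bound q n ^ (2 * card T)"
      unfolding Ev_def using Suc.IH[OF fin[OF \<open>f \<in> Ch\<close>]] card2[OF \<open>f \<in> Ch\<close>] by metis
  qed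
  also have "\<dots> = block_bound q (Suc n) ^ card T"
    by (simp add: cardCh block_bound_Suc power_mult power_mult_distrib)
  finally show ?case .
qed

text \<open>The failure probabilities of all levels add up to at most 1/108, so the union bound
  leaves positive probability.\<close>

lemma prob_all_blocks_good:
  assumes meas: "\<And>b. {\<omega> \<in> space M. G \<omega> b} \<in> events" and q: "q \<ge> 0" "q \<le> 1 / 144"
    and bad: "\<And>F. finite F \<Longrightarrow> prob {\<omega> \<in> space M. \<forall>b\<in>F. \<not> G \<omega> b} \<le> q ^ card F"
  shows "prob {\<omega> \<in> space M. \<forall>n. good_block (G \<omega>) n (0, 0)} > 0"
proof -
  define Bad where "Bad n = {\<omega> \<in> space M. \<not> good_block (G \<omega>) n (0, 0)}" for n
  have Bad: "Bad n \<in> events" for n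
    unfolding Bad_def using sets_good_block[OF meas] by (intro sets.sets_Collect)
  have le: "prob (Bad n) \<le> (1 / 4) ^ Suc n / 36" for n
    using prob_bad_blocks[OF meas q(1) bad, of "{(0, 0)}" n] block_bound_le[OF q, of n]
    by (simp add: Bad_def)
  have geo: "(\<lambda>n. (1 / 4) ^ Suc n / 36 :: real) sums (1 / 3 / 36)"
    using sums_divide[OF sums_mult[OF geometric_sums[of "1 / 4 :: real"], of "1 / 4"], of 36] by simp
  have "prob (\<Union>n. Bad n) \<le> (\<Sum>n. prob (Bad n))"
    using Bad le geo by (intro finite_measure_subadditive_countably)
      (auto intro!: summable_comparison_test'[OF sums_summable[OF geo], of 0])
  also have "\<dots> \<le> (\<Sum>n. (1 / 4) ^ Suc n / 36)"
    using le geo by (intro suminf_le) (auto intro!: summable_comparison_test'[OF sums_summable[OF geo], of 0] sums_summable[OF geo])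
  also have "\<dots> < 1"
    using sums_unique[OF geo] by simp
  finally have "prob (space M - (\<Union>n. Bad n)) > 0"
    using Bad by (subst prob_compl) auto
  also have "space M - (\<Union>n. Bad n) = {\<omega> \<in> space M. \<forall>n. good_block (G \<omega>) n (0, 0)}"
    by (auto simp: Bad_def)
  finally show ?thesis .
qed

end

section \<open>Counts of a Poisson process\<close>

definition pois :: "real \<Rightarrow> nat \<Rightarrow> real" where
  "pois l n = l ^ n / fact n * exp (- l)"

lemma pois_nonneg: "0 \<le> l \<Longrightarrow> 0 \<le> pois l n"
  by (simp add: pois_def)

lemma pois_pgf_sums: "(\<lambda>n. c ^ n * pois l n) sums exp (- (l * (1 - c)))"
proof -
  have "(\<lambda>n. (c * l) ^ n /\<^sub>R fact n * exp (- l)) sums (exp (c * l) * exp (- l))"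
    by (intro sums_mult2 exp_converges)
  moreover have "exp (c * l) * exp (- l) = exp (- (l * (1 - c)))"
    by (simp add: exp_add[symmetric] algebra_simps)
  ultimately show ?thesis
    by (simp add: pois_def power_mult_distrib field_simps)
qed

lemma pois_sums: "pois l sums 1"
  using pois_pgf_sums[of 1 l] by simp

lemma pois_mean_sums: "(\<lambda>n. real n * pois l n) sums l"
proof -
  have "(\<lambda>n. l * pois l n) sums (l * 1)"
    by (intro sums_mult pois_sums)
  moreover have "l * pois l n = real (Suc n) * pois l (Suc n)" for n
    by (simp add: pois_def divide_simps del: of_nat_Suc)
  ultimately have "(\<lambda>n. real (Suc n) * pois l (Suc n)) sums l"
    by simp
  then show ?thesis
    by (subst (asm) sums_Suc_iff) simp
qed

lemma suminf_pois_mean: "0 \<le> l \<Longrightarrow> (\<Sum>n. of_nat n * ennreal (pois l n)) = ennreal l"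
  using pois_mean_sums[of l]
  by (simp add: ennreal_of_nat_eq_real_of_nat ennreal_mult'[symmetric] pois_nonneg sums_iff
       suminf_ennreal2 del: suminf_ennreal)

lemma suminf_pois_pgf:
  "0 \<le> l \<Longrightarrow> 0 \<le> c \<Longrightarrow> (\<Sum>n. ennreal c ^ n * ennreal (pois l n)) = ennreal (exp (- (l * (1 - c))))"
  using pois_pgf_sums[of c l]
  by (simp add: ennreal_power ennreal_mult'[symmetric] pois_nonneg sums_iff
       suminf_ennreal2 del: suminf_ennreal)

text \<open>Natural-number counts can serve as exponents in generating functions and take values in
  a countable space. Rounding changes nothing on bounded sets, where the measure is an
  integer.\<close>

definition npoints :: "plane set \<Rightarrow> plane measure \<Rightarrow> nat" where
  "npoints B N = nat \<lfloor>measure N B\<rfloor>"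

lemma count_eqI: "emeasure N B = of_nat n \<Longrightarrow> npoints B N = n"
  by (simp add: npoints_def measure_def ennreal_of_nat_eq_real_of_nat)

lemma emeasure_count:
  assumes "N \<in> counting_measures" "B \<in> sets borel" "bounded B"
  shows "emeasure N B = of_nat (npoints B N)"
  using counting_measuresD(2)[OF assms] count_eqI by fastforce

lemma measure_count:
  assumes "N \<in> counting_measures" "B \<in> sets borel" "bounded B"
  shows "measure N B = real (npoints B N)"
  using emeasure_count[OF assms] by (simp add: measure_def ennreal_of_nat_eq_real_of_nat)

lemma measurable_count [measurable]:
  "B \<in> sets borel \<Longrightarrow> npoints B \<in> measurable config_space (count_space UNIV)"
  unfolding npoints_def[abs_def]
  by (rule measurable_compose[OF measurable_compose[OF measurable_measure_config measurable_real_floor]])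
     simp_all

lemma homogeneous_poissonD:
  assumes "homogeneous_poisson a P"
  shows "point_process P" "prob_space P" "sets P = sets config_space" "space P = counting_measures"
  using assms sets_eq_imp_space_eq[of P config_space] space_config_space
  by (auto simp: homogeneous_poisson_def point_process_def)

lemma bounded_borel_finite:
  fixes B :: "plane set"
  shows "bounded B \<Longrightarrow> emeasure lborel B = ennreal (measure lborel B)"
  using emeasure_bounded_finite[of B] by (intro emeasure_eq_ennreal_measure) auto

lemma homogeneous_poisson_count:
  assumes P: "homogeneous_poisson a P" and B: "B \<in> sets borel" "bounded B"
  shows "emeasure P {N \<in> space P. npoints B N = n} = ennreal (pois (a * measure lborel B) n)"
proof -
  interpret prob_space P using homogeneous_poissonD[OF P] by auto
  have "{N \<in> space P. npoints B N = n} = {N \<in> space P. emeasure N B = of_nat n}"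
    using homogeneous_poissonD(4)[OF P] emeasure_count[OF _ B] by auto
  moreover have "measure P {N \<in> space P. emeasure N B = of_nat n} = pois (a * measure lborel B) n"
    using P B by (auto simp: homogeneous_poisson_def pois_def)
  ultimately show ?thesis
    by (simp add: emeasure_eq_measure)
qed

lemma nn_integral_nat_valued:
  assumes [measurable]: "V \<in> measurable M (count_space UNIV)"
  shows "(\<integral>\<^sup>+ x. g (V x) \<partial>M) = (\<Sum>n::nat. g n * emeasure M {x \<in> space M. V x = n})"
proof -
  have "(\<integral>\<^sup>+ x. g (V x) \<partial>M) = (\<integral>\<^sup>+ x. (\<Sum>n. g n * indicator {x \<in> space M. V x = n} x) \<partial>M)"
  proof (intro nn_integral_cong)
    fix x assume "x \<in> space M"
    then have "(\<Sum>n. g n * indicator {x \<in> space M. V x = n} x) = (\<Sum>n\<in>{V x}. g n * indicator {x \<in> space M. V x = n} x)"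
      by (intro suminf_finite) auto
    then show "g (V x) = (\<Sum>n. g n * indicator {x \<in> space M. V x = n} x)"
      using \<open>x \<in> space M\<close> by simp
  qed
  also have "\<dots> = (\<Sum>n. g n * emeasure M {x \<in> space M. V x = n})"
    by (subst nn_integral_suminf) (auto simp: nn_integral_cmult_indicator)
  finally show ?thesis .
qed

lemma nn_integral_poisson_count:
  assumes P: "homogeneous_poisson a P" and B: "B \<in> sets borel" "bounded B"
  shows "(\<integral>\<^sup>+ N. g (npoints B N) \<partial>P) = (\<Sum>n. g n * ennreal (pois (a * measure lborel B) n))"
  using measurable_count[OF B(1)] homogeneous_poisson_count[OF P B] homogeneous_poissonD(3)[OF P]
  by (subst nn_integral_nat_valued) (auto simp: cong: measurable_cong_sets)

lemma poisson_count_pgf: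
  assumes "homogeneous_poisson a P" "B \<in> sets borel" "bounded B" "0 < a" "0 \<le> c"
  shows "(\<integral>\<^sup>+ N. ennreal c ^ npoints B N \<partial>P) = ennreal (exp (- (a * measure lborel B * (1 - c))))"
  using assms suminf_pois_pgf[of "a * measure lborel B" c]
  by (subst nn_integral_poisson_count[where g = "\<lambda>n. ennreal c ^ n"]) simp_all

lemma poisson_void_probability:
  assumes P: "homogeneous_poisson a P" and B: "B \<in> sets borel" "bounded B"
  shows "emeasure P {N \<in> space P. emeasure N B = 0} = ennreal (exp (- (a * measure lborel B)))"
proof -
  have "{N \<in> space P. emeasure N B = 0} = {N \<in> space P. npoints B N = 0}"
    using homogeneous_poissonD(4)[OF P] emeasure_count[OF _ B] by auto
  then show ?thesis
    using homogeneous_poisson_count[OF assms, of 0] by (simp add: pois_def)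
qed

text \<open>The plane is cut into annuli rather than squares, so that \<^const>\<open>mark_law\<close> also describes the
  points of a Poisson process in one cell.\<close>

definition cell :: "nat \<Rightarrow> plane set" where
  "cell c = annulus (real (Suc c)) 1"

lemma cell_iff: "x \<in> cell c \<longleftrightarrow> real c \<le> norm x \<and> norm x < real c + 1"
  by (auto simp: cell_def annulus_def)

lemma sets_annulus [measurable, simp]: "annulus R \<delta> \<in> sets borel"
  by (simp add: annulus_def)

lemma sets_cell [measurable, simp]: "cell c \<in> sets borel"
  by (simp add: cell_def)

lemma bounded_annulus [simp]: "bounded (annulus R \<delta>)"
  by (auto simp: annulus_def intro: bounded_subset)

lemma bounded_cell [simp]: "bounded (cell c)"
  by (simp add: cell_def)

lemma disjoint_cells: "disjoint_family cell"
  by (auto simp: disjoint_family_on_def cell_iff)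

lemma UN_cells: "(\<Union>c. cell c) = UNIV"
proof (intro equalityI subsetI UNIV_I)
  fix x :: plane
  have "x \<in> cell (nat \<lfloor>norm x\<rfloor>)"
    by (auto simp: cell_iff)
  then show "x \<in> (\<Union>c. cell c)" by blast
qed

lemma bounded_subset_cells:
  assumes "bounded (B :: plane set)"
  obtains C where "B \<subseteq> (\<Union>c<C. cell c)"
proof -
  from assms obtain K where K: "\<And>x. x \<in> B \<Longrightarrow> norm x \<le> K" by (auto simp: bounded_iff)
  have "B \<subseteq> (\<Union>c<nat \<lceil>K\<rceil> + 1. cell c)"
  proof
    fix x assume "x \<in> B"
    have "x \<in> cell (nat \<lfloor>norm x\<rfloor>)" by (auto simp: cell_iff)
    moreover have "nat \<lfloor>norm x\<rfloor> < nat \<lceil>K\<rceil> + 1"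
      using K[OF \<open>x \<in> B\<close>] by linarith
    ultimately show "x \<in> (\<Union>c<nat \<lceil>K\<rceil> + 1. cell c)" by blast
  qed
  then show ?thesis by (rule that)
qed

lemma emeasure_cells:
  assumes "sets N = sets borel" "B \<in> sets borel"
  shows "emeasure N B = (\<Sum>c. emeasure N (B \<inter> cell c))"
proof -
  have "emeasure N B = emeasure N (\<Union>c. B \<inter> cell c)"
    using UN_cells by (simp add: Int_UN_distrib[symmetric])
  also have "\<dots> = (\<Sum>c. emeasure N (B \<inter> cell c))"
    using assms disjoint_cells
    by (intro suminf_emeasure[symmetric]) (auto simp: disjoint_family_on_def)
  finally show ?thesis .
qed

text \<open>Poisson counts are specified on bounded sets only; summing over the cells extends the
  mean measure to all Borel sets.\<close>

lemma has_intensity_of_bounded: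
  assumes sets: "sets P = sets config_space"
    and bd: "\<And>B. B \<in> sets borel \<Longrightarrow> bounded B \<Longrightarrow> mean_measure P B = ennreal a * emeasure lborel B"
  shows "has_intensity P a"
  unfolding has_intensity_def
proof
  fix B :: "plane set" assume B: "B \<in> sets borel"
  have [measurable_cong]: "sets P = sets config_space" by fact
  have N: "N \<in> space P \<Longrightarrow> sets N = sets borel" for N
    using sets_eq_imp_space_eq[OF sets] counting_measuresD(1) by (simp add: space_config_space)
  have "mean_measure P B = (\<integral>\<^sup>+ N. (\<Sum>c. emeasure N (B \<inter> cell c)) \<partial>P)"
    unfolding mean_measure_def using N B by (intro nn_integral_cong emeasure_cells) auto
  also have "\<dots> = (\<Sum>c. mean_measure P (B \<inter> cell c))"
    unfolding mean_measure_def using B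
    by (intro nn_integral_suminf) (simp add: measurable_emeasure_config measurable_cong_sets[OF sets refl])
  also have "\<dots> = (\<Sum>c. ennreal a * emeasure lborel (B \<inter> cell c))"
    using B by (subst bd) (auto intro: bounded_subset[OF bounded_cell])
  also have "\<dots> = ennreal a * emeasure lborel B"
    using B by (subst (2) emeasure_cells) auto
  finally show "mean_measure P B = ennreal a * emeasure lborel B" .
qed

lemma homogeneous_poisson_intensity:
  assumes P: "homogeneous_poisson a P" and "0 < a"
  shows "has_intensity P a"
proof (rule has_intensity_of_bounded)
  fix B :: "plane set" assume B: "B \<in> sets borel" "bounded B"
  have "mean_measure P B = (\<integral>\<^sup>+ N. of_nat (npoints B N) \<partial>P)"
    unfolding mean_measure_def using homogeneous_poissonD(4)[OF P] emeasure_count[OF _ B]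
    by (intro nn_integral_cong) auto
  also have "\<dots> = ennreal (a * measure lborel B)"
    using \<open>0 < a\<close> by (subst nn_integral_poisson_count[OF P B]) (auto intro!: suminf_pois_mean)
  also have "\<dots> = ennreal a * emeasure lborel B"
    using \<open>0 < a\<close> B by (simp add: bounded_borel_finite ennreal_mult')
  finally show "mean_measure P B = ennreal a * emeasure lborel B" .
qed (use homogeneous_poissonD[OF P] in auto)

section \<open>Marks\<close>

lemma prod_indicator:
  assumes "finite A"
  shows "(\<Prod>a\<in>A. indicator (S a) (x a)) = (of_bool (\<forall>a\<in>A. x a \<in> S a) :: ennreal)"
  using assms by induction auto

text \<open>Only finitely many coordinates enter, so the infinite product projects onto the finite
  product over \<open>J\<close>, where the integral factorises.\<close>

lemma nn_integral_PiM_prod: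
  assumes M: "\<And>i::'i. prob_space (M i)" and J: "finite J"
    and g [measurable]: "\<And>i. g i \<in> borel_measurable (M i)"
  shows "(\<integral>\<^sup>+ \<omega>. (\<Prod>i\<in>J. g i (\<omega> i)) \<partial>PiM UNIV M) = (\<Prod>i\<in>J. \<integral>\<^sup>+ x. g i x \<partial>M i)"
proof -
  interpret product_prob_space M UNIV
    using M by (intro product_prob_spaceI)
  have "(\<integral>\<^sup>+ \<omega>. (\<Prod>i\<in>J. g i (\<omega> i)) \<partial>PiM UNIV M) =
      (\<integral>\<^sup>+ \<omega>. (\<Prod>i\<in>J. g i (restrict \<omega> J i)) \<partial>PiM UNIV M)"
    by (intro nn_integral_cong prod.cong) auto
  also have "\<dots> = (\<integral>\<^sup>+ \<omega>. (\<Prod>i\<in>J. g i (\<omega> i)) \<partial>distr (PiM UNIV M) (PiM J M) (\<lambda>\<omega>. restrict \<omega> J))"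
    by (subst nn_integral_distr) (auto intro!: borel_measurable_prod measurable_compose[OF measurable_component_singleton])
  also have "\<dots> = (\<integral>\<^sup>+ \<omega>. (\<Prod>i\<in>J. g i (\<omega> i)) \<partial>PiM J M)"
    using J by (subst distr_PiM_restrict_finite) auto
  also have "\<dots> = (\<Prod>i\<in>J. \<integral>\<^sup>+ x. g i x \<partial>M i)"
    by (intro product_nn_integral_prod J g)
  finally show ?thesis .
qed

text \<open>This factor cancels in the ratio of a disc to an annulus; elsewhere its positivity is
  what counts.\<close>

abbreviation "disc_area \<equiv> measure lborel (ball (0 :: plane) 1)"

lemma disc_area_pos: "0 < disc_area"
  by (rule content_ball_pos) simp

lemma measure_disc: "0 \<le> r \<Longrightarrow> measure lborel (ball (c :: plane) r) = r\<^sup>2 * disc_area"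
  using content_ball_conv_unit_ball[of r c] by simp

lemma measure_annulus:
  assumes "0 < \<delta>" "\<delta> \<le> R"
  shows "measure lborel (annulus R \<delta>) = disc_area * (R\<^sup>2 - (R - \<delta>)\<^sup>2)"
proof -
  have "measure lborel (annulus R \<delta>) = measure lborel (ball (0::plane) R) - measure lborel (ball (0::plane) (R - \<delta>))"
    unfolding annulus_def using assms emeasure_bounded_finite[of "ball (0::plane) R"]
    by (intro measure_Diff subset_ball) (auto simp: less_top)
  also have "measure lborel (ball (0::plane) R) = R\<^sup>2 * disc_area"
    using assms by (intro measure_disc) simp
  also have "measure lborel (ball (0::plane) (R - \<delta>)) = (R - \<delta>)\<^sup>2 * disc_area"
    using assms by (intro measure_disc) simp
  finally show ?thesis
    by (simp only: left_diff_distrib mult.commute[of disc_area])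
qed

lemma measure_annulus_pos:
  assumes "0 < \<delta>" "\<delta> \<le> R"
  shows "0 < measure lborel (annulus R \<delta>)"
proof -
  have "(R - \<delta>)\<^sup>2 < R\<^sup>2"
    using assms by (intro power_strict_mono) auto
  then show ?thesis
    unfolding measure_annulus[OF assms] by (intro mult_pos_pos disc_area_pos) simp
qed

locale mark =
  fixes R \<delta> \<mu> :: real
  assumes \<delta>: "0 < \<delta>" "\<delta> \<le> R" and \<mu>: "0 < \<mu>"
begin

abbreviation "U \<equiv> uniform_measure lborel (annulus R \<delta>) :: plane measure"

lemma annulus_pos: "0 < measure lborel (annulus R \<delta>)"
  by (rule measure_annulus_pos[OF \<delta>])

lemma emeasure_annulus:
  "emeasure lborel (annulus R \<delta>) = ennreal (measure lborel (annulus R \<delta>))"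
  "emeasure lborel (annulus R \<delta>) \<noteq> 0" "emeasure lborel (annulus R \<delta>) \<noteq> \<infinity>"
  using annulus_pos by (simp_all add: bounded_borel_finite)

lemma prob_U: "prob_space U"
  using emeasure_annulus by (intro prob_space_uniform_measure)

lemma prob_PiU: "prob_space (\<Pi>\<^sub>M i\<in>(UNIV::nat set). U)"
  by (intro prob_space_PiM prob_U)

lemma prob_mark: "prob_space (mark_law R \<delta> \<mu>)"
proof -
  interpret pair_prob_space "measure_pmf (poisson_pmf \<mu>)" "\<Pi>\<^sub>M i\<in>(UNIV::nat set). U"
    by (intro pair_prob_space.intro pair_sigma_finite.intro prob_PiU measure_pmf.prob_space_axioms
        prob_space_imp_sigma_finite)
  show ?thesis unfolding mark_law_def by unfold_locales
qed

lemma sets_mark: "sets (mark_law R \<delta> \<mu>) = sets (count_space UNIV \<Otimes>\<^sub>M (\<Pi>\<^sub>M i\<in>UNIV. borel))"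
  unfolding mark_law_def by (intro sets_pair_measure_cong sets_PiM_cong) auto

lemma nn_integral_mark:
  assumes [measurable]: "f \<in> borel_measurable (mark_law R \<delta> \<mu>)"
  shows "(\<integral>\<^sup>+ z. f z \<partial>mark_law R \<delta> \<mu>) =
    (\<Sum>k. ennreal (pois \<mu> k) * (\<integral>\<^sup>+ Y. f (k, Y) \<partial>(\<Pi>\<^sub>M i\<in>UNIV. U)))"
proof -
  interpret sigma_finite_measure "\<Pi>\<^sub>M i\<in>(UNIV::nat set). U"
    by (intro prob_space_imp_sigma_finite prob_PiU)
  have "(\<integral>\<^sup>+ z. f z \<partial>mark_law R \<delta> \<mu>) =
      (\<integral>\<^sup>+ k. \<integral>\<^sup>+ Y. f (k, Y) \<partial>(\<Pi>\<^sub>M i\<in>UNIV. U) \<partial>measure_pmf (poisson_pmf \<mu>))"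
    unfolding mark_law_def using assms
    by (intro nn_integral_fst[symmetric]) (simp add: mark_law_def)
  then show ?thesis
    using \<mu> by (simp add: nn_integral_measure_pmf nn_integral_count_space_nat pois_def)
qed

lemma measurable_mark_prod:
  assumes [measurable]: "g \<in> borel_measurable borel"
  shows "(\<lambda>z. \<Prod>i<fst z. g (snd z i) :: ennreal) \<in> borel_measurable (mark_law R \<delta> \<mu>)"
proof -
  have "(\<lambda>z. \<Prod>i<fst z. g (snd z i) :: ennreal) \<in>
      borel_measurable (count_space UNIV \<Otimes>\<^sub>M (\<Pi>\<^sub>M i\<in>(UNIV::nat set). borel))"
    by (rule measurable_compose_countable[where f = "\<lambda>n z. \<Prod>i<n. g (snd z i)" and g = fst])
       measurable
  then show ?thesis
    by (simp cong: measurable_cong_sets add: sets_mark measurable_cong_sets[OF sets_mark refl])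
qed

text \<open>Given \<open>k\<close> points the factors are independent with mean \<open>c\<close>,
  and averaging \<open>c ^ k\<close> over the Poisson number gives the exponential. An indicator for
  \<open>g\<close> yields void probabilities, a product of weights \<open>s j\<close> yields joint
  generating functions, and \<open>g = 0\<close> the probability of having no point.\<close>

lemma mark_pgf:
  assumes [measurable]: "g \<in> borel_measurable borel"
    and g: "(\<integral>\<^sup>+ x. g x \<partial>U) = ennreal c" "0 \<le> c"
  shows "(\<integral>\<^sup>+ z. (\<Prod>i<fst z. g (snd z i)) \<partial>mark_law R \<delta> \<mu>) = ennreal (exp (- (\<mu> * (1 - c))))"
proof -
  have "(\<integral>\<^sup>+ z. (\<Prod>i<fst z. g (snd z i)) \<partial>mark_law R \<delta> \<mu>) =
    (\<Sum>k. ennreal (pois \<mu> k) * (\<integral>\<^sup>+ Y. (\<Prod>i<k. g (Y i)) \<partial>(\<Pi>\<^sub>M i\<in>UNIV. U)))"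
    by (subst nn_integral_mark) (auto intro: measurable_mark_prod)
  also have "\<dots> = (\<Sum>k. ennreal (pois \<mu> k) * ennreal c ^ k)"
    using g by (subst nn_integral_PiM_prod) (auto intro: prob_U)
  also have "\<dots> = ennreal (exp (- (\<mu> * (1 - c))))"
    using suminf_pois_pgf[of \<mu> c] \<mu> g by (simp add: mult.commute)
  finally show ?thesis .
qed

lemma nn_integral_mark_point:
  assumes [measurable]: "g \<in> borel_measurable borel"
  shows "(\<integral>\<^sup>+ z. indicator {..<fst z} i * g (snd z i) \<partial>mark_law R \<delta> \<mu>) =
     (\<Sum>k. ennreal (pois \<mu> k) * indicator {..<k} i) * (\<integral>\<^sup>+ y. g y \<partial>U)"
proof -
  have [measurable]: "(\<lambda>z. indicator {..<fst z} i * g (snd z i) :: ennreal) \<in> borel_measurable (mark_law R \<delta> \<mu>)"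
    unfolding mark_law_def indicator_def by measurable
  have "(\<integral>\<^sup>+ Y. g (Y i) \<partial>(\<Pi>\<^sub>M i\<in>UNIV. U)) = (\<integral>\<^sup>+ y. g y \<partial>U)"
    using nn_integral_PiM_prod[of "\<lambda>_. U" "{i}" "\<lambda>_. g"] prob_U by simp
  then have "(\<integral>\<^sup>+ Y. indicator {..<k} i * g (Y i) \<partial>(\<Pi>\<^sub>M i\<in>UNIV. U)) = indicator {..<k} i * (\<integral>\<^sup>+ y. g y \<partial>U)" for k
    by (subst nn_integral_cmult) auto
  then show ?thesis
    by (subst nn_integral_mark) (auto simp: mult.assoc[symmetric])
qed

text \<open>The mean as the sum of the tails: point number \<open>i\<close> is present iff the
  Poisson number exceeds \<open>i\<close>, and exchanging the sums turns the tails into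
  \<open>k * pois \<mu> k\<close>.\<close>

lemma suminf_mark_tail:
  "(\<Sum>i. \<Sum>k. ennreal (pois \<mu> k) * indicator {..<k} i) = ennreal \<mu>"
proof -
  have "(\<Sum>i. \<Sum>k. ennreal (pois \<mu> k) * indicator {..<k} i) =
      (\<integral>\<^sup>+ i. \<integral>\<^sup>+ k. ennreal (pois \<mu> k) * indicator {..<k} i \<partial>count_space UNIV \<partial>count_space UNIV)"
    by (simp add: nn_integral_count_space_nat)
  also have "\<dots> = (\<integral>\<^sup>+ k. \<integral>\<^sup>+ i. ennreal (pois \<mu> k) * indicator {..<k} i \<partial>count_space UNIV \<partial>count_space UNIV)"
    using nn_integral_fst_count_space[of "\<lambda>(i, k). ennreal (pois \<mu> k) * indicator {..<k} i"]
      nn_integral_snd_count_space[of "\<lambda>(i, k). ennreal (pois \<mu> k) * indicator {..<k} i"] by simp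
  also have "\<dots> = (\<Sum>k. of_nat k * ennreal (pois \<mu> k))"
    by (simp add: nn_integral_count_space_nat[symmetric] nn_integral_cmult_indicator mult.commute)
  also have "\<dots> = ennreal \<mu>"
    using \<mu> by (intro suminf_pois_mean) simp
  finally show ?thesis .
qed

end

section \<open>Generating functions\<close>

text \<open>The series vanishes only to the right of 0. Once the lower coefficients are known to be
  zero, dividing by \<open>t ^ n\<close> and letting \<open>t\<close> decrease to 0 isolates the
  next one.\<close>

lemma powser_zero_imp_coeff_zero:
  fixes h :: "nat \<Rightarrow> real"
  assumes h: "\<And>t. 0 < t \<Longrightarrow> t < 1 \<Longrightarrow> (\<lambda>n. h n * t ^ n) sums 0"
  shows "h n = 0"
proof (induction n rule: less_induct)
  case (less n)
  let ?a = "\<lambda>k. h (k + n)"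
  have sums0: "(\<lambda>k. ?a k * t ^ k) sums 0" if t: "0 < t" "t < 1" for t
  proof -
    have "(\<lambda>k. h (k + n) * t ^ (k + n)) sums (0 - (\<Sum>i<n. h i * t ^ i))"
      using h[OF t] by (rule sums_split_initial_segment)
    then have "(\<lambda>k. (h (k + n) * t ^ (k + n)) * inverse (t ^ n)) sums (0 * inverse (t ^ n))"
      using less by (intro sums_mult2) simp
    moreover have "h (k + n) * t ^ (k + n) * inverse (t ^ n) = ?a k * t ^ k" for k
      using t by (simp add: power_add mult.assoc)
    ultimately show ?thesis
      by simp
  qed
  \<comment> \<open>Convergence at the single positive point 1/2 gives convergence on a two-sided
    neighbourhood of 0, hence continuity there.\<close>
  have summ: "summable (\<lambda>k. ?a k * x ^ k)" if "norm x < 1 / 2" for x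
    by (rule powser_inside[of ?a "1 / 2", OF sums_summable[OF sums0]]) (use that in auto)
  define f where "f x = (\<Sum>k. ?a k * x ^ k)" for x
  have "(f \<longlongrightarrow> ?a 0) (at 0)"
    by (rule powser_limit_0[of "1 / 2"]) (use summ in \<open>auto simp: f_def intro: summable_sums\<close>)
  then have "(f \<longlongrightarrow> ?a 0) (at_right 0)"
    by (rule filterlim_mono) (auto simp: at_within_le_at)
  moreover have "(f \<longlongrightarrow> 0) (at_right 0)"
  proof (rule tendsto_eventually)
    have "\<forall>\<^sub>F x in at_right (0::real). x \<in> {0<..<1}"
      by (rule eventually_at_right_real) simp
    then show "\<forall>\<^sub>F x in at_right 0. f x = 0"
      by eventually_elim (use sums_unique[OF sums0] in \<open>auto simp: f_def\<close>)
  qed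
  ultimately show ?case
    using tendsto_unique[of "at_right (0::real)"] by force
qed

lemma suminf_ennreal_sums:
  assumes "\<And>n. 0 \<le> f n" "0 \<le> x" "(\<Sum>n. ennreal (f n)) = ennreal x"
  shows "f sums x"
proof -
  have "(\<lambda>n. ennreal (f n)) sums ennreal x"
    using summable_sums[OF summableI, of "\<lambda>n. ennreal (f n)"] unfolding assms(3) .
  then show ?thesis
    by (subst (asm) sums_ennreal) (use assms in auto)
qed

text \<open>The factor \<open>C\<close> holds the contribution of the other variables while one
  variable is being resolved.\<close>

lemma pgf_coeff_unique:
  fixes e :: "nat \<Rightarrow> ennreal"
  assumes e: "\<And>n. e n \<noteq> \<infinity>" and "0 \<le> l" and C: "C \<noteq> \<infinity>"
    and eq: "\<And>t. 0 < t \<Longrightarrow> t < 1 \<Longrightarrow> (\<Sum>n. ennreal t ^ n * e n) = C * ennreal (exp (- (l * (1 - t))))"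
  shows "e n = C * ennreal (pois l n)"
proof -
  define e' where "e' n = enn2real (e n)" for n
  have e': "e n = ennreal (e' n)" "0 \<le> e' n" for n
    using e[of n] by (simp_all add: e'_def less_top)
  define c where "c = enn2real C"
  have c: "C = ennreal c" "0 \<le> c"
    using C by (simp_all add: c_def less_top)
  have "(\<lambda>n. (e' n - c * pois l n) * t ^ n) sums 0" if t: "0 < t" "t < 1" for t
  proof -
    have "(\<lambda>n. t ^ n * e' n) sums (c * exp (- (l * (1 - t))))"
      using eq[OF t] t e' c
      by (intro suminf_ennreal_sums) (auto simp: ennreal_mult'[symmetric] ennreal_power)
    moreover have "(\<lambda>n. c * (t ^ n * pois l n)) sums (c * exp (- (l * (1 - t))))"
      by (intro sums_mult pois_pgf_sums)
    ultimately have "(\<lambda>n. t ^ n * e' n - c * (t ^ n * pois l n)) sums (c * exp (- (l * (1 - t))) - c * exp (- (l * (1 - t))))"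
      by (rule sums_diff)
    moreover have "t ^ n * e' n - c * (t ^ n * pois l n) = (e' n - c * pois l n) * t ^ n" for n
      by (simp add: algebra_simps)
    ultimately show ?thesis
      by simp
  qed
  then have "e' n - c * pois l n = 0"
    by (rule powser_zero_imp_coeff_zero)
  then show ?thesis
    using e' c \<open>0 \<le> l\<close> by (simp add: ennreal_mult'[symmetric] pois_nonneg)
qed

lemma nn_integral_weighted_nat_valued:
  assumes [measurable]: "V \<in> measurable M (count_space UNIV)" "W \<in> borel_measurable M"
  shows "(\<integral>\<^sup>+ x. W x * g (V x) \<partial>M) = (\<Sum>n::nat. g n * (\<integral>\<^sup>+ x. W x * indicator {n} (V x) \<partial>M))"
proof -
  have [measurable]: "(\<lambda>x. indicator {n} (V x) :: ennreal) \<in> borel_measurable M" for n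
    by (rule measurable_compose[OF assms(1)]) simp
  have "(\<integral>\<^sup>+ x. W x * g (V x) \<partial>M) = (\<integral>\<^sup>+ x. (\<Sum>n. g n * (W x * indicator {n} (V x))) \<partial>M)"
  proof (intro nn_integral_cong)
    fix x
    have "(\<Sum>n. g n * (W x * indicator {n} (V x))) = (\<Sum>n\<in>{V x}. g n * (W x * indicator {n} (V x)))"
      by (intro suminf_finite) auto
    then show "W x * g (V x) = (\<Sum>n. g n * (W x * indicator {n} (V x)))"
      by (simp add: mult.commute)
  qed
  also have "\<dots> = (\<Sum>n. g n * (\<integral>\<^sup>+ x. W x * indicator {n} (V x) \<partial>M))"
    by (simp add: nn_integral_suminf nn_integral_cmult)
  finally show ?thesis .
qed

context prob_space
begin

text \<open>One variable at a time: both sides are power series in \<open>s i\<close>, and comparing coefficients replaces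
  the factor \<open>s i ^ V i\<close> by the indicator of \<open>V i = n i\<close>.\<close>

lemma joint_pgf_poisson:
  assumes J: "finite J" and V [measurable]: "\<And>j. j \<in> J \<Longrightarrow> V j \<in> measurable M (count_space UNIV)"
    and l: "\<And>j. j \<in> J \<Longrightarrow> 0 \<le> l j"
    and pgf: "\<And>s. (\<And>j. 0 \<le> s j \<and> s j \<le> 1) \<Longrightarrow>
      (\<integral>\<^sup>+ \<omega>. (\<Prod>j\<in>J. ennreal (s j) ^ V j \<omega>) \<partial>M) = (\<Prod>j\<in>J. ennreal (exp (- (l j * (1 - s j)))))"
    and T: "T \<subseteq> J" and s: "\<And>j. 0 \<le> s j \<and> s j \<le> 1"
  shows "(\<integral>\<^sup>+ \<omega>. (\<Prod>j\<in>T. indicator {n j} (V j \<omega>)) * (\<Prod>j\<in>J - T. ennreal (s j) ^ V j \<omega>) \<partial>M) =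
    (\<Prod>j\<in>T. ennreal (pois (l j) (n j))) * (\<Prod>j\<in>J - T. ennreal (exp (- (l j * (1 - s j)))))"
proof -
  have "finite T" using T J by (rule finite_subset)
  from this T s show ?thesis
  proof (induction T arbitrary: s rule: finite_induct)
    case empty
    then show ?case using pgf by simp
  next
    case (insert i T)
    let ?W = "\<lambda>\<omega>. (\<Prod>j\<in>T. indicator {n j} (V j \<omega>)) * (\<Prod>j\<in>J - insert i T. ennreal (s j) ^ V j \<omega>)"
    let ?C = "(\<Prod>j\<in>T. ennreal (pois (l j) (n j))) * (\<Prod>j\<in>J - insert i T. ennreal (exp (- (l j * (1 - s j)))))"
    \<comment> \<open>Coefficients of the power series in \<open>s i\<close>. They are finite
      because every factor of the integrand is at most 1 on a probability space.\<close>
    define e where "e m = (\<integral>\<^sup>+ \<omega>. ?W \<omega> * indicator {m} (V i \<omega>) \<partial>M)" for m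
    have iJ: "i \<in> J" and TJ: "T \<subseteq> J" using insert by auto
    have split: "J - T = insert i (J - insert i T)" using iJ insert by auto
    have comp: "(\<lambda>\<omega>. f (V j \<omega>)) \<in> borel_measurable M" if "j \<in> J" for j and f :: "nat \<Rightarrow> ennreal"
      by (rule measurable_compose[OF V[OF that]]) simp
    have W: "?W \<in> borel_measurable M"
    proof (intro borel_measurable_times_ennreal borel_measurable_prod_ennreal)
      show "(\<lambda>\<omega>. indicator {n j} (V j \<omega>) :: ennreal) \<in> borel_measurable M" if "j \<in> T" for j
        using comp[of j "indicator {n j}"] that TJ by auto
      show "(\<lambda>\<omega>. ennreal (s j) ^ V j \<omega>) \<in> borel_measurable M" if "j \<in> J - insert i T" for j
        using comp[of j "\<lambda>k. ennreal (s j) ^ k"] that by auto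
    qed
    have "?W \<omega> * indicator {m} (V i \<omega>) \<le> 1" for \<omega> m
    proof -
      have "(\<Prod>j\<in>T. indicator {n j} (V j \<omega>)) \<le> (1::ennreal)"
        by (intro prod_le_1) (auto simp: indicator_def)
      moreover have "(\<Prod>j\<in>J - insert i T. ennreal (s j) ^ V j \<omega>) \<le> 1"
        using insert.prems by (intro prod_le_1) (auto intro!: power_le_one simp: ennreal_le_1)
      ultimately have "?W \<omega> \<le> 1 * 1"
        by (intro mult_mono) auto
      then show ?thesis
        by (auto simp: indicator_def)
    qed
    then have "e m \<le> (\<integral>\<^sup>+ \<omega>. 1 \<partial>M)" for m
      unfolding e_def by (intro nn_integral_mono) auto
    then have e: "e m \<noteq> \<infinity>" for m
      by (metis emeasure_space_1 infinity_ennreal_def mult.left_neutral nn_integral_const ennreal_one_neq_top top.extremum_uniqueI)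
    have "(\<Sum>m. ennreal t ^ m * e m) = ?C * ennreal (exp (- (l i * (1 - t))))" if t: "0 < t" "t < 1" for t
    proof -
      have "(\<Sum>m. ennreal t ^ m * e m) = (\<integral>\<^sup>+ \<omega>. ?W \<omega> * ennreal t ^ V i \<omega> \<partial>M)"
        unfolding e_def by (rule nn_integral_weighted_nat_valued[OF V[OF iJ] W, symmetric])
      also have "\<dots> = (\<integral>\<^sup>+ \<omega>. (\<Prod>j\<in>T. indicator {n j} (V j \<omega>)) *
          (\<Prod>j\<in>J - T. ennreal ((s(i := t)) j) ^ V j \<omega>) \<partial>M)"
        unfolding split using J by (intro nn_integral_cong) (simp add: ac_simps)
      also have "\<dots> = (\<Prod>j\<in>T. ennreal (pois (l j) (n j))) *
          (\<Prod>j\<in>J - T. ennreal (exp (- (l j * (1 - (s(i := t)) j)))))"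
        using insert.IH[of "s(i := t)"] TJ insert.prems t by auto
      also have "\<dots> = ?C * ennreal (exp (- (l i * (1 - t))))"
        unfolding split using J by (simp add: ac_simps)
      finally show ?thesis .
    qed
    moreover have "?C \<noteq> \<infinity>"
      by (simp add: ennreal_mult_eq_top_iff ennreal_prod_eq_top)
    ultimately have "e (n i) = ?C * ennreal (pois (l i) (n i))"
      using e l[OF iJ] by (intro pgf_coeff_unique) auto
    then show ?case
      unfolding e_def using insert.hyps by (simp add: ac_simps)
  qed
qed

text \<open>Finitely many natural-number variables take their joint values in a countable set, so
  point masses determine the joint law.\<close>

lemma indep_vars_nat_valuedI:
  assumes J: "finite J" and V: "\<And>j. j \<in> J \<Longrightarrow> V j \<in> measurable M (count_space (UNIV :: nat set))"
    and pt: "\<And>n. emeasure M {\<omega> \<in> space M. \<forall>j\<in>J. V j \<omega> = n j} =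
       (\<Prod>j\<in>J. emeasure M {\<omega> \<in> space M. V j \<omega> = n j})"
  shows "indep_vars (\<lambda>_. count_space UNIV) V J"
proof (cases "J = {}")
  case True
  then show ?thesis by (simp add: indep_vars_def indep_sets_def)
next
  case False
  let ?N = "\<lambda>i. count_space (UNIV :: nat set)"
  have cs: "PiM J ?N = count_space (PiE J (\<lambda>_. UNIV))"
    using J by (intro count_space_PiM_finite) auto
  have tup: "(\<lambda>x. \<lambda>i\<in>J. V i x) \<in> measurable M (PiM J ?N)"
    using V by (intro measurable_restrict)
  have sets': "sets (PiM J (\<lambda>i. distr M (?N i) (V i))) = sets (PiM J ?N)"
    by (intro sets_PiM_cong) auto
  show ?thesis
  proof (subst indep_vars_iff_distr_eq_PiM'[OF False])
    show "V i \<in> measurable M (?N i)" if "i \<in> J" for i using V that .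
    have P: "prob_space (distr M (?N i) (V i))" if "i \<in> J" for i
      using V[OF that] by (rule prob_space_distr)
    show "distr M (PiM J ?N) (\<lambda>x. \<lambda>i\<in>J. V i x) = PiM J (\<lambda>i. distr M (?N i) (V i))"
    proof (rule measure_eqI_countable[where A = "PiE J (\<lambda>_. UNIV)"])
      show "sets (distr M (PiM J ?N) (\<lambda>x. \<lambda>i\<in>J. V i x)) = Pow (PiE J (\<lambda>_. UNIV))"
        by (simp add: cs)
      show "sets (PiM J (\<lambda>i. distr M (?N i) (V i))) = Pow (PiE J (\<lambda>_. UNIV))"
        by (simp only: sets' cs sets_count_space)
      show "countable (PiE J (\<lambda>_. UNIV :: nat set))"
        using J by (intro countable_PiE) auto
      fix n assume n: "n \<in> PiE J (\<lambda>_. UNIV :: nat set)"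
      have eq: "(\<lambda>x. \<lambda>i\<in>J. V i x) -` {n} \<inter> space M = {\<omega> \<in> space M. \<forall>j\<in>J. V j \<omega> = n j}"
        using n by (auto simp: PiE_iff extensional_def restrict_def fun_eq_iff)
      have "emeasure (distr M (PiM J ?N) (\<lambda>x. \<lambda>i\<in>J. V i x)) {n} =
          (\<Prod>j\<in>J. emeasure M {\<omega> \<in> space M. V j \<omega> = n j})"
        using n by (subst emeasure_distr[OF tup]) (simp_all add: cs eq pt)
      also have "\<dots> = (\<Prod>j\<in>J. emeasure (distr M (?N j) (V j)) {n j})"
        using V by (intro prod.cong refl) (auto simp: emeasure_distr vimage_def Int_def conj_commute)
      also have "\<dots> = emeasure (PiM J (\<lambda>i. distr M (?N i) (V i))) (PiE J (\<lambda>j. {n j}))"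
        using emeasure_PiM_emb[of J "\<lambda>i. distr M (?N i) (V i)" J "\<lambda>j. {n j}"] J P
        by (simp add: prod_emb_id PiE_mono)
      also have "PiE J (\<lambda>j. {n j}) = {n}"
        using n by (intro PiE_singleton) (auto simp: PiE_iff)
      finally show "emeasure (distr M (PiM J ?N) (\<lambda>x. \<lambda>i\<in>J. V i x)) {n} =
          emeasure (PiM J (\<lambda>i. distr M (?N i) (V i))) {n}" .
    qed
  qed
qed

text \<open>Point probabilities for any \<open>T \<subseteq> J\<close> follow from the mixed formula
  by setting the remaining arguments \<open>s j\<close> to 1. Singletons give the Poisson laws and
  \<open>T = J\<close> gives the product formula for independence.\<close>

lemma poisson_of_pgf:
  assumes J: "finite J" and V: "\<And>j. j \<in> J \<Longrightarrow> V j \<in> measurable M (count_space (UNIV :: nat set))"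
    and l: "\<And>j. j \<in> J \<Longrightarrow> 0 \<le> l j"
    and pgf: "\<And>s. (\<And>j. 0 \<le> s j \<and> s j \<le> 1) \<Longrightarrow>
      (\<integral>\<^sup>+ \<omega>. (\<Prod>j\<in>J. ennreal (s j) ^ V j \<omega>) \<partial>M) = (\<Prod>j\<in>J. ennreal (exp (- (l j * (1 - s j)))))"
  shows "j \<in> J \<Longrightarrow> emeasure M {\<omega> \<in> space M. V j \<omega> = n} = ennreal (pois (l j) n)"
    and "indep_vars (\<lambda>_. count_space UNIV) V J"
proof -
  have ev: "{\<omega> \<in> space M. \<forall>j\<in>T. V j \<omega> = n j} \<in> events" if "T \<subseteq> J" for T n
  proof -
    have "finite T" using that J by (rule finite_subset)
    moreover have "{\<omega> \<in> space M. V j \<omega> = n j} \<in> events" if "j \<in> T" for j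
      using measurable_sets[OF V[of j], of "{n j}"] \<open>T \<subseteq> J\<close> that
      by (auto simp: vimage_def Int_def conj_commute)
    ultimately show ?thesis
      by (intro sets.sets_Collect_finite_All)
  qed
  have pt: "emeasure M {\<omega> \<in> space M. \<forall>j\<in>T. V j \<omega> = n j} = (\<Prod>j\<in>T. ennreal (pois (l j) (n j)))"
    if T: "T \<subseteq> J" for T n
  proof -
    have "finite T" using that J by (rule finite_subset)
    have "emeasure M {\<omega> \<in> space M. \<forall>j\<in>T. V j \<omega> = n j} =
        (\<integral>\<^sup>+ \<omega>. indicator {\<omega> \<in> space M. \<forall>j\<in>T. V j \<omega> = n j} \<omega> \<partial>M)"
      using ev[OF T] by simp
    also have "\<dots> = (\<integral>\<^sup>+ \<omega>. (\<Prod>j\<in>T. indicator {n j} (V j \<omega>)) * (\<Prod>j\<in>J - T. ennreal 1 ^ V j \<omega>) \<partial>M)"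
      by (intro nn_integral_cong) (simp add: prod_indicator[OF \<open>finite T\<close>] indicator_def \<open>finite T\<close>)
    also have "\<dots> = (\<Prod>j\<in>T. ennreal (pois (l j) (n j)))"
      by (subst joint_pgf_poisson[OF J V l pgf T, where s = "\<lambda>_. 1"]) simp_all
    finally show ?thesis .
  qed
  show one: "emeasure M {\<omega> \<in> space M. V j \<omega> = n} = ennreal (pois (l j) n)" if "j \<in> J" for j n
    using pt[of "{j}" "\<lambda>_. n"] that by simp
  show "indep_vars (\<lambda>_. count_space UNIV) V J"
    by (rule indep_vars_nat_valuedI[OF J V]) (simp_all add: pt one)
qed

end

section \<open>Random sums of Dirac measures\<close>

lemma sets_dirac_sum [simp, measurable_cong]: "sets (dirac_sum J f) = sets borel"
  by (simp add: dirac_sum_def)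

lemma emeasure_dirac_sum_card:
  assumes "B \<in> sets borel"
  shows "emeasure (dirac_sum J f) B = emeasure (count_space J) (f -` B \<inter> J)"
  using assms by (simp add: dirac_sum_def emeasure_distr)

lemma emeasure_dirac_sum:
  assumes B: "B \<in> sets borel"
  shows "emeasure (dirac_sum J f) B = (\<integral>\<^sup>+ j. indicator B (f j) * indicator J j \<partial>count_space UNIV)"
proof -
  have "emeasure (dirac_sum J f) B = (\<integral>\<^sup>+ j. indicator (f -` B \<inter> J) j \<partial>count_space J)"
    using B by (simp add: emeasure_dirac_sum_card)
  also have "\<dots> = (\<integral>\<^sup>+ j. indicator (f -` B \<inter> J) j * indicator J j \<partial>count_space UNIV)"
    by (rule nn_integral_count_space_indicator) simp
  also have "\<dots> = (\<integral>\<^sup>+ j. indicator B (f j) * indicator J j \<partial>count_space UNIV)"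
    by (intro nn_integral_cong) (auto simp: indicator_def)
  finally show ?thesis .
qed

lemma emeasure_dirac_sum_nat:
  assumes B: "B \<in> sets borel"
  shows "emeasure (dirac_sum UNIV f) B = (\<Sum>n. indicator B (f n))"
  using B by (simp add: emeasure_dirac_sum nn_integral_count_space_nat)

lemma emeasure_dirac_sum_clusters:
  fixes k :: "nat \<Rightarrow> nat"
  assumes B: "B \<in> sets borel"
  shows "emeasure (dirac_sum {(n, i). i < k n} (\<lambda>(n, i). h n i)) B =
    (\<Sum>n. \<Sum>i. indicator {..<k n} i * indicator B (h n i))"
proof -
  have "emeasure (dirac_sum {(n, i). i < k n} (\<lambda>(n, i). h n i)) B =
    (\<integral>\<^sup>+ p. (\<lambda>(n, i). indicator {..<k n} i * indicator B (h n i)) p \<partial>count_space UNIV)"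
    using B by (simp only: emeasure_dirac_sum)
      (intro nn_integral_cong, auto simp: indicator_def)
  then show ?thesis
    by (simp add: nn_integral_fst_count_space[symmetric] nn_integral_count_space_nat)
qed

lemma dirac_sum_atom: "emeasure (dirac_sum J f) {x} > 0 \<longleftrightarrow> x \<in> f ` J"
  by (auto simp: emeasure_dirac_sum_card zero_less_iff_neq_zero emeasure_count_space_eq_0)

lemma dirac_sum_reindex:
  assumes "bij_betw g UNIV J"
  shows "dirac_sum UNIV (\<lambda>n. f (g n)) = dirac_sum J f"
proof (rule measure_eqI)
  fix B assume "B \<in> sets (dirac_sum UNIV (\<lambda>n. f (g n)))"
  then have B: "B \<in> sets borel" by simp
  have "emeasure (dirac_sum J f) B = (\<integral>\<^sup>+ j. indicator B (f j) \<partial>count_space J)"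
    using B by (simp add: emeasure_dirac_sum nn_integral_count_space_indicator)
  also have "\<dots> = (\<integral>\<^sup>+ n. indicator B (f (g n)) \<partial>count_space UNIV)"
    by (rule nn_integral_bij_count_space[OF assms, symmetric])
  finally show "emeasure (dirac_sum UNIV (\<lambda>n. f (g n))) B = emeasure (dirac_sum J f) B"
    using B by (simp add: emeasure_dirac_sum)
qed simp

lemma dirac_sum_counting:
  assumes fin: "\<And>c. emeasure (dirac_sum J f) (cell c) < \<infinity>"
  shows "dirac_sum J f \<in> counting_measures"
  unfolding counting_measures_def
proof (intro CollectI conjI ballI impI)
  fix B :: "plane set" assume B: "B \<in> sets borel" "bounded B"
  from B(2) obtain C where "B \<subseteq> (\<Union>c<C. cell c)" by (rule bounded_subset_cells)
  then have "emeasure (dirac_sum J f) B \<le> emeasure (dirac_sum J f) (\<Union>c<C. cell c)"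
    by (intro emeasure_mono) auto
  also have "\<dots> \<le> (\<Sum>c<C. emeasure (dirac_sum J f) (cell c))"
    by (intro emeasure_subadditive_finite) auto
  also have "\<dots> < \<infinity>"
    using fin by simp
  finally have "emeasure (count_space J) (f -` B \<inter> J) < \<infinity>"
    using B by (simp add: emeasure_dirac_sum_card)
  then have "finite (f -` B \<inter> J)"
    by (simp add: emeasure_count_space split: if_splits)
  then show "\<exists>n::nat. emeasure (dirac_sum J f) B = of_nat n"
    using B by (auto simp: emeasure_dirac_sum_card)
qed simp

lemma null_measure_counting: "null_measure borel \<in> counting_measures"
  by (auto simp: counting_measures_def intro: exI[of _ 0])

text \<open>A law requires a version that is a counting measure for every outcome. On the null event
  that some cell has infinite mass, the sum is replaced by the zero measure; there are countably
  many cells, so this event is measurable.\<close>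

lemma law_of_dirac_sum:
  assumes meas: "\<And>B. B \<in> sets borel \<Longrightarrow> (\<lambda>\<omega>. emeasure (dirac_sum (J \<omega>) (f \<omega>)) B) \<in> borel_measurable M"
    and fin: "\<And>c. AE \<omega> in M. emeasure (dirac_sum (J \<omega>) (f \<omega>)) (cell c) < \<infinity>"
  shows "\<exists>P. law_of M (\<lambda>\<omega>. dirac_sum (J \<omega>) (f \<omega>)) P"
proof -
  let ?\<Phi> = "\<lambda>\<omega>. dirac_sum (J \<omega>) (f \<omega>)"
  define \<Phi>' where "\<Phi>' \<omega> = (if \<forall>c. emeasure (?\<Phi> \<omega>) (cell c) < \<infinity> then ?\<Phi> \<omega> else null_measure borel)" for \<omega>
  have "\<Phi>' \<in> measurable M config_space"
  proof (rule measurable_into_config)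
    show "\<Phi>' \<omega> \<in> counting_measures" for \<omega>
      using dirac_sum_counting[of "J \<omega>" "f \<omega>"] null_measure_counting by (auto simp: \<Phi>'_def)
    fix B :: "plane set" assume B: "B \<in> sets borel"
    have "{\<omega> \<in> space M. emeasure (?\<Phi> \<omega>) (cell c) < \<infinity>} \<in> sets M" for c
      by (rule borel_measurable_less[OF meas[OF sets_cell] borel_measurable_const])
    then have "{\<omega> \<in> space M. \<forall>c. emeasure (?\<Phi> \<omega>) (cell c) < \<infinity>} \<in> sets M"
      by (rule sets.sets_Collect_countable_All)
    then have "(\<lambda>\<omega>. if \<forall>c. emeasure (?\<Phi> \<omega>) (cell c) < \<infinity> then emeasure (?\<Phi> \<omega>) B else 0) \<in> borel_measurable M"
      by (rule measurable_If[OF meas[OF B] borel_measurable_const])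
    moreover have "emeasure (\<Phi>' \<omega>) B = (if \<forall>c. emeasure (?\<Phi> \<omega>) (cell c) < \<infinity> then emeasure (?\<Phi> \<omega>) B else 0)" for \<omega>
      unfolding \<Phi>'_def by (rule if_distrib[where f = "\<lambda>N. emeasure N B", THEN trans]) (simp only: emeasure_null_measure)
    ultimately show "(\<lambda>\<omega>. emeasure (\<Phi>' \<omega>) B) \<in> borel_measurable M"
      by (simp only:)
  qed
  moreover have "AE \<omega> in M. \<forall>c. emeasure (?\<Phi> \<omega>) (cell c) < \<infinity>"
    using fin by (simp add: AE_all_countable)
  then have "AE \<omega> in M. \<Phi>' \<omega> = ?\<Phi> \<omega>"
    by eventually_elim (simp add: \<Phi>'_def)
  ultimately show ?thesis
    unfolding law_of_def by blast
qed

lemma law_of_mean: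
  assumes "law_of M \<Phi> P" "B \<in> sets borel"
  shows "mean_measure P B = (\<integral>\<^sup>+ \<omega>. emeasure (\<Phi> \<omega>) B \<partial>M)"
proof -
  from assms obtain \<Phi>' where \<Phi>': "\<Phi>' \<in> measurable M config_space" "AE \<omega> in M. \<Phi>' \<omega> = \<Phi> \<omega>"
    "P = distr M config_space \<Phi>'"
    unfolding law_of_def by blast
  have "mean_measure P B = (\<integral>\<^sup>+ \<omega>. emeasure (\<Phi>' \<omega>) B \<partial>M)"
    unfolding mean_measure_def \<Phi>'(3)
    by (rule nn_integral_distr[OF \<Phi>'(1)]) (simp add: measurable_emeasure_config assms(2))
  also have "\<dots> = (\<integral>\<^sup>+ \<omega>. emeasure (\<Phi> \<omega>) B \<partial>M)"
    using \<Phi>'(2) by (intro nn_integral_cong_AE) auto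
  finally show ?thesis .
qed

lemma law_of_prob:
  assumes "law_of M \<Phi> P" "prob_space M"
  shows "prob_space P" "sets P = sets config_space"
proof -
  obtain \<Phi>' where "\<Phi>' \<in> measurable M config_space" "P = distr M config_space \<Phi>'"
    using assms(1) unfolding law_of_def by blast
  then show "prob_space P" "sets P = sets config_space"
    using prob_space.prob_space_distr[OF assms(2)] by simp_all
qed

section \<open>Construction of the Poisson process\<close>

text \<open>Needed because \<open>emeasure N B\<close> and its natural-number count agree only for
  counting measures \<open>N\<close>.\<close>

lemma (in prob_space) indep_vars_cong_space:
  assumes eq: "\<And>i x. i \<in> I \<Longrightarrow> x \<in> space M \<Longrightarrow> X i x = Y i x"
  shows "indep_vars M' X I \<longleftrightarrow> indep_vars M' Y I"
proof -
  have pre: "X i -` A \<inter> space M = Y i -` A \<inter> space M" if "i \<in> I" for i A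
    using eq[OF that] by auto
  have "X i \<in> measurable M (M' i) \<longleftrightarrow> Y i \<in> measurable M (M' i)" if "i \<in> I" for i
    using eq[OF that] by (rule measurable_cong)
  then show ?thesis
    unfolding indep_vars_def2 by (intro conj_cong indep_sets_cong ball_cong refl) (simp_all add: pre)
qed

context mark
begin

lemma measurable_mark_point:
  assumes "B \<in> sets borel"
  shows "(\<lambda>z. indicator {..<fst z} i * indicator B (snd z i) :: ennreal) \<in> borel_measurable (mark_law R \<delta> \<mu>)"
proof -
  have [measurable]: "B \<in> sets borel" by fact
  have "(\<lambda>z. indicator {..<fst z} i * indicator B (snd z i) :: ennreal) \<in>
      borel_measurable (count_space UNIV \<Otimes>\<^sub>M (\<Pi>\<^sub>M i\<in>(UNIV::nat set). borel))"
    unfolding indicator_def lessThan_iff by measurable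
  then show ?thesis
    by (simp only: measurable_cong_sets[OF sets_mark refl])
qed

lemma measurable_mark_snd: "(\<lambda>z. snd z i) \<in> borel_measurable (mark_law R \<delta> \<mu>)"
proof -
  have "(\<lambda>z. snd z i) \<in> borel_measurable (count_space (UNIV::nat set) \<Otimes>\<^sub>M (\<Pi>\<^sub>M i\<in>(UNIV::nat set). borel :: plane measure))"
    by measurable
  then show ?thesis
    by (simp only: measurable_cong_sets[OF sets_mark refl])
qed

lemma measurable_mark_fst: "fst \<in> measurable (mark_law R \<delta> \<mu>) (count_space UNIV)"
proof -
  have "fst \<in> measurable (count_space (UNIV::nat set) \<Otimes>\<^sub>M (\<Pi>\<^sub>M i\<in>(UNIV::nat set). borel :: plane measure)) (count_space UNIV)"
    by measurable
  then show ?thesis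
    by (simp only: measurable_cong_sets[OF sets_mark refl])
qed

lemma AE_mark: "AE z in mark_law R \<delta> \<mu>. \<forall>i. snd z i \<in> annulus R \<delta>"
proof -
  have "AE z in mark_law R \<delta> \<mu>. snd z i \<in> annulus R \<delta>" for i
  proof -
    let ?h = "indicator (- annulus R \<delta>) :: plane \<Rightarrow> ennreal"
    have hm: "?h \<in> borel_measurable borel" by simp
    have h [measurable]: "(\<lambda>z. ?h (snd z i)) \<in> borel_measurable (mark_law R \<delta> \<mu>)"
      by (rule measurable_compose[OF measurable_mark_snd hm])
    have "AE y in U. y \<in> annulus R \<delta>"
      by (rule AE_uniform_measureI) simp_all
    then have "AE Y in (\<Pi>\<^sub>M i\<in>(UNIV::nat set). U). Y i \<in> annulus R \<delta>"
      using prob_U by (intro AE_PiM_component) auto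
    then have "(\<integral>\<^sup>+ Y. ?h (Y i) \<partial>(\<Pi>\<^sub>M i\<in>(UNIV::nat set). U)) = (\<integral>\<^sup>+ Y. 0 \<partial>(\<Pi>\<^sub>M i\<in>(UNIV::nat set). U))"
      by (intro nn_integral_cong_AE) (auto elim!: eventually_mono)
    then have "(\<integral>\<^sup>+ z. ?h (snd z i) \<partial>mark_law R \<delta> \<mu>) = 0"
      by (subst nn_integral_mark[OF h]) simp
    then have "AE z in mark_law R \<delta> \<mu>. ?h (snd z i) = 0"
      by (subst (asm) nn_integral_0_iff_AE[OF h])
    then show ?thesis
      by eventually_elim (auto simp: indicator_def split: if_splits)
  qed
  then show ?thesis
    by (simp add: AE_all_countable)
qed

lemma measure_U: "B \<in> sets borel \<Longrightarrow> measure U B = measure lborel (annulus R \<delta> \<inter> B) / measure lborel (annulus R \<delta>)"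
  using annulus_pos by (intro measure_uniform_measure) (simp_all add: emeasure_annulus)

text \<open>The \<open>B j\<close> are disjoint, so at most one factor differs from 1 and the
  product is the linear expression 1 minus the sum of \<open>(1 - s j) * indicator (B j)\<close>,
  whose mean is immediate.\<close>

lemma uniform_pgf:
  fixes B :: "nat \<Rightarrow> plane set" and s :: "nat \<Rightarrow> real"
  assumes B: "\<And>j. j < k \<Longrightarrow> B j \<in> sets borel" and disj: "disjoint_family_on B {..<k}"
    and s: "\<And>j. 0 \<le> s j \<and> s j \<le> 1"
  shows "(\<integral>\<^sup>+ x. (\<Prod>j<k. if x \<in> B j then ennreal (s j) else 1) \<partial>U) =
      ennreal (1 - (\<Sum>j<k. (1 - s j) * measure U (B j)))"
    and "0 \<le> 1 - (\<Sum>j<k. (1 - s j) * measure U (B j))"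
proof -
  interpret U: prob_space U by (rule prob_U)
  let ?g = "\<lambda>x. 1 - (\<Sum>j<k. (1 - s j) * indicator (B j) x) :: real"
  have pt: "(\<Prod>j<k. if x \<in> B j then ennreal (s j) else 1) = ennreal (?g x) \<and> 0 \<le> ?g x" for x
  proof (cases "\<exists>j<k. x \<in> B j")
    case True
    then obtain i where i: "i < k" "x \<in> B i" by blast
    have no: "x \<notin> B j" if "j < k" "j \<noteq> i" for j
      using disj i that by (auto simp: disjoint_family_on_def)
    have "(\<Prod>j<k. if x \<in> B j then ennreal (s j) else 1) = (\<Prod>j\<in>{i}. if x \<in> B j then ennreal (s j) else 1)"
      by (rule prod.mono_neutral_right) (use i no in auto)
    moreover have "(\<Sum>j<k. (1 - s j) * indicator (B j) x :: real) = (\<Sum>j\<in>{i}. (1 - s j) * indicator (B j) x)"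
      by (rule sum.mono_neutral_right) (use i no in auto)
    ultimately show ?thesis using i s by simp
  next
    case False
    then have "(\<Sum>j<k. (1 - s j) * indicator (B j) x :: real) = 0" by (intro sum.neutral) auto
    with False show ?thesis by simp
  qed
  have Bm: "j < k \<Longrightarrow> B j \<in> sets U" for j using B by simp
  have int: "integrable U (\<lambda>x. (1 - s j) * indicator (B j) x :: real)" if "j < k" for j
    using Bm[OF that] by (intro integrable_mult_right U.integrable_const_bound[where B = 1])
      (auto simp: indicator_def)
  have ig: "integrable U ?g"
    using int by (intro Bochner_Integration.integrable_diff Bochner_Integration.integrable_sum) auto
  have val: "integral\<^sup>L U ?g = 1 - (\<Sum>j<k. (1 - s j) * measure U (B j))"
  proof -
    have "integral\<^sup>L U ?g = integral\<^sup>L U (\<lambda>x. 1) - integral\<^sup>L U (\<lambda>x. \<Sum>j<k. (1 - s j) * indicator (B j) x)"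
      using int by (intro Bochner_Integration.integral_diff Bochner_Integration.integrable_sum) auto
    also have "integral\<^sup>L U (\<lambda>x. \<Sum>j<k. (1 - s j) * indicator (B j) x) = (\<Sum>j<k. integral\<^sup>L U (\<lambda>x. (1 - s j) * indicator (B j) x))"
      using int by (intro Bochner_Integration.integral_sum) auto
    also have "\<dots> = (\<Sum>j<k. (1 - s j) * measure U (B j))"
      using Bm by (intro sum.cong refl) simp
    finally show ?thesis
      using U.prob_space by simp
  qed
  have "(\<integral>\<^sup>+ x. (\<Prod>j<k. if x \<in> B j then ennreal (s j) else 1) \<partial>U) = (\<integral>\<^sup>+ x. ennreal (?g x) \<partial>U)"
    using pt by (intro nn_integral_cong) blast
  also have "\<dots> = ennreal (integral\<^sup>L U ?g)"
    using pt by (intro nn_integral_eq_integral ig) auto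
  finally show "(\<integral>\<^sup>+ x. (\<Prod>j<k. if x \<in> B j then ennreal (s j) else 1) \<partial>U) =
      ennreal (1 - (\<Sum>j<k. (1 - s j) * measure U (B j)))"
    unfolding val .
  have "0 \<le> integral\<^sup>L U ?g"
    using pt by (intro Bochner_Integration.integral_nonneg) blast
  then show "0 \<le> 1 - (\<Sum>j<k. (1 - s j) * measure U (B j))"
    unfolding val .
qed

end

lemma measure_lborel_cells:
  assumes "B \<in> sets borel" "B \<subseteq> (\<Union>c<C. cell c)"
  shows "measure lborel B = (\<Sum>c<C. measure lborel (cell c \<inter> B))"
proof -
  have "B = (\<Union>c<C. cell c \<inter> B)" using assms by blast
  moreover have "measure lborel (\<Union>c<C. cell c \<inter> B) = (\<Sum>c<C. measure lborel (cell c \<inter> B))"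
    using assms disjoint_cells
    by (intro measure_finite_Union)
       (auto simp: disjoint_family_on_def bounded_borel_finite[OF bounded_subset[OF bounded_cell Int_lower1]])
  ultimately show ?thesis by simp
qed

text \<open>The classical construction: independently in each cell, a Poisson number of uniform
  points with mean \<open>a\<close> times the area of the cell.\<close>

locale poisson_cells =
  fixes a :: real
  assumes a: "0 < a"
begin

definition mu :: "nat \<Rightarrow> real" where "mu c = a * measure lborel (cell c)"

definition Ml :: "nat \<Rightarrow> (nat \<times> (nat \<Rightarrow> plane)) measure" where
  "Ml c = mark_law (real (Suc c)) 1 (mu c)"

definition \<Omega> :: "(nat \<Rightarrow> nat \<times> (nat \<Rightarrow> plane)) measure" where
  "\<Omega> = PiM UNIV Ml"

definition Pts :: "(nat \<Rightarrow> nat \<times> (nat \<Rightarrow> plane)) \<Rightarrow> plane measure" where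
  "Pts \<omega> = dirac_sum {(c, i). i < fst (\<omega> c)} (\<lambda>(c, i). snd (\<omega> c) i)"

text \<open>Cell \<open>c\<close> has area \<open>(2 * c + 1) * disc_area\<close>. A lower bound
  uniform in \<open>c\<close> keeps the probability of an empty cell away from 1, as required for
  infinitely many points.\<close>

lemma measure_cell_ge: "disc_area \<le> measure lborel (cell c)"
proof -
  have "measure lborel (cell c) = disc_area * ((real (Suc c))\<^sup>2 - (real (Suc c) - 1)\<^sup>2)"
    unfolding cell_def by (rule measure_annulus) simp_all
  also have "(real (Suc c))\<^sup>2 - (real (Suc c) - 1)\<^sup>2 = 2 * real c + 1"
    by (simp add: power2_eq_square algebra_simps)
  finally show ?thesis
    using disc_area_pos by (simp add: mult_le_cancel_left1)
qed

lemma cell_pos: "0 < measure lborel (cell c)"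
  using measure_cell_ge[of c] disc_area_pos by linarith

lemma mu_pos: "0 < mu c"
  unfolding mu_def by (intro mult_pos_pos a cell_pos)

sublocale mark "real (Suc c)" 1 "mu c" for c
  by unfold_locales (use mu_pos in auto)

lemma prob_Ml: "prob_space (Ml c)"
  unfolding Ml_def by (rule prob_mark)

lemma prob_\<Omega>: "prob_space \<Omega>"
  unfolding \<Omega>_def by (intro prob_space_PiM prob_Ml)

lemma component: "(\<lambda>\<omega>. \<omega> c) \<in> measurable \<Omega> (Ml c)"
  unfolding \<Omega>_def by (rule measurable_component_singleton) simp

lemma emeasure_Pts:
  assumes "B \<in> sets borel"
  shows "emeasure (Pts \<omega>) B = (\<Sum>c. \<Sum>i. indicator {..<fst (\<omega> c)} i * indicator B (snd (\<omega> c) i))"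
  unfolding Pts_def by (rule emeasure_dirac_sum_clusters[OF assms])

lemma measurable_Pts:
  assumes "B \<in> sets borel"
  shows "(\<lambda>\<omega>. emeasure (Pts \<omega>) B) \<in> borel_measurable \<Omega>"
  unfolding emeasure_Pts[OF assms]
proof (intro borel_measurable_suminf_order)
  fix c i
  have "(\<lambda>z. indicator {..<fst z} i * indicator B (snd z i) :: ennreal) \<in> borel_measurable (Ml c)"
    unfolding Ml_def by (rule measurable_mark_point[OF assms])
  then show "(\<lambda>\<omega>. indicator {..<fst (\<omega> c)} i * indicator B (snd (\<omega> c) i) :: ennreal) \<in> borel_measurable \<Omega>"
    by (rule measurable_compose[OF component])
qed

lemma AE_cells: "AE \<omega> in \<Omega>. \<forall>c i. snd (\<omega> c) i \<in> cell c"
proof -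
  have "AE \<omega> in \<Omega>. \<forall>i. snd (\<omega> c) i \<in> cell c" for c
    unfolding \<Omega>_def
  proof (rule AE_PiM_component[where P = "\<lambda>z. \<forall>i. snd z i \<in> cell c", OF prob_Ml UNIV_I])
    show "AE z in Ml c. \<forall>i. snd z i \<in> cell c"
      unfolding Ml_def cell_def by (rule AE_mark)
  qed
  then show ?thesis by (simp add: AE_all_countable)
qed

lemma count_Pts:
  assumes cells: "\<And>c i. snd (\<omega> c) i \<in> cell c" and B: "B \<in> sets borel" "B \<subseteq> (\<Union>c<C. cell c)"
  shows "emeasure (Pts \<omega>) B = of_nat (\<Sum>c<C. \<Sum>i<fst (\<omega> c). of_bool (snd (\<omega> c) i \<in> B))"
proof -
  have "(\<Sum>i. indicator {..<fst (\<omega> c)} i * indicator B (snd (\<omega> c) i)) =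
      (\<Sum>i<fst (\<omega> c). indicator B (snd (\<omega> c) i) :: ennreal)" for c
    by (subst suminf_finite[of "{..<fst (\<omega> c)}"]) (auto intro!: sum.cong)
  moreover have "snd (\<omega> c) i \<notin> B" if "C \<le> c" for c i
  proof
    assume "snd (\<omega> c) i \<in> B"
    then obtain c' where c': "c' < C" "snd (\<omega> c) i \<in> cell c'" using B(2) by blast
    with cells[of c i] that have "c' = c" by (simp add: cell_iff)
    with c' that show False by simp
  qed
  ultimately have "emeasure (Pts \<omega>) B = (\<Sum>c<C. \<Sum>i<fst (\<omega> c). indicator B (snd (\<omega> c) i))"
    unfolding emeasure_Pts[OF B(1)] by (subst suminf_finite[of "{..<C}"]) (auto simp: not_less)
  also have "\<dots> = of_nat (\<Sum>c<C. \<Sum>i<fst (\<omega> c). of_bool (snd (\<omega> c) i \<in> B))"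
    by (simp only: of_nat_sum of_nat_of_bool indicator_def)
  finally show ?thesis .
qed

text \<open>Each point contributes the factor \<open>g\<close>, so the product of powers regroups by
  cells. The cells are independent, and each gives the exponential of minus the sum of
  \<open>a * (1 - s j)\<close> times the area of its part of \<open>B j\<close>; these areas add up
  over the finitely many cells that the sets meet.\<close>

lemma pgf_Pts:
  fixes B :: "nat \<Rightarrow> plane set" and s :: "nat \<Rightarrow> real"
  assumes B: "\<And>j. j < k \<Longrightarrow> B j \<in> sets borel \<and> bounded (B j)" and disj: "disjoint_family_on B {..<k}"
    and s: "\<And>j. 0 \<le> s j \<and> s j \<le> 1"
  shows "(\<integral>\<^sup>+ \<omega>. (\<Prod>j<k. ennreal (s j) ^ npoints (B j) (Pts \<omega>)) \<partial>\<Omega>) =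
    (\<Prod>j<k. ennreal (exp (- (a * measure lborel (B j) * (1 - s j)))))"
proof -
  have "bounded (\<Union>j<k. B j)" using B by (intro bounded_UN) auto
  then obtain C where "(\<Union>j<k. B j) \<subseteq> (\<Union>c<C. cell c)" by (rule bounded_subset_cells)
  then have C: "B j \<subseteq> (\<Union>c<C. cell c)" if "j < k" for j using that by blast
  define g where "g x = (\<Prod>j<k. if x \<in> B j then ennreal (s j) else 1)" for x
  have gm: "g \<in> borel_measurable borel"
    unfolding g_def using B by (intro borel_measurable_prod_ennreal measurable_If) auto
  have AE: "AE \<omega> in \<Omega>. (\<Prod>j<k. ennreal (s j) ^ npoints (B j) (Pts \<omega>)) = (\<Prod>c<C. \<Prod>i<fst (\<omega> c). g (snd (\<omega> c) i))"
    using AE_cells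
  proof eventually_elim
    case (elim \<omega>)
    have "(\<Prod>j<k. ennreal (s j) ^ npoints (B j) (Pts \<omega>)) =
        (\<Prod>j<k. \<Prod>c<C. \<Prod>i<fst (\<omega> c). if snd (\<omega> c) i \<in> B j then ennreal (s j) else 1)"
    proof (intro prod.cong refl)
      fix j assume "j \<in> {..<k}"
      then have "npoints (B j) (Pts \<omega>) = (\<Sum>c<C. \<Sum>i<fst (\<omega> c). of_bool (snd (\<omega> c) i \<in> B j))"
        using elim B C by (intro count_eqI count_Pts) auto
      then show "ennreal (s j) ^ npoints (B j) (Pts \<omega>) = (\<Prod>c<C. \<Prod>i<fst (\<omega> c). if snd (\<omega> c) i \<in> B j then ennreal (s j) else 1)"
        by (simp only: power_sum) (intro prod.cong refl, auto)
    qed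
    also have "\<dots> = (\<Prod>c<C. \<Prod>j<k. \<Prod>i<fst (\<omega> c). if snd (\<omega> c) i \<in> B j then ennreal (s j) else 1)"
      by (rule prod.swap)
    also have "\<dots> = (\<Prod>c<C. \<Prod>i<fst (\<omega> c). g (snd (\<omega> c) i))"
      unfolding g_def by (intro prod.cong refl prod.swap)
    finally show ?case .
  qed
  \<comment> \<open>The mean of \<open>g\<close> at one uniform point of cell
    \<open>c\<close>.\<close>
  let ?e = "\<lambda>c. 1 - (\<Sum>j<k. (1 - s j) * measure (U c) (B j))"
  have "(\<integral>\<^sup>+ \<omega>. (\<Prod>j<k. ennreal (s j) ^ npoints (B j) (Pts \<omega>)) \<partial>\<Omega>) =
      (\<integral>\<^sup>+ \<omega>. (\<Prod>c<C. (\<lambda>z. \<Prod>i<fst z. g (snd z i)) (\<omega> c)) \<partial>\<Omega>)"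
    by (rule nn_integral_cong_AE) (use AE in simp)
  also have "\<dots> = (\<Prod>c<C. \<integral>\<^sup>+ z. (\<Prod>i<fst z. g (snd z i)) \<partial>Ml c)"
    unfolding \<Omega>_def
    by (rule nn_integral_PiM_prod[OF prob_Ml, where g = "\<lambda>_ z. \<Prod>i<fst z. g (snd z i)"])
       (simp_all only: Ml_def finite_lessThan measurable_mark_prod[OF gm])
  also have "\<dots> = (\<Prod>c<C. ennreal (exp (- (mu c * (1 - ?e c)))))"
  proof (intro prod.cong refl)
    fix c
    show "(\<integral>\<^sup>+ z. (\<Prod>i<fst z. g (snd z i)) \<partial>Ml c) = ennreal (exp (- (mu c * (1 - ?e c))))"
      unfolding Ml_def
    proof (rule mark_pgf[OF gm])
      show "(\<integral>\<^sup>+ x. g x \<partial>U c) = ennreal (?e c)"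
        unfolding g_def by (rule uniform_pgf(1)) (use B disj s in auto)
      show "0 \<le> ?e c"
        by (rule uniform_pgf(2)) (use B disj s in auto)
    qed
  qed
  also have "\<dots> = (\<Prod>c<C. ennreal (exp (- (\<Sum>j<k. a * (1 - s j) * measure lborel (cell c \<inter> B j)))))"
  proof (intro prod.cong refl)
    fix c
    have "mu c * (1 - ?e c) = (\<Sum>j<k. mu c * ((1 - s j) * measure (U c) (B j)))"
      by (simp add: sum_distrib_left)
    also have "\<dots> = (\<Sum>j<k. a * (1 - s j) * measure lborel (cell c \<inter> B j))"
    proof (intro sum.cong refl)
      fix j assume "j \<in> {..<k}"
      then have "measure (U c) (B j) = measure lborel (cell c \<inter> B j) / measure lborel (cell c)"
        using measure_U[of "B j" c] B by (simp add: cell_def)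
      then show "mu c * ((1 - s j) * measure (U c) (B j)) = a * (1 - s j) * measure lborel (cell c \<inter> B j)"
        using cell_pos[of c] by (simp add: mu_def)
    qed
    finally show "ennreal (exp (- (mu c * (1 - ?e c)))) = ennreal (exp (- (\<Sum>j<k. a * (1 - s j) * measure lborel (cell c \<inter> B j))))"
      by simp
  qed
  also have "\<dots> = ennreal (exp (- (\<Sum>c<C. \<Sum>j<k. a * (1 - s j) * measure lborel (cell c \<inter> B j))))"
    by (simp add: prod_ennreal exp_sum[symmetric] sum_negf)
  also have "(\<Sum>c<C. \<Sum>j<k. a * (1 - s j) * measure lborel (cell c \<inter> B j)) =
      (\<Sum>j<k. \<Sum>c<C. a * (1 - s j) * measure lborel (cell c \<inter> B j))"
    by (rule sum.swap)
  also have "\<dots> = (\<Sum>j<k. a * measure lborel (B j) * (1 - s j))"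
  proof (intro sum.cong refl)
    fix j assume "j \<in> {..<k}"
    then have "measure lborel (B j) = (\<Sum>c<C. measure lborel (cell c \<inter> B j))"
      using B C by (intro measure_lborel_cells) auto
    then show "(\<Sum>c<C. a * (1 - s j) * measure lborel (cell c \<inter> B j)) = a * measure lborel (B j) * (1 - s j)"
      by (simp add: sum_distrib_left sum_distrib_right ac_simps)
  qed
  also have "ennreal (exp (- \<dots>)) = (\<Prod>j<k. ennreal (exp (- (a * measure lborel (B j) * (1 - s j)))))"
    by (simp add: prod_ennreal exp_sum[symmetric] sum_negf)
  finally show ?thesis .
qed

lemma Pts_law_exists: "\<exists>P. law_of \<Omega> Pts P"
proof -
  have "\<exists>P. law_of \<Omega> (\<lambda>\<omega>. dirac_sum {(c, i). i < fst (\<omega> c)} (\<lambda>(c, i). snd (\<omega> c) i)) P"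
  proof (rule law_of_dirac_sum)
    show "(\<lambda>\<omega>. emeasure (dirac_sum {(c, i). i < fst (\<omega> c)} (\<lambda>(c, i). snd (\<omega> c) i)) B) \<in> borel_measurable \<Omega>"
      if "B \<in> sets borel" for B
      using measurable_Pts[OF that] by (simp only: Pts_def)
    fix c
    show "AE \<omega> in \<Omega>. emeasure (dirac_sum {(c, i). i < fst (\<omega> c)} (\<lambda>(c, i). snd (\<omega> c) i)) (cell c) < \<infinity>"
      using AE_cells
    proof eventually_elim
      case (elim \<omega>)
      have "emeasure (Pts \<omega>) (cell c) = of_nat (\<Sum>c'<Suc c. \<Sum>i<fst (\<omega> c'). of_bool (snd (\<omega> c') i \<in> cell c))"
        using elim by (intro count_Pts) auto
      then show ?case
        unfolding Pts_def by (simp only: of_nat_less_top infinity_ennreal_def)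
    qed
  qed
  then show ?thesis by (simp only: Pts_def[abs_def])
qed

text \<open>The joint generating function is carried over to the law \<open>P\<close>; counts,
  independence and finite means are then all read off from it.\<close>

lemma Pts_law_poisson:
  assumes "law_of \<Omega> Pts P"
  shows "homogeneous_poisson a P"
proof -
  obtain \<Phi>' where \<Phi>': "\<Phi>' \<in> measurable \<Omega> config_space" "AE \<omega> in \<Omega>. \<Phi>' \<omega> = Pts \<omega>"
    "P = distr \<Omega> config_space \<Phi>'"
    using assms unfolding law_of_def by blast
  interpret P: prob_space P
    by (rule law_of_prob[OF assms prob_\<Omega>])
  have sP: "sets P = sets config_space"
    by (rule law_of_prob[OF assms prob_\<Omega>])
  have spP: "space P = counting_measures"
    using sets_eq_imp_space_eq[OF sP] space_config_space by simp
  have cm: "npoints B \<in> measurable P (count_space UNIV)" if "B \<in> sets borel" for B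
    using measurable_count[OF that] measurable_cong_sets[OF sP refl] by blast
  have pgf: "(\<integral>\<^sup>+ N. (\<Prod>j<k. ennreal (s j) ^ npoints (B j) N) \<partial>P) =
      (\<Prod>j<k. ennreal (exp (- (a * measure lborel (B j) * (1 - s j)))))"
    if B: "\<And>j. j < k \<Longrightarrow> B j \<in> sets borel \<and> bounded (B j)" and disj: "disjoint_family_on B {..<k}"
      and s: "\<And>j. 0 \<le> s j \<and> s j \<le> 1" for k :: nat and B and s :: "nat \<Rightarrow> real"
  proof -
    have m: "(\<lambda>N. \<Prod>j<k. ennreal (s j) ^ npoints (B j) N) \<in> borel_measurable config_space"
    proof (rule borel_measurable_prod_ennreal)
      fix j assume "j \<in> {..<k}"
      then have "B j \<in> sets borel" using B by simp
      then show "(\<lambda>N. ennreal (s j) ^ npoints (B j) N) \<in> borel_measurable config_space"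
        by (intro measurable_compose[OF measurable_count, where g = "\<lambda>n. ennreal (s j) ^ n"]) simp_all
    qed
    have "(\<integral>\<^sup>+ N. (\<Prod>j<k. ennreal (s j) ^ npoints (B j) N) \<partial>P) =
        (\<integral>\<^sup>+ \<omega>. (\<Prod>j<k. ennreal (s j) ^ npoints (B j) (\<Phi>' \<omega>)) \<partial>\<Omega>)"
      unfolding \<Phi>'(3) by (rule nn_integral_distr[OF \<Phi>'(1)]) (simp add: m)
    also have "\<dots> = (\<integral>\<^sup>+ \<omega>. (\<Prod>j<k. ennreal (s j) ^ npoints (B j) (Pts \<omega>)) \<partial>\<Omega>)"
      by (rule nn_integral_cong_AE) (use \<Phi>'(2) in \<open>auto elim!: eventually_mono\<close>)
    also have "\<dots> = (\<Prod>j<k. ennreal (exp (- (a * measure lborel (B j) * (1 - s j)))))"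
      by (rule pgf_Pts[OF B disj s])
    finally show ?thesis .
  qed
  \<comment> \<open>A single set is treated as a family indexed by \<open>{..<1}\<close>.\<close>
  have distr: "emeasure P {N \<in> space P. npoints B N = n} = ennreal (pois (a * measure lborel B) n)"
    if B: "B \<in> sets borel" "bounded B" for B n
  proof (rule P.poisson_of_pgf(1)[where J = "{..<1::nat}" and V = "\<lambda>_. npoints B" and l = "\<lambda>_. a * measure lborel B" and j = 0])
    show "(\<integral>\<^sup>+ N. (\<Prod>j<1. ennreal (s j) ^ npoints B N) \<partial>P) = (\<Prod>j<1. ennreal (exp (- (a * measure lborel B * (1 - s j)))))"
      if "\<And>j. 0 \<le> s j \<and> s j \<le> 1" for s :: "nat \<Rightarrow> real"
      using pgf[of 1 "\<lambda>_. B" s] that B by (simp add: disjoint_family_on_def)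
  qed (use a cm B in auto)
  show ?thesis
    unfolding homogeneous_poisson_def point_process_def
  proof (intro conjI ballI allI impI)
    show "prob_space P" by (rule P.prob_space_axioms)
    show "sets P = sets config_space" by (rule sP)
  next
    fix B :: "plane set" assume B: "B \<in> sets borel" "bounded B"
    have "mean_measure P B = (\<integral>\<^sup>+ N. of_nat (npoints B N) \<partial>P)"
      unfolding mean_measure_def using spP emeasure_count[OF _ B]
      by (intro nn_integral_cong) auto
    also have "\<dots> = ennreal (a * measure lborel B)"
      using a by (subst nn_integral_nat_valued[OF cm[OF B(1)]]) (auto simp: distr[OF B] intro!: suminf_pois_mean)
    finally show "mean_measure P B < \<infinity>" by simp
  next
    fix B :: "plane set" and n :: nat assume B: "B \<in> sets borel" "bounded B"
    have "{N \<in> space P. emeasure N B = of_nat n} = {N \<in> space P. npoints B N = n}"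
      using spP emeasure_count[OF _ B] by auto
    then show "measure P {N \<in> space P. emeasure N B = of_nat n} =
        (a * measure lborel B) ^ n / fact n * exp (- (a * measure lborel B))"
      using distr[OF B, of n] a by (simp add: measure_def pois_nonneg) (simp add: pois_def)
  next
    fix k :: nat and B :: "nat \<Rightarrow> plane set"
    assume B: "\<forall>i<k. B i \<in> sets borel \<and> bounded (B i)" and disj: "disjoint_family_on B {..<k}"
    have "P.indep_vars (\<lambda>_. count_space UNIV) (\<lambda>i. npoints (B i)) {..<k}"
    proof (rule P.poisson_of_pgf(2)[where l = "\<lambda>j. a * measure lborel (B j)"])
      show "(\<integral>\<^sup>+ N. (\<Prod>j<k. ennreal (s j) ^ npoints (B j) N) \<partial>P) =
          (\<Prod>j<k. ennreal (exp (- (a * measure lborel (B j) * (1 - s j)))))"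
        if "\<And>j. 0 \<le> s j \<and> s j \<le> 1" for s :: "nat \<Rightarrow> real"
        using pgf[of k B s] that B disj by blast
    qed (use a cm B in auto)
    then have "P.indep_vars (\<lambda>_. borel) (\<lambda>i N. of_nat (npoints (B i) N) :: ennreal) {..<k}"
      by (rule P.indep_vars_compose2) simp
    then show "P.indep_vars (\<lambda>_. borel) (\<lambda>i N. emeasure N (B i)) {..<k}"
      by (subst P.indep_vars_cong_space[where Y = "\<lambda>i N. of_nat (npoints (B i) N)"])
        (use B spP in \<open>auto simp: emeasure_count\<close>)
  qed
qed

section \<open>Arranging the Poisson points in a sequence\<close>

text \<open>Marked centres are indexed by one natural number, whereas \<open>Pts\<close> is indexed
  by a cell and a position in it. Coding pairs as naturals leaves gaps wherever the position exceeds
  the number of points; \<open>enumerate\<close> then skips the gaps.\<close>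

definition point_index :: "(nat \<Rightarrow> nat \<times> (nat \<Rightarrow> plane)) \<Rightarrow> nat set" where
  "point_index \<omega> = {m. case prod_decode m of (c, i) \<Rightarrow> i < fst (\<omega> c)}"

definition pt :: "(nat \<Rightarrow> nat \<times> (nat \<Rightarrow> plane)) \<Rightarrow> nat \<Rightarrow> plane" where
  "pt \<omega> m = (case prod_decode m of (c, i) \<Rightarrow> snd (\<omega> c) i)"

definition centre :: "nat \<Rightarrow> (nat \<Rightarrow> nat \<times> (nat \<Rightarrow> plane)) \<Rightarrow> plane" where
  "centre n \<omega> = pt \<omega> (enumerate (point_index \<omega>) n)"

lemma measurable_fst_component: "(\<lambda>\<omega>. fst (\<omega> c)) \<in> measurable \<Omega> (count_space UNIV)"
proof -
  have "fst \<in> measurable (Ml c) (count_space UNIV)"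
    unfolding Ml_def by (rule measurable_mark_fst)
  then show ?thesis by (rule measurable_compose[OF component])
qed

lemma measurable_pt: "(\<lambda>\<omega>. pt \<omega> m) \<in> borel_measurable \<Omega>"
proof -
  obtain c i where ci: "prod_decode m = (c, i)" by force
  have "(\<lambda>z. snd z i) \<in> borel_measurable (Ml c)"
    unfolding Ml_def by (rule measurable_mark_snd)
  then have "(\<lambda>\<omega>. snd (\<omega> c) i) \<in> borel_measurable \<Omega>"
    by (rule measurable_compose[OF component])
  then show ?thesis by (simp add: pt_def ci)
qed

text \<open>By recursion: the least element is a measurable function of the set, and removing it
  leaves a set that again depends measurably on the outcome.\<close>

lemma measurable_enumerate:
  fixes S :: "'w \<Rightarrow> nat set"
  assumes "\<And>m. Measurable.pred M (\<lambda>\<omega>. m \<in> S \<omega>)"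
  shows "(\<lambda>\<omega>. enumerate (S \<omega>) n) \<in> measurable M (count_space UNIV)"
  using assms
proof (induction n arbitrary: S)
  case 0
  then show ?case unfolding enumerate_0 by (intro measurable_Least)
next
  case (Suc n)
  have L: "(\<lambda>\<omega>. LEAST m. m \<in> S \<omega>) \<in> measurable M (count_space UNIV)"
    using Suc.prems by (intro measurable_Least)
  have "Measurable.pred M (\<lambda>\<omega>. m \<in> S \<omega> - {LEAST m. m \<in> S \<omega>})" for m
  proof -
    have "Measurable.pred M (\<lambda>\<omega>. (LEAST m. m \<in> S \<omega>) = m)"
      using measurable_sets[OF L, of "{m}"] by (simp add: pred_def vimage_def Int_def conj_commute)
    then have "Measurable.pred M (\<lambda>\<omega>. m \<in> S \<omega> \<and> \<not> (LEAST m. m \<in> S \<omega>) = m)"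
      using Suc.prems by (intro pred_intros_logic)
    moreover have "m \<in> S \<omega> - {LEAST m. m \<in> S \<omega>} \<longleftrightarrow> m \<in> S \<omega> \<and> \<not> (LEAST m. m \<in> S \<omega>) = m" for \<omega>
      by auto
    ultimately show ?thesis by (simp only:)
  qed
  then show ?case unfolding enumerate_Suc by (rule Suc.IH)
qed

lemma pred_point_index: "Measurable.pred \<Omega> (\<lambda>\<omega>. m \<in> point_index \<omega>)"
proof -
  obtain c i where ci: "prod_decode m = (c, i)" by force
  have "Measurable.pred (count_space UNIV) (\<lambda>k. i < k)" by simp
  then have "Measurable.pred \<Omega> (\<lambda>\<omega>. i < fst (\<omega> c))"
    by (rule measurable_compose[OF measurable_fst_component])
  then show ?thesis by (simp add: point_index_def ci)
qed

lemma measurable_centre: "centre n \<in> borel_measurable \<Omega>"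
  unfolding centre_def[abs_def]
  by (rule measurable_compose_countable[where f = "\<lambda>m \<omega>. pt \<omega> m", OF measurable_pt
        measurable_enumerate[OF pred_point_index]])

text \<open>That \<open>k\<close> cells from number \<open>m\<close> on are all empty has
  probability at most \<open>exp (- (a * disc_area)) ^ k\<close>, which tends to 0; so almost surely
  nonempty cells occur beyond every \<open>m\<close>.\<close>

lemma AE_infinitely_many_points: "AE \<omega> in \<Omega>. infinite (point_index \<omega>)"
proof -
  interpret prob_space \<Omega> by (rule prob_\<Omega>)
  have "AE \<omega> in \<Omega>. \<exists>c\<ge>m. fst (\<omega> c) > 0" for m
  proof -
    let ?A = "{\<omega> \<in> space \<Omega>. \<forall>c\<in>{m..}. fst (\<omega> c) = 0}"
    have zero: "{\<omega> \<in> space \<Omega>. fst (\<omega> c) = 0} \<in> sets \<Omega>" for c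
      using measurable_sets[OF measurable_fst_component, of "{0}" c]
      by (simp add: vimage_def Int_def conj_commute)
    then have A: "?A \<in> sets \<Omega>"
      by (intro sets.sets_Collect_countable_All') auto
    have bound: "prob ?A \<le> exp (- (a * disc_area)) ^ k" for k
    proof -
      have "emeasure \<Omega> ?A = (\<integral>\<^sup>+ \<omega>. indicator ?A \<omega> \<partial>\<Omega>)"
        using A by simp
      \<comment> \<open>The empty product is 1, so a product of zeros over \<open>i < fst z\<close>
        is the indicator of a cell with no points.\<close>
      also have "\<dots> \<le> (\<integral>\<^sup>+ \<omega>. (\<Prod>c\<in>{m..<m + k}. (\<lambda>z. \<Prod>i<fst z. 0) (\<omega> c)) \<partial>\<Omega>)"
        by (intro nn_integral_mono) (auto simp: indicator_def intro!: prod.neutral)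
      also have "\<dots> = (\<Prod>c\<in>{m..<m + k}. \<integral>\<^sup>+ z. (\<Prod>i<fst z. 0) \<partial>Ml c)"
        unfolding \<Omega>_def
        by (rule nn_integral_PiM_prod[OF prob_Ml, where g = "\<lambda>_ z. \<Prod>i<fst z. 0"])
           (simp_all only: Ml_def finite_atLeastLessThan measurable_mark_prod[where g = "\<lambda>_. 0", OF borel_measurable_const])
      also have "\<dots> = (\<Prod>c\<in>{m..<m + k}. ennreal (exp (- mu c)))"
      proof (intro prod.cong refl)
        fix c
        have "(\<integral>\<^sup>+ z. (\<Prod>i<fst z. 0) \<partial>Ml c) = ennreal (exp (- (mu c * (1 - 0))))"
          unfolding Ml_def by (rule mark_pgf[where g = "\<lambda>_. 0"]) (simp_all del: of_nat_Suc)
        then show "(\<integral>\<^sup>+ z. (\<Prod>i<fst z. 0) \<partial>Ml c) = ennreal (exp (- mu c))"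
          by simp
      qed
      also have "\<dots> = ennreal (\<Prod>c\<in>{m..<m + k}. exp (- mu c))"
        by (simp add: prod_ennreal)
      also have "\<dots> \<le> ennreal (\<Prod>c\<in>{m..<m + k}. exp (- (a * disc_area)))"
        using measure_cell_ge a by (intro ennreal_leI prod_mono) (auto simp: mu_def)
      also have "\<dots> = ennreal (exp (- (a * disc_area)) ^ k)"
        by simp
      finally show ?thesis
        by (simp add: emeasure_eq_measure)
    qed
    have "(\<lambda>k. exp (- (a * disc_area)) ^ k) \<longlonglongrightarrow> 0"
      using a disc_area_pos by (intro LIMSEQ_realpow_zero) simp_all
    then have "prob ?A \<le> 0"
      by (rule LIMSEQ_le_const) (use bound in blast)
    then have "emeasure \<Omega> ?A = 0"
      by (simp add: emeasure_eq_measure measure_le_0_iff)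
    then have "AE \<omega> in \<Omega>. \<omega> \<notin> ?A"
      using A by (intro AE_not_in) (simp add: null_sets_def)
    then show ?thesis
      using AE_space by eventually_elim auto
  qed
  then have "AE \<omega> in \<Omega>. \<forall>m. \<exists>c\<ge>m. fst (\<omega> c) > 0"
    by (simp add: AE_all_countable)
  then show ?thesis
  proof eventually_elim
    case (elim \<omega>)
    then have "infinite {c. fst (\<omega> c) > 0}"
      by (auto simp: infinite_nat_iff_unbounded_le)
    moreover have "(\<lambda>c. prod_encode (c, 0)) ` {c. fst (\<omega> c) > 0} \<subseteq> point_index \<omega>"
      by (auto simp: point_index_def)
    moreover have "inj_on (\<lambda>c. prod_encode (c, 0)) {c. fst (\<omega> c) > 0}"
      by (auto simp: inj_on_def)
    ultimately show ?case
      using finite_imageD finite_subset by blast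
  qed
qed

lemma centres_law:
  "\<exists>P. homogeneous_poisson a P \<and> law_of \<Omega> (\<lambda>\<omega>. dirac_sum UNIV (\<lambda>n. centre n \<omega>)) P"
proof -
  obtain P where P: "law_of \<Omega> Pts P" using Pts_law_exists by blast
  have "dirac_sum UNIV (\<lambda>n. centre n \<omega>) = Pts \<omega>" if "infinite (point_index \<omega>)" for \<omega>
  proof -
    have bij1: "bij_betw (enumerate (point_index \<omega>)) UNIV (point_index \<omega>)"
      using that by (rule bij_enumerate)
    have "bij_betw prod_decode (point_index \<omega>) {(c, i). i < fst (\<omega> c)}"
      unfolding bij_betw_def
    proof
      show "inj_on prod_decode (point_index \<omega>)"
        by (rule inj_prod_decode)
      show "prod_decode ` point_index \<omega> = {(c, i). i < fst (\<omega> c)}"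
        by (force simp: point_index_def image_iff intro: exI[of _ "prod_encode (_, _)"])
    qed
    with bij1 have "bij_betw (prod_decode \<circ> enumerate (point_index \<omega>)) UNIV {(c, i). i < fst (\<omega> c)}"
      by (rule bij_betw_trans)
    from dirac_sum_reindex[OF this, of "\<lambda>(c, i). snd (\<omega> c) i"] show ?thesis
      by (simp add: centre_def[abs_def] pt_def Pts_def)
  qed
  then have "AE \<omega> in \<Omega>. dirac_sum UNIV (\<lambda>n. centre n \<omega>) = Pts \<omega>"
    using AE_infinitely_many_points by (auto elim!: eventually_mono)
  moreover obtain \<Phi>' where "\<Phi>' \<in> measurable \<Omega> config_space" "AE \<omega> in \<Omega>. \<Phi>' \<omega> = Pts \<omega>"
    "P = distr \<Omega> config_space \<Phi>'"
    using P unfolding law_of_def by blast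
  moreover from calculation have "AE \<omega> in \<Omega>. \<Phi>' \<omega> = dirac_sum UNIV (\<lambda>n. centre n \<omega>)"
    by (auto elim: eventually_elim2)
  ultimately have "law_of \<Omega> (\<lambda>\<omega>. dirac_sum UNIV (\<lambda>n. centre n \<omega>)) P"
    unfolding law_of_def by blast
  with Pts_law_poisson[OF P] show ?thesis by blast
qed

end

section \<open>Annular cluster processes\<close>

lemma law_of_unique:
  assumes "law_of M \<Phi> P" "law_of M \<Phi> P'"
  shows "P = P'"
proof -
  obtain f where f: "f \<in> measurable M config_space" "AE \<omega> in M. f \<omega> = \<Phi> \<omega>" "P = distr M config_space f"
    using assms(1) unfolding law_of_def by blast
  obtain g where g: "g \<in> measurable M config_space" "AE \<omega> in M. g \<omega> = \<Phi> \<omega>" "P' = distr M config_space g"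
    using assms(2) unfolding law_of_def by blast
  have "AE \<omega> in M. f \<omega> = g \<omega>"
    using f(2) g(2) by eventually_elim simp
  then show ?thesis
    unfolding f(3) g(3) by (intro distr_cong_AE f(1) g(1) refl)
qed

text \<open>Allows laws on different sample spaces to be compared after pulling them back to a
  common one.\<close>

lemma law_of_distr:
  assumes g: "g \<in> measurable M N" and law: "law_of (distr M N g) \<Phi> P"
  shows "law_of M (\<lambda>\<omega>. \<Phi> (g \<omega>)) P"
proof -
  obtain f where f: "f \<in> measurable (distr M N g) config_space" "AE \<omega> in distr M N g. f \<omega> = \<Phi> \<omega>"
    "P = distr (distr M N g) config_space f"
    using law unfolding law_of_def by blast
  have fN: "f \<in> measurable N config_space"
    using f(1) by simp
  have "(\<lambda>\<omega>. f (g \<omega>)) \<in> measurable M config_space"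
    by (rule measurable_compose[OF g fN])
  moreover have "AE \<omega> in M. f (g \<omega>) = \<Phi> (g \<omega>)"
    by (rule AE_distrD[OF g f(2)])
  moreover have "P = distr M config_space (\<lambda>\<omega>. f (g \<omega>))"
    using f(3) distr_distr[OF fN g] by (simp only: comp_def)
  ultimately show ?thesis
    unfolding law_of_def by (intro bexI[of _ "\<lambda>\<omega>. f (g \<omega>)"] conjI)
qed

lemma distr_pair_fst_prob:
  assumes "prob_space B"
  shows "distr (A \<Otimes>\<^sub>M B) A fst = A"
proof (rule measure_eqI)
  interpret B: prob_space B by fact
  fix S assume "S \<in> sets (distr (A \<Otimes>\<^sub>M B) A fst)"
  then have S: "S \<in> sets A" by simp
  have "fst -` S \<inter> space (A \<Otimes>\<^sub>M B) = S \<times> space B"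
    using sets.sets_into_space[OF S] by (auto simp: space_pair_measure)
  then show "emeasure (distr (A \<Otimes>\<^sub>M B) A fst) S = emeasure A S"
    using S by (simp add: emeasure_distr B.emeasure_pair_measure_Times B.emeasure_space_1)
qed simp

lemma emeasure_cluster_points:
  assumes "B \<in> sets borel"
  shows "emeasure (cluster_points X Z \<omega>) B =
    (\<Sum>n. \<Sum>i. indicator {..<fst (Z n \<omega>)} i * indicator B (X n \<omega> + snd (Z n \<omega>) i))"
  unfolding cluster_points_def by (rule emeasure_dirac_sum_clusters[OF assms])

lemma emeasure_lborel_translate:
  assumes "B \<in> sets borel"
  shows "emeasure lborel ((\<lambda>x. x + y) -` B) = emeasure lborel (B :: plane set)"
proof -
  have "emeasure lborel B = emeasure (distr lborel borel ((+) y)) B"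
    by (simp only: lborel_distr_plus)
  also have "\<dots> = emeasure lborel ((+) y -` B)"
    using assms by (subst emeasure_distr) simp_all
  also have "(+) y -` B = (\<lambda>x. x + y) -` B"
    by (auto simp: add.commute)
  finally show ?thesis ..
qed

context mark
begin

definition \<Lambda> :: "(nat \<Rightarrow> nat \<times> (nat \<Rightarrow> plane)) measure" where
  "\<Lambda> = (\<Pi>\<^sub>M n\<in>UNIV. mark_law R \<delta> \<mu>)"

lemma prob_\<Lambda>: "prob_space \<Lambda>"
  unfolding \<Lambda>_def by (intro prob_space_PiM prob_mark)

lemma component_\<Lambda>: "(\<lambda>z. z n) \<in> measurable \<Lambda> (mark_law R \<delta> \<mu>)"
  unfolding \<Lambda>_def by (rule measurable_component_singleton) simp

lemma measurable_shifted_point: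
  assumes "B \<in> sets borel"
  shows "(\<lambda>(x, z). indicator {..<fst z} i * indicator B (x + snd z i) :: ennreal) \<in>
    borel_measurable (borel \<Otimes>\<^sub>M mark_law R \<delta> \<mu>)"
proof -
  have [measurable]: "B \<in> sets borel" by fact
  have "(\<lambda>(x, z). indicator {..<fst z} i * indicator B (x + snd z i) :: ennreal) \<in>
      borel_measurable (borel \<Otimes>\<^sub>M (count_space UNIV \<Otimes>\<^sub>M (\<Pi>\<^sub>M i\<in>(UNIV::nat set). borel)))"
    unfolding indicator_def lessThan_iff by measurable
  moreover have eq: "sets ((borel :: plane measure) \<Otimes>\<^sub>M mark_law R \<delta> \<mu>) =
      sets (borel \<Otimes>\<^sub>M (count_space UNIV \<Otimes>\<^sub>M (\<Pi>\<^sub>M i\<in>(UNIV::nat set). borel)))"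
    by (intro sets_pair_measure_cong refl sets_mark)
  ultimately show ?thesis
    by (simp only: measurable_cong_sets[OF eq refl])
qed

lemma measurable_cluster_count:
  assumes B: "B \<in> sets borel"
  shows "(\<lambda>(x, z). \<Sum>n. \<Sum>i. indicator {..<fst (z n)} i * indicator B (x n + snd (z n) i) :: ennreal) \<in>
    borel_measurable ((\<Pi>\<^sub>M n\<in>UNIV. borel) \<Otimes>\<^sub>M \<Lambda>)"
  unfolding split_beta'
proof (intro borel_measurable_suminf_order)
  fix n i
  have "(\<lambda>p. (fst p n, snd p n)) \<in> measurable ((\<Pi>\<^sub>M n\<in>(UNIV::nat set). borel) \<Otimes>\<^sub>M \<Lambda>) (borel \<Otimes>\<^sub>M mark_law R \<delta> \<mu>)"
  proof (rule measurable_Pair)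
    show "(\<lambda>p. fst p n) \<in> measurable ((\<Pi>\<^sub>M n\<in>(UNIV::nat set). borel) \<Otimes>\<^sub>M \<Lambda>) borel"
      by (rule measurable_compose[OF measurable_fst measurable_component_singleton]) simp
    show "(\<lambda>p. snd p n) \<in> measurable ((\<Pi>\<^sub>M n\<in>(UNIV::nat set). borel) \<Otimes>\<^sub>M \<Lambda>) (mark_law R \<delta> \<mu>)"
      by (rule measurable_compose[OF measurable_snd component_\<Lambda>])
  qed
  from measurable_compose[OF this measurable_shifted_point[OF B, of i]]
  show "(\<lambda>p. indicator {..<fst (snd p n)} i * indicator B (fst p n + snd (snd p n) i) :: ennreal) \<in>
      borel_measurable ((\<Pi>\<^sub>M n\<in>UNIV. borel) \<Otimes>\<^sub>M \<Lambda>)"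
    by (simp add: split_beta')
qed

end

section \<open>Mean measure and law of a cluster process\<close>

text \<open>An arbitrary representation by marked centres, not the constructed one: the final claim
  concerns every law of an annular cluster process, whatever sample space and enumeration it comes
  from.\<close>

locale marked = mark +
  fixes \<alpha> :: real and M :: "'w measure" and X :: "nat \<Rightarrow> 'w \<Rightarrow> plane" and Z :: "nat \<Rightarrow> 'w \<Rightarrow> nat \<times> (nat \<Rightarrow> plane)"
  assumes \<alpha>: "0 < \<alpha>" and marked: "marked_centres \<alpha> R \<delta> \<mu> M X Z"
begin

abbreviation "Seq \<equiv> (\<Pi>\<^sub>M n\<in>(UNIV::nat set). borel) :: (nat \<Rightarrow> plane) measure"

definition Q :: "(nat \<Rightarrow> plane) measure" where
  "Q = distr M Seq (\<lambda>\<omega> n. X n \<omega>)"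

lemma prob_M: "prob_space M"
  using marked by (simp add: marked_centres_def)

lemma X_meas: "(\<lambda>\<omega> n. X n \<omega>) \<in> measurable M Seq"
  using marked by (simp add: marked_centres_def)

lemma Z_meas: "(\<lambda>\<omega> n. Z n \<omega>) \<in> measurable M \<Lambda>"
  using marked by (simp add: marked_centres_def \<Lambda>_def)

lemma prob_Q: "prob_space Q"
  unfolding Q_def by (rule prob_space.prob_space_distr[OF prob_M X_meas])

lemma sets_Q: "sets Q = sets Seq"
  by (simp add: Q_def)

lemma XZ_meas: "(\<lambda>\<omega>. (\<lambda>n. X n \<omega>, \<lambda>n. Z n \<omega>)) \<in> measurable M (Seq \<Otimes>\<^sub>M \<Lambda>)"
  by (rule measurable_Pair[OF X_meas Z_meas])

text \<open>This is how the independence of marks and centres enters: the joint law is a product, so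
  the marks are integrated first with the centres held fixed.\<close>

lemma nn_integral_XZ:
  assumes H: "(\<lambda>(x, z). H x z) \<in> borel_measurable (Seq \<Otimes>\<^sub>M \<Lambda>)"
  shows "(\<integral>\<^sup>+ \<omega>. H (\<lambda>n. X n \<omega>) (\<lambda>n. Z n \<omega>) \<partial>M) = (\<integral>\<^sup>+ x. \<integral>\<^sup>+ z. H x z \<partial>\<Lambda> \<partial>Q)"
proof -
  interpret sigma_finite_measure \<Lambda> by (rule prob_space_imp_sigma_finite[OF prob_\<Lambda>])
  have "(\<integral>\<^sup>+ \<omega>. H (\<lambda>n. X n \<omega>) (\<lambda>n. Z n \<omega>) \<partial>M) =
      (\<integral>\<^sup>+ p. (\<lambda>(x, z). H x z) p \<partial>distr M (Seq \<Otimes>\<^sub>M \<Lambda>) (\<lambda>\<omega>. (\<lambda>n. X n \<omega>, \<lambda>n. Z n \<omega>)))"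
    by (subst nn_integral_distr[OF XZ_meas]) (simp_all add: H)
  also have "distr M (Seq \<Otimes>\<^sub>M \<Lambda>) (\<lambda>\<omega>. (\<lambda>n. X n \<omega>, \<lambda>n. Z n \<omega>)) = Q \<Otimes>\<^sub>M \<Lambda>"
    using marked unfolding marked_centres_def \<Lambda>_def Q_def by blast
  also have "(\<integral>\<^sup>+ p. (\<lambda>(x, z). H x z) p \<partial>(Q \<Otimes>\<^sub>M \<Lambda>)) = (\<integral>\<^sup>+ x. \<integral>\<^sup>+ z. H x z \<partial>\<Lambda> \<partial>Q)"
    using H measurable_cong_sets[OF sets_pair_measure_cong[OF sets_Q refl] refl]
    by (subst nn_integral_fst[symmetric]) auto
  finally show ?thesis .
qed

lemma measurable_cluster_points:
  assumes B: "B \<in> sets borel"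
  shows "(\<lambda>\<omega>. emeasure (cluster_points X Z \<omega>) B) \<in> borel_measurable M"
  unfolding emeasure_cluster_points[OF B]
  using measurable_compose[OF XZ_meas measurable_cluster_count[OF B]] by simp

lemma centres_mean:
  assumes B: "B \<in> sets borel"
  shows "(\<integral>\<^sup>+ x. (\<Sum>n. indicator B (x n)) \<partial>Q) = ennreal \<alpha> * emeasure lborel B"
proof -
  obtain P where P: "homogeneous_poisson \<alpha> P" "law_of M (\<lambda>\<omega>. dirac_sum UNIV (\<lambda>n. X n \<omega>)) P"
    using marked by (auto simp: marked_centres_def)
  have "(\<lambda>x. indicator B (x n) :: ennreal) \<in> borel_measurable Seq" for n
    by (rule measurable_compose[OF measurable_component_singleton]) (use B in simp_all)
  then have m: "(\<lambda>x. \<Sum>n. indicator B (x n) :: ennreal) \<in> borel_measurable Seq"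
    by (rule borel_measurable_suminf_order)
  have "(\<integral>\<^sup>+ x. (\<Sum>n. indicator B (x n)) \<partial>Q) = (\<integral>\<^sup>+ \<omega>. (\<Sum>n. indicator B (X n \<omega>)) \<partial>M)"
    unfolding Q_def by (subst nn_integral_distr[OF X_meas]) (simp_all add: m)
  also have "\<dots> = mean_measure P B"
    by (simp add: law_of_mean[OF P(2) B] emeasure_dirac_sum_nat[OF B])
  also have "\<dots> = ennreal \<alpha> * emeasure lborel B"
    using homogeneous_poisson_intensity[OF P(1) \<alpha>] B by (simp add: has_intensity_def)
  finally show ?thesis .
qed

text \<open>Campbell's formula: averaging over the marks leaves \<open>\<mu>\<close> times one
  uniform displacement per centre. For a fixed displacement the mean number of shifted centres in
  \<open>B\<close> is the mean number of centres in a translate of \<open>B\<close>, which has the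
  same area.\<close>

lemma cluster_mean:
  assumes B: "B \<in> sets borel"
  shows "(\<integral>\<^sup>+ \<omega>. emeasure (cluster_points X Z \<omega>) B \<partial>M) = ennreal (\<alpha> * \<mu>) * emeasure lborel B"
proof -
  let ?h = "\<lambda>x i z. indicator {..<fst z} i * indicator B (x + snd z i) :: ennreal"
  have pm: "?h x i \<in> borel_measurable (mark_law R \<delta> \<mu>)" for x i
    using measurable_compose[OF measurable_Pair1' measurable_shifted_point[OF B, of i], of x] by simp
  have hm: "(\<lambda>z. ?h x i (z n)) \<in> borel_measurable \<Lambda>" for x i n
    using measurable_compose[OF component_\<Lambda> pm] by simp
  have tB: "(\<lambda>y. x + y) -` B \<in> sets borel" for x :: plane
    using measurable_sets[of "\<lambda>y. x + y" borel borel B] B by simp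
  have inner: "(\<integral>\<^sup>+ z. ?h x i (z n) \<partial>\<Lambda>) =
      (\<Sum>k. ennreal (pois \<mu> k) * indicator {..<k} i) * (\<integral>\<^sup>+ y. indicator B (x + y) \<partial>U)" for x i n
  proof -
    have "(\<integral>\<^sup>+ z. ?h x i (z n) \<partial>\<Lambda>) = (\<integral>\<^sup>+ z. (\<Prod>m\<in>{n}. ?h x i (z m)) \<partial>\<Lambda>)"
      by simp
    also have "\<dots> = (\<integral>\<^sup>+ z. ?h x i z \<partial>mark_law R \<delta> \<mu>)"
      unfolding \<Lambda>_def
      by (subst nn_integral_PiM_prod[OF prob_mark, where g = "\<lambda>_. ?h x i"]) (simp_all add: pm)
    also have "\<dots> = (\<integral>\<^sup>+ z. indicator {..<fst z} i * indicator ((\<lambda>y. x + y) -` B) (snd z i) \<partial>mark_law R \<delta> \<mu>)"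
      by (simp add: indicator_def)
    also have "\<dots> = (\<Sum>k. ennreal (pois \<mu> k) * indicator {..<k} i) * (\<integral>\<^sup>+ y. indicator ((\<lambda>y. x + y) -` B) y \<partial>U)"
      by (rule nn_integral_mark_point) (use tB in simp)
    finally show ?thesis by (simp add: indicator_def)
  qed
  have xm: "(\<lambda>(x, y). \<Sum>n. indicator B (x n + y) :: ennreal) \<in> borel_measurable (Q \<Otimes>\<^sub>M U)"
    unfolding split_beta'
  proof (intro borel_measurable_suminf_order)
    fix n
    have "(\<lambda>p. fst p n + snd p) \<in> borel_measurable (Seq \<Otimes>\<^sub>M (borel :: plane measure))"
      by measurable
    moreover have eq: "sets (Q \<Otimes>\<^sub>M U) = sets (Seq \<Otimes>\<^sub>M (borel :: plane measure))"
      by (intro sets_pair_measure_cong sets_Q) simp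
    ultimately have "(\<lambda>p. fst p n + snd p) \<in> borel_measurable (Q \<Otimes>\<^sub>M U)"
      by (simp only: measurable_cong_sets[OF eq refl])
    then show "(\<lambda>p. indicator B (fst p n + snd p) :: ennreal) \<in> borel_measurable (Q \<Otimes>\<^sub>M U)"
      by (rule measurable_compose) (use B in simp)
  qed
  have ym: "(\<lambda>y. indicator B (x + y) :: ennreal) \<in> borel_measurable U" for x :: plane
  proof -
    have "(\<lambda>y. x + y) \<in> measurable U borel" by simp
    then show ?thesis by (rule measurable_compose) (use B in simp)
  qed
  interpret QU: pair_sigma_finite Q U
    by (intro pair_sigma_finite.intro prob_space_imp_sigma_finite prob_Q prob_U)
  interpret U: prob_space U by (rule prob_U)
  have "(\<integral>\<^sup>+ \<omega>. emeasure (cluster_points X Z \<omega>) B \<partial>M) =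
      (\<integral>\<^sup>+ x. \<integral>\<^sup>+ z. (\<Sum>n. \<Sum>i. ?h (x n) i (z n)) \<partial>\<Lambda> \<partial>Q)"
    unfolding emeasure_cluster_points[OF B]
    by (rule nn_integral_XZ[OF measurable_cluster_count[OF B]])
  also have "\<dots> = (\<integral>\<^sup>+ x. (\<Sum>n. \<Sum>i. \<integral>\<^sup>+ z. ?h (x n) i (z n) \<partial>\<Lambda>) \<partial>Q)"
    using hm by (simp add: nn_integral_suminf borel_measurable_suminf_order)
  also have "\<dots> = (\<integral>\<^sup>+ x. (\<Sum>n. ennreal \<mu> * (\<integral>\<^sup>+ y. indicator B (x n + y) \<partial>U)) \<partial>Q)"
    unfolding inner by (simp only: ennreal_suminf_multc suminf_mark_tail)
  also have "\<dots> = (\<integral>\<^sup>+ x. ennreal \<mu> * (\<integral>\<^sup>+ y. (\<Sum>n. indicator B (x n + y)) \<partial>U) \<partial>Q)"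
    by (simp only: ennreal_suminf_cmult nn_integral_suminf[OF ym])
  also have "\<dots> = ennreal \<mu> * (\<integral>\<^sup>+ x. \<integral>\<^sup>+ y. (\<Sum>n. indicator B (x n + y)) \<partial>U \<partial>Q)"
    using QU.M2.borel_measurable_nn_integral_fst[OF xm] by (intro nn_integral_cmult) simp
  \<comment> \<open>The order is exchanged so that the displacement is fixed while the centres are
    averaged.\<close>
  also have "(\<integral>\<^sup>+ x. \<integral>\<^sup>+ y. (\<Sum>n. indicator B (x n + y)) \<partial>U \<partial>Q) =
      (\<integral>\<^sup>+ y. \<integral>\<^sup>+ x. (\<Sum>n. indicator B (x n + y)) \<partial>Q \<partial>U)"
    using QU.Fubini[OF xm] by simp
  also have "\<dots> = (\<integral>\<^sup>+ y. ennreal \<alpha> * emeasure lborel B \<partial>U)"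
  proof (intro nn_integral_cong)
    fix y :: plane
    have "(\<lambda>x. x + y) -` B \<in> sets borel"
      using measurable_sets[of "\<lambda>x. x + y" borel borel B] B by simp
    from centres_mean[OF this] show "(\<integral>\<^sup>+ x. (\<Sum>n. indicator B (x n + y)) \<partial>Q) = ennreal \<alpha> * emeasure lborel B"
      by (simp add: emeasure_lborel_translate[OF B] indicator_def)
  qed
  also have "\<dots> = ennreal \<alpha> * emeasure lborel B"
    by (simp add: U.emeasure_space_1[simplified])
  finally show ?thesis
    using \<alpha> \<mu> by (simp add: ennreal_mult ac_simps)
qed

text \<open>Local finiteness is a first-moment consequence: the mean number of points in a cell is
  finite, so the number is finite almost surely.\<close>

lemma cluster_law_exists: "\<exists>P. law_of M (cluster_points X Z) P"
  unfolding cluster_points_def[abs_def]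
proof (rule law_of_dirac_sum; fold cluster_points_def)
  show "(\<lambda>\<omega>. emeasure (cluster_points X Z \<omega>) B) \<in> borel_measurable M" if "B \<in> sets borel" for B
    by (rule measurable_cluster_points[OF that])
  fix c
  have "(\<integral>\<^sup>+ \<omega>. emeasure (cluster_points X Z \<omega>) (cell c) \<partial>M) \<noteq> \<infinity>"
    unfolding cluster_mean[OF sets_cell] by (simp add: bounded_borel_finite ennreal_mult_eq_top_iff)
  then have "AE \<omega> in M. emeasure (cluster_points X Z \<omega>) (cell c) \<noteq> \<infinity>"
    by (intro nn_integral_noteq_infinite measurable_cluster_points) simp_all
  then show "AE \<omega> in M. emeasure (cluster_points X Z \<omega>) (cell c) < \<infinity>"
    by eventually_elim (simp add: less_top)
qed

lemma cluster_point_process: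
  assumes P: "law_of M (cluster_points X Z) P"
  shows "point_process P" "has_intensity P (\<alpha> * \<mu>)"
proof -
  have mean: "mean_measure P B = ennreal (\<alpha> * \<mu>) * emeasure lborel B" if "B \<in> sets borel" for B
    using law_of_mean[OF P that] cluster_mean[OF that] by simp
  then show "has_intensity P (\<alpha> * \<mu>)"
    by (simp add: has_intensity_def)
  show "point_process P"
    unfolding point_process_def
    using law_of_prob[OF P prob_M] mean by (auto simp: bounded_borel_finite ennreal_mult_less_top)
qed

end

text \<open>The natural sample space is a product of the Poisson construction with a sequence of
  marks. It is pushed forward to sequences of marked centres, the type on which
  \<open>annular_cluster_process\<close> is defined.\<close>

lemma marked_centres_exist:
  assumes "0 < \<alpha>" "0 < \<delta>" "\<delta> \<le> R" "0 < \<mu>"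
  shows "\<exists>(M :: (nat \<Rightarrow> plane \<times> (nat \<times> (nat \<Rightarrow> plane))) measure) X Z. marked_centres \<alpha> R \<delta> \<mu> M X Z"
proof -
  interpret mark R \<delta> \<mu> by unfold_locales (use assms in auto)
  interpret C: poisson_cells \<alpha> by unfold_locales (use assms in auto)
  let ?L = "mark_law R \<delta> \<mu>" and ?Seq = "(\<Pi>\<^sub>M n\<in>(UNIV::nat set). borel) :: (nat \<Rightarrow> plane) measure"
  let ?T = "\<Pi>\<^sub>M n\<in>(UNIV::nat set). (borel :: plane measure) \<Otimes>\<^sub>M ?L"
  define zip where "zip p n = (C.centre n (fst p), snd p n)"
    for p :: "(nat \<Rightarrow> nat \<times> (nat \<Rightarrow> plane)) \<times> (nat \<Rightarrow> nat \<times> (nat \<Rightarrow> plane))" and n :: nat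
  \<comment> \<open>After the pushforward by \<open>zip\<close>, the variables \<open>X\<close> and
    \<open>Z\<close> are simply the coordinate projections.\<close>
  define M where "M = distr (C.\<Omega> \<Otimes>\<^sub>M \<Lambda>) ?T zip"
  define X where "X n w = fst (w n)" for n :: nat and w :: "nat \<Rightarrow> plane \<times> (nat \<times> (nat \<Rightarrow> plane))"
  define Z where "Z n w = snd (w n)" for n :: nat and w :: "nat \<Rightarrow> plane \<times> (nat \<times> (nat \<Rightarrow> plane))"
  interpret pair_prob_space C.\<Omega> \<Lambda>
    by (intro pair_prob_space.intro pair_sigma_finite.intro prob_space_imp_sigma_finite C.prob_\<Omega> prob_\<Lambda>)
  have zip: "zip \<in> measurable (C.\<Omega> \<Otimes>\<^sub>M \<Lambda>) ?T"
    unfolding zip_def[abs_def]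
  proof (rule measurable_abs_UNIV, rule measurable_Pair)
    show "(\<lambda>p. C.centre n (fst p)) \<in> borel_measurable (C.\<Omega> \<Otimes>\<^sub>M \<Lambda>)" for n
      by (rule measurable_compose[OF measurable_fst C.measurable_centre])
    show "(\<lambda>p. snd p n) \<in> measurable (C.\<Omega> \<Otimes>\<^sub>M \<Lambda>) ?L" for n
      by (rule measurable_compose[OF measurable_snd component_\<Lambda>])
  qed
  have Xm: "(\<lambda>w n. X n w) \<in> measurable ?T ?Seq"
    unfolding X_def
    by (rule measurable_abs_UNIV, rule measurable_compose[OF _ measurable_fst], rule measurable_component_singleton) simp
  have Zm: "(\<lambda>w n. Z n w) \<in> measurable ?T \<Lambda>"
    unfolding Z_def \<Lambda>_def
    by (rule measurable_abs_UNIV, rule measurable_compose[OF _ measurable_snd], rule measurable_component_singleton) simp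
  have cm: "(\<lambda>\<omega> n. C.centre n \<omega>) \<in> measurable C.\<Omega> ?Seq"
    by (rule measurable_abs_UNIV) (rule C.measurable_centre)
  have Xzip: "(\<lambda>n. X n (zip p)) = (\<lambda>n. C.centre n (fst p))" and Zzip: "(\<lambda>n. Z n (zip p)) = snd p" for p
    by (simp_all add: X_def Z_def zip_def)
  have X_distr: "distr M ?Seq (\<lambda>w n. X n w) = distr C.\<Omega> ?Seq (\<lambda>\<omega> n. C.centre n \<omega>)"
  proof -
    have "distr M ?Seq (\<lambda>w n. X n w) = distr (C.\<Omega> \<Otimes>\<^sub>M \<Lambda>) ?Seq (\<lambda>p. (\<lambda>\<omega> n. C.centre n \<omega>) (fst p))"
      unfolding M_def using distr_distr[OF Xm zip] by (simp only: comp_def Xzip)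
    also have "\<dots> = distr (distr (C.\<Omega> \<Otimes>\<^sub>M \<Lambda>) C.\<Omega> fst) ?Seq (\<lambda>\<omega> n. C.centre n \<omega>)"
      using distr_distr[OF cm measurable_fst, of \<Lambda>] by (simp only: comp_def)
    finally show ?thesis
      by (simp only: distr_pair_fst_prob[OF prob_\<Lambda>])
  qed
  have joint: "distr M (?Seq \<Otimes>\<^sub>M \<Lambda>) (\<lambda>w. (\<lambda>n. X n w, \<lambda>n. Z n w)) = distr M ?Seq (\<lambda>w n. X n w) \<Otimes>\<^sub>M \<Lambda>"
  proof -
    have id: "(\<lambda>z. z) \<in> measurable \<Lambda> \<Lambda>" and did: "distr \<Lambda> \<Lambda> (\<lambda>z. z) = \<Lambda>"
      by (simp_all add: distr_id[unfolded id_def])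
    have "distr M (?Seq \<Otimes>\<^sub>M \<Lambda>) (\<lambda>w. (\<lambda>n. X n w, \<lambda>n. Z n w)) =
        distr (C.\<Omega> \<Otimes>\<^sub>M \<Lambda>) (?Seq \<Otimes>\<^sub>M \<Lambda>) (\<lambda>p. (\<lambda>n. C.centre n (fst p), snd p))"
      unfolding M_def using distr_distr[OF measurable_Pair[OF Xm Zm] zip] by (simp only: comp_def Xzip Zzip)
    also have "\<dots> = distr C.\<Omega> ?Seq (\<lambda>\<omega> n. C.centre n \<omega>) \<Otimes>\<^sub>M distr \<Lambda> \<Lambda> (\<lambda>z. z)"
      using pair_measure_distr[OF cm id] prob_space_imp_sigma_finite[OF prob_\<Lambda>]
      by (simp add: did split_beta')
    finally show ?thesis by (simp only: did X_distr)
  qed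
  obtain P\<^sub>0 where P0: "homogeneous_poisson \<alpha> P\<^sub>0" "law_of C.\<Omega> (\<lambda>\<omega>. dirac_sum UNIV (\<lambda>n. C.centre n \<omega>)) P\<^sub>0"
    using C.centres_law by blast
  have pM: "prob_space M"
    unfolding M_def by (rule prob_space_distr[OF zip])
  have dm: "(\<lambda>w. emeasure (dirac_sum UNIV (\<lambda>n. X n w)) B) \<in> borel_measurable M" if B: "B \<in> sets borel" for B
  proof -
    have "(\<lambda>w. indicator B (X n w) :: ennreal) \<in> borel_measurable ?T" for n
    proof -
      have "(\<lambda>w. X n w) \<in> borel_measurable ?T"
        unfolding X_def by (rule measurable_compose[OF _ measurable_fst], rule measurable_component_singleton) simp
      then show ?thesis by (rule measurable_compose) (use B in simp)
    qed
    then show ?thesis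
      unfolding emeasure_dirac_sum_nat[OF B] M_def measurable_distr_eq1 by (rule borel_measurable_suminf_order)
  qed
  have lawP: "law_of (C.\<Omega> \<Otimes>\<^sub>M \<Lambda>) (\<lambda>p. dirac_sum UNIV (\<lambda>n. C.centre n (fst p))) P\<^sub>0"
    using law_of_distr[OF measurable_fst, of C.\<Omega> \<Lambda>] P0(2) unfolding distr_pair_fst_prob[OF prob_\<Lambda>] by blast
  \<comment> \<open>The centres have a measurable version on the product space but not yet on its
    image. Some law \<open>P\<close> is therefore obtained there from finite means, and identified
    with \<open>P\<^sub>0\<close> afterwards.\<close>
  have "\<exists>P. law_of M (\<lambda>w. dirac_sum UNIV (\<lambda>n. X n w)) P"
  proof (rule law_of_dirac_sum[where J = "\<lambda>_. UNIV"])
    fix c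
    have "(\<integral>\<^sup>+ w. emeasure (dirac_sum UNIV (\<lambda>n. X n w)) (cell c) \<partial>M) =
        (\<integral>\<^sup>+ p. emeasure (dirac_sum UNIV (\<lambda>n. C.centre n (fst p))) (cell c) \<partial>(C.\<Omega> \<Otimes>\<^sub>M \<Lambda>))"
      using nn_integral_distr[OF zip, of "\<lambda>w. emeasure (dirac_sum UNIV (\<lambda>n. X n w)) (cell c)"] dm[OF sets_cell]
      by (simp only: M_def[symmetric] Xzip)
    also have "\<dots> = mean_measure P\<^sub>0 (cell c)"
      by (rule law_of_mean[OF lawP sets_cell, symmetric])
    also have "\<dots> < \<infinity>"
      using P0(1) by (simp add: homogeneous_poisson_def point_process_def)
    finally have "AE w in M. emeasure (dirac_sum UNIV (\<lambda>n. X n w)) (cell c) \<noteq> \<infinity>"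
      by (intro nn_integral_noteq_infinite dm) simp_all
    then show "AE w in M. emeasure (dirac_sum UNIV (\<lambda>n. X n w)) (cell c) < \<infinity>"
      by eventually_elim (simp add: less_top)
  qed (rule dm)
  then obtain P where P: "law_of M (\<lambda>w. dirac_sum UNIV (\<lambda>n. X n w)) P" by blast
  have "law_of (C.\<Omega> \<Otimes>\<^sub>M \<Lambda>) (\<lambda>p. dirac_sum UNIV (\<lambda>n. X n (zip p))) P"
    using law_of_distr[OF zip] P unfolding M_def by blast
  \<comment> \<open>Pulled back along \<open>zip\<close>, both are laws of the same random
    measure.\<close>
  then have "P = P\<^sub>0"
    unfolding Xzip using lawP by (rule law_of_unique)
  with P P0(1) have "\<exists>P\<^sub>0. homogeneous_poisson \<alpha> P\<^sub>0 \<and> law_of M (\<lambda>w. dirac_sum UNIV (\<lambda>n. X n w)) P\<^sub>0"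
    by blast
  moreover have "(\<lambda>w n. X n w) \<in> measurable M ?Seq" "(\<lambda>w n. Z n w) \<in> measurable M \<Lambda>"
    using Xm Zm by (simp_all add: M_def)
  ultimately have "marked_centres \<alpha> R \<delta> \<mu> M X Z"
    unfolding marked_centres_def using pM joint unfolding \<Lambda>_def by blast
  then show ?thesis by blast
qed

section \<open>Squares and circles\<close>

text \<open>Open boxes are pairwise disjoint even when they share an edge line, so the void
  probability of a finite union is the product of the single ones.\<close>

definition square :: "real \<Rightarrow> site \<Rightarrow> plane set" where
  "square s b = box (vector [s * real (fst b), s * real (snd b)]) (vector [s * real (fst b) + s, s * real (snd b) + s])"

lemma mem_square:
  "x \<in> square s b \<longleftrightarrow> s * real (fst b) < x $ 1 \<and> x $ 1 < s * real (fst b) + s \<and>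
     s * real (snd b) < x $ 2 \<and> x $ 2 < s * real (snd b) + s"
  by (auto simp: square_def mem_box_cart forall_2 vector_2)

lemma sets_square [simp]: "square s b \<in> sets borel"
  by (simp add: square_def)

lemma bounded_square [simp]: "bounded (square s b)"
  by (simp add: square_def)

lemma measure_square:
  assumes "0 < s"
  shows "measure lborel (square s b) = s\<^sup>2"
proof -
  let ?a = "vector [s * real (fst b), s * real (snd b)] :: plane"
  let ?b = "vector [s * real (fst b) + s, s * real (snd b) + s] :: plane"
  have ne: "cbox ?a ?b \<noteq> {}"
    unfolding interval_ne_empty_cart forall_2 vector_2 using assms by simp
  have "measure lborel (square s b) = measure lborel (cbox ?a ?b)"
    unfolding square_def by (simp only: measure_lborel_box_eq measure_lborel_cbox_eq)
  also have "\<dots> = s\<^sup>2"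
    unfolding content_cbox_cart[OF ne] UNIV_2 by (simp add: vector_2 power2_eq_square)
  finally show ?thesis .
qed

lemma real_grid_unique:
  fixes i j :: nat
  assumes "s * real i < t" "t < s * real i + s" "s * real j < t" "t < s * real j + s" "0 < s"
  shows "i = j"
proof -
  have "s * real i < s * real (Suc j)" "s * real j < s * real (Suc i)"
    using assms by (simp_all add: algebra_simps)
  then have "real i < real (Suc j)" "real j < real (Suc i)"
    using assms(5) by (simp_all only: mult_less_cancel_left_pos)
  then show ?thesis by simp
qed

lemma disjoint_squares:
  assumes "0 < s"
  shows "disjoint_family (square s)"
  using real_grid_unique[OF _ _ _ _ assms]
  by (auto simp: disjoint_family_on_def mem_square prod_eq_iff)

lemma measure_squares:
  assumes "0 < s" "finite T"
  shows "measure lborel (\<Union>b\<in>T. square s b) = real (card T) * s\<^sup>2"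
proof -
  have "measure lborel (\<Union>b\<in>T. square s b) = (\<Sum>b\<in>T. measure lborel (square s b))"
    using disjoint_family_on_mono[OF _ disjoint_squares[OF assms(1)], of T] assms(2)
    by (intro measure_finite_Union) (auto simp: bounded_borel_finite[OF bounded_square])
  then show ?thesis
    using assms by (simp add: measure_square)
qed

text \<open>In the direction of adjacency the coordinates differ by less than \<open>2 * s\<close>,
  in the other by less than \<open>s\<close>; the distance is at most the sum.\<close>

lemma dist_next_squares:
  assumes "x \<in> square s b" "y \<in> square s c" "next_to b c"
  shows "dist x y < 3 * s"
proof -
  have "dist x y \<le> \<bar>x $ 1 - y $ 1\<bar> + \<bar>x $ 2 - y $ 2\<bar>"
    using norm_le_l1_cart[of "x - y"] by (simp add: dist_norm sum_2)
  also have "\<dots> < 3 * s"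
    using assms by (auto simp: next_to_def mem_square algebra_simps abs_if)
  finally show ?thesis .
qed

lemma norm_ge_square:
  assumes "x \<in> square s b"
  shows "s * real (fst b) \<le> norm x"
  using assms component_le_norm_cart[of x 1] by (auto simp: mem_square)

text \<open>The common point is the midpoint of the centres displaced orthogonally by the missing
  side of the right triangle with hypotenuse \<open>\<rho>\<close>.\<close>

lemma spheres_intersect:
  fixes x y :: plane
  assumes "dist x y \<le> 2 * \<rho>" "0 \<le> \<rho>"
  shows "sphere x \<rho> \<inter> sphere y \<rho> \<noteq> {}"
proof -
  define v where "v = (1 / 2) *\<^sub>R (y - x)"
  have nv: "norm v \<le> \<rho>"
    using assms by (simp add: v_def dist_norm norm_minus_commute)
  obtain w where w: "w \<noteq> 0" "orthogonal v w"
    using orthogonal_to_vector_exists[of v] by auto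
  define u where "u = (sqrt (\<rho>\<^sup>2 - (norm v)\<^sup>2) / norm w) *\<^sub>R w"
  have "(norm v)\<^sup>2 \<le> \<rho>\<^sup>2"
    using nv by (intro power_mono) auto
  then have nu: "(norm u)\<^sup>2 = \<rho>\<^sup>2 - (norm v)\<^sup>2"
    using w by (simp add: u_def power_divide)
  have o: "orthogonal v u" "orthogonal (- v) u"
    using w by (simp_all add: u_def orthogonal_def)
  have "(norm (v + u))\<^sup>2 = \<rho>\<^sup>2"
    unfolding norm_add_Pythagorean[OF o(1)] nu by simp
  then have n1: "norm (v + u) = \<rho>"
    using assms(2) by (rule power2_eq_imp_eq[OF _ norm_ge_zero])
  have "(norm (- v + u))\<^sup>2 = \<rho>\<^sup>2"
    unfolding norm_add_Pythagorean[OF o(2)] nu norm_minus_cancel by simp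
  then have n2: "norm (- v + u) = \<rho>"
    using assms(2) by (rule power2_eq_imp_eq[OF _ norm_ge_zero])
  have vv: "v + v = y - x"
    unfolding v_def scaleR_add_left[symmetric] by simp
  have xy: "x + (v + u) - y = - v + u"
  proof -
    have "x + (v + u) - y = v + u - (y - x)" by simp
    also have "\<dots> = - v + u" unfolding vv[symmetric] by simp
    finally show ?thesis .
  qed
  have "norm (x + (v + u) - x) = \<rho>"
    using n1 by simp
  moreover have "norm (x + (v + u) - y) = \<rho>"
    unfolding xy by (rule n2)
  ultimately have "x + (v + u) \<in> sphere x \<rho> \<inter> sphere y \<rho>"
    unfolding Int_iff mem_sphere dist_norm by (metis norm_minus_commute)
  then show ?thesis by blast
qed

section \<open>Finite nets on circles\<close>

definition circle_point :: "real \<Rightarrow> real \<Rightarrow> plane" where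
  "circle_point \<rho> t = vector [\<rho> * cos t, \<rho> * sin t]"

lemma circle_point_nth: "circle_point \<rho> t $ 1 = \<rho> * cos t" "circle_point \<rho> t $ 2 = \<rho> * sin t"
  by (simp_all add: circle_point_def vector_2)

lemma norm_plane: "norm (x :: plane) = sqrt ((x $ 1)\<^sup>2 + (x $ 2)\<^sup>2)"
  by (simp add: norm_vec_def L2_set_def sum_2)

lemma norm_circle_point: "0 \<le> \<rho> \<Longrightarrow> norm (circle_point \<rho> t) = \<rho>"
proof -
  assume "0 \<le> \<rho>"
  have "(\<rho> * cos t)\<^sup>2 + (\<rho> * sin t)\<^sup>2 = \<rho>\<^sup>2"
    by (simp add: power_mult_distrib flip: distrib_left)
  with \<open>0 \<le> \<rho>\<close> show ?thesis
    by (simp add: norm_plane circle_point_nth)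
qed

lemma cos_sin_Lipschitz:
  fixes x y :: real
  shows "\<bar>cos x - cos y\<bar> \<le> \<bar>x - y\<bar>" "\<bar>sin x - sin y\<bar> \<le> \<bar>x - y\<bar>"
proof -
  have s: "\<bar>sin ((y - x) / 2)\<bar> \<le> \<bar>x - y\<bar> / 2" "\<bar>sin ((x - y) / 2)\<bar> \<le> \<bar>x - y\<bar> / 2"
    using abs_sin_x_le_abs_x[of "(y - x) / 2"] abs_sin_x_le_abs_x[of "(x - y) / 2"] by (auto simp: abs_minus_commute)
  have "\<bar>cos x - cos y\<bar> = 2 * (\<bar>sin ((x + y) / 2)\<bar> * \<bar>sin ((y - x) / 2)\<bar>)"
    by (simp add: cos_diff_cos abs_mult)
  also have "\<dots> \<le> 2 * (1 * (\<bar>x - y\<bar> / 2))"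
    using s by (intro mult_left_mono mult_mono) auto
  finally show "\<bar>cos x - cos y\<bar> \<le> \<bar>x - y\<bar>" by simp
  have "\<bar>sin x - sin y\<bar> = 2 * (\<bar>sin ((x - y) / 2)\<bar> * \<bar>cos ((x + y) / 2)\<bar>)"
    by (simp add: sin_diff_sin abs_mult)
  also have "\<dots> \<le> 2 * ((\<bar>x - y\<bar> / 2) * 1)"
    using s by (intro mult_left_mono mult_mono) auto
  finally show "\<bar>sin x - sin y\<bar> \<le> \<bar>x - y\<bar>" by simp
qed

lemma dist_circle_points:
  assumes "0 \<le> \<rho>"
  shows "dist (circle_point \<rho> t) (circle_point \<rho> t') \<le> 2 * \<rho> * \<bar>t - t'\<bar>"
proof -
  have "dist (circle_point \<rho> t) (circle_point \<rho> t') \<le> \<bar>\<rho> * cos t - \<rho> * cos t'\<bar> + \<bar>\<rho> * sin t - \<rho> * sin t'\<bar>"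
    using norm_le_l1_cart[of "circle_point \<rho> t - circle_point \<rho> t'"]
    by (simp add: dist_norm sum_2 circle_point_nth)
  also have "\<dots> = \<rho> * (\<bar>cos t - cos t'\<bar> + \<bar>sin t - sin t'\<bar>)"
    using assms by (simp add: abs_mult distrib_left flip: right_diff_distrib)
  also have "\<dots> \<le> \<rho> * (\<bar>t - t'\<bar> + \<bar>t - t'\<bar>)"
    using assms cos_sin_Lipschitz[of t t'] by (intro mult_left_mono add_mono)
  finally show ?thesis by (simp add: algebra_simps)
qed

text \<open>Rounding the angle down to the grid costs at most \<open>2 * pi / m\<close>, below
  \<open>8 / m\<close>, and the circle parametrisation has Lipschitz constant at most
  \<open>2 * \<rho>\<close>; together this is \<open>16 * \<rho> / m\<close>.\<close>

lemma circle_net: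
  assumes "0 < \<rho>" "0 < m" and x: "norm (x :: plane) = \<rho>"
  shows "\<exists>j<m. dist x (circle_point \<rho> (2 * pi * real j / real m)) \<le> 16 * \<rho> / real m"
proof -
  have "(x $ 1 / \<rho>)\<^sup>2 + (x $ 2 / \<rho>)\<^sup>2 = 1"
    using assms by (auto simp: norm_plane power_divide simp flip: add_divide_distrib)
  then obtain t where t: "0 \<le> t" "t < 2 * pi" "x $ 1 / \<rho> = cos t" "x $ 2 / \<rho> = sin t"
    by (rule sincos_total_2pi)
  have xt: "x = circle_point \<rho> t"
    using t \<open>0 < \<rho>\<close> by (simp add: vec_eq_iff forall_2 circle_point_nth field_simps)
  define y where "y = t * real m / (2 * pi)"
  have y: "0 \<le> y" "y < real m"
    using t \<open>0 < m\<close> by (simp_all add: y_def field_simps)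
  define j where "j = nat \<lfloor>y\<rfloor>"
  have j: "real j \<le> y" "y < real j + 1"
    using y by (simp_all add: j_def)
  then have "j < m" using y by linarith
  have "t - 2 * pi * real j / real m = (2 * pi / real m) * (y - real j)"
    using \<open>0 < m\<close> by (simp add: y_def field_simps)
  then have "\<bar>t - 2 * pi * real j / real m\<bar> = (2 * pi / real m) * (y - real j)"
    using j by (simp add: abs_mult)
  also have "\<dots> \<le> (8 / real m) * 1"
    using j pi_less_4 \<open>0 < m\<close> by (intro mult_mono divide_right_mono) auto
  finally have d: "\<bar>t - 2 * pi * real j / real m\<bar> \<le> 8 / real m" by simp
  have "dist x (circle_point \<rho> (2 * pi * real j / real m)) \<le> 2 * \<rho> * \<bar>t - 2 * pi * real j / real m\<bar>"
    unfolding xt using \<open>0 < \<rho>\<close> by (intro dist_circle_points) simp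
  also have "\<dots> \<le> 2 * \<rho> * (8 / real m)"
    using d \<open>0 < \<rho>\<close> by (intro mult_left_mono) auto
  finally show ?thesis
    using \<open>j < m\<close> by (intro exI[of _ j]) simp
qed

section \<open>Full clusters\<close>

context mark
begin

text \<open>The cluster misses a given ball with probability \<open>exp (- (\<mu> * p))\<close>,
  where \<open>p\<close> is the uniform mass of the ball: this is the void probability of a thinned
  Poisson number. A union bound over the \<open>m\<close> targets gives the estimate.\<close>

lemma prob_full_mark:
  fixes c :: "nat \<Rightarrow> plane"
  assumes F: "F = {z \<in> space (mark_law R \<delta> \<mu>). \<forall>j<m. \<exists>i<fst z. snd z i \<in> ball (c j) e}"
    and u: "\<And>j. j < m \<Longrightarrow> u \<le> measure U (ball (c j) e)"
  shows "F \<in> sets (mark_law R \<delta> \<mu>)" and "1 - real m * exp (- (\<mu> * u)) \<le> measure (mark_law R \<delta> \<mu>) F"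
proof -
  interpret L: prob_space "mark_law R \<delta> \<mu>" by (rule prob_mark)
  interpret U: prob_space U by (rule prob_U)
  let ?L = "mark_law R \<delta> \<mu>"
  let ?g = "\<lambda>j. indicator (- ball (c j) e) :: plane \<Rightarrow> ennreal"
  define E where "E j = {z \<in> space ?L. \<forall>i<fst z. snd z i \<notin> ball (c j) e}" for j
  have prodE: "(\<Prod>i<fst z. ?g j (snd z i)) = indicator (E j) z" if "z \<in> space ?L" for j z
    unfolding prod_indicator[OF finite_lessThan] using that by (auto simp: E_def indicator_def)
  have gm: "(\<lambda>z. \<Prod>i<fst z. ?g j (snd z i)) \<in> borel_measurable ?L" for j
    by (rule measurable_mark_prod) simp
  have Em: "E j \<in> sets ?L" for j
  proof -
    have "E j = (\<lambda>z. \<Prod>i<fst z. ?g j (snd z i)) -` {1} \<inter> space ?L"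
      using prodE by (auto simp: E_def indicator_def split: if_splits)
    then show ?thesis
      using measurable_sets[OF gm, of "{1}" j] by simp
  qed
  have FE: "F = space ?L - (\<Union>j<m. E j)"
    unfolding F E_def by auto
  show "F \<in> sets ?L"
    unfolding FE using Em by auto
  have PE: "L.prob (E j) \<le> exp (- (\<mu> * u))" if "j < m" for j
  proof -
    have "(\<integral>\<^sup>+ x. ?g j x \<partial>U) = ennreal (1 - measure U (ball (c j) e))"
      using U.prob_compl[of "ball (c j) e"] by (simp add: U.emeasure_eq_measure Compl_eq_Diff_UNIV)
    then have "(\<integral>\<^sup>+ z. (\<Prod>i<fst z. ?g j (snd z i)) \<partial>?L) = ennreal (exp (- (\<mu> * (1 - (1 - measure U (ball (c j) e))))))"
      by (intro mark_pgf) simp_all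
    moreover have "(\<integral>\<^sup>+ z. (\<Prod>i<fst z. ?g j (snd z i)) \<partial>?L) = (\<integral>\<^sup>+ z. indicator (E j) z \<partial>?L)"
      by (rule nn_integral_cong) (rule prodE)
    ultimately have "L.prob (E j) = exp (- (\<mu> * measure U (ball (c j) e)))"
      using Em[of j] by (simp add: L.emeasure_eq_measure)
    also have "\<dots> \<le> exp (- (\<mu> * u))"
      using u[OF that] \<mu> by simp
    finally show ?thesis .
  qed
  have "L.prob (\<Union>j<m. E j) \<le> (\<Sum>j<m. L.prob (E j))"
    using Em by (intro measure_UNION_le) auto
  also have "\<dots> \<le> real m * exp (- (\<mu> * u))"
    using sum_mono[of "{..<m}" "\<lambda>j. L.prob (E j)" "\<lambda>_. exp (- (\<mu> * u))"] PE by simp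
  finally show "1 - real m * exp (- (\<mu> * u)) \<le> L.prob F"
    unfolding FE using Em by (subst L.prob_compl) auto
qed

end

text \<open>The annulus has width \<open>r\<close>, so balls of radius \<open>r / 4\<close> centred
  on its middle circle stay inside it. Once every ball of a net with spacing \<open>r / 4\<close> is
  hit, each point of the circle is within \<open>r / 2\<close> of a cluster point, hence
  covered.\<close>

lemma full_marks_exist:
  fixes r R \<mu> :: real
  assumes r: "0 < r" "r \<le> R" and "0 < \<mu>"
  shows "\<exists>F \<in> sets (mark_law R r \<mu>).
    1 - (64 * R / r + 1) * exp (- (\<mu> * (r / (32 * R)))) \<le> measure (mark_law R r \<mu>) F \<and>
    (\<forall>z\<in>F. sphere 0 (R - r / 2) \<subseteq> (\<Union>i<fst z. ball (snd z i) r))"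
proof -
  interpret mark R r \<mu> by unfold_locales (use assms in auto)
  define \<rho> where "\<rho> = R - r / 2"
  have \<rho>: "0 < \<rho>" using r by (simp add: \<rho>_def)
  \<comment> \<open>Chosen so that the net error \<open>16 * \<rho> / m\<close> is at most
    \<open>r / 4\<close>.\<close>
  define m where "m = nat \<lceil>64 * R / r\<rceil>"
  have "0 < 64 * R / r" using r by simp
  then have m: "64 * R / r \<le> real m" "real m \<le> 64 * R / r + 1"
    unfolding m_def by linarith+
  then have m0: "0 < m" using \<open>0 < 64 * R / r\<close> by (intro gr0I) simp
  define c where "c j = circle_point \<rho> (2 * pi * real j / real m)" for j
  have sub: "ball (c j) (r / 4) \<subseteq> annulus R r" for j
  proof
    fix x assume "x \<in> ball (c j) (r / 4)"
    then have "norm (x - c j) < r / 4" by (simp add: dist_norm norm_minus_commute)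
    moreover have "norm (c j) = \<rho>" using \<rho> by (simp add: c_def norm_circle_point)
    ultimately show "x \<in> annulus R r"
      using norm_triangle_ineq2[of x "c j"] norm_triangle_ineq2[of "c j" x] r
      by (simp add: annulus_def norm_minus_commute \<rho>_def)
  qed
  \<comment> \<open>A ball of radius \<open>r / 4\<close> against an annulus of area at most
    \<open>2 * R * r * disc_area\<close>: the ratio is at least \<open>r / (32 * R)\<close>.\<close>
  have u: "r / (32 * R) \<le> measure U (ball (c j) (r / 4))" for j
  proof -
    have "measure U (ball (c j) (r / 4)) = measure lborel (ball (c j) (r / 4)) / measure lborel (annulus R r)"
      using sub[of j] by (subst measure_U) (simp_all add: Int_absorb1)
    also have "\<dots> = ((r / 4)\<^sup>2 * disc_area) / (disc_area * (R\<^sup>2 - (R - r)\<^sup>2))"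
      using r measure_disc[of "r / 4" "c j"] measure_annulus[of r R] by simp
    also have "\<dots> = (r / 4)\<^sup>2 / (R\<^sup>2 - (R - r)\<^sup>2)"
      using disc_area_pos by simp
    finally have eq: "measure U (ball (c j) (r / 4)) = (r / 4)\<^sup>2 / (R\<^sup>2 - (R - r)\<^sup>2)" .
    have e: "R\<^sup>2 - (R - r)\<^sup>2 = r * (2 * R - r)"
      by (simp add: power2_eq_square algebra_simps)
    have d: "0 < R\<^sup>2 - (R - r)\<^sup>2"
      unfolding e using r by (intro mult_pos_pos) auto
    have d2: "R\<^sup>2 - (R - r)\<^sup>2 \<le> 2 * R * r"
      unfolding e using r by (simp add: algebra_simps)
    have "r / (32 * R) = (r / 4)\<^sup>2 / (2 * R * r)"
      using r by (simp add: power2_eq_square field_simps)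
    also have "\<dots> \<le> (r / 4)\<^sup>2 / (R\<^sup>2 - (R - r)\<^sup>2)"
      using d d2 r by (intro divide_left_mono mult_pos_pos) auto
    finally show ?thesis unfolding eq .
  qed
  define F where "F = {z \<in> space (mark_law R r \<mu>). \<forall>j<m. \<exists>i<fst z. snd z i \<in> ball (c j) (r / 4)}"
  have "real m * exp (- (\<mu> * (r / (32 * R)))) \<le> (64 * R / r + 1) * exp (- (\<mu> * (r / (32 * R))))"
    using m by (intro mult_right_mono) auto
  then have F: "F \<in> sets (mark_law R r \<mu>)"
    "1 - (64 * R / r + 1) * exp (- (\<mu> * (r / (32 * R)))) \<le> measure (mark_law R r \<mu>) F"
    using prob_full_mark[OF F_def u] by (blast, linarith)
  have "sphere 0 \<rho> \<subseteq> (\<Union>i<fst z. ball (snd z i) r)" if "z \<in> F" for z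
  proof
    fix x :: plane assume "x \<in> sphere 0 \<rho>"
    then obtain j where j: "j < m" "dist x (c j) \<le> 16 * \<rho> / real m"
      using circle_net[OF \<rho> m0, of x] by (auto simp: c_def)
    have "16 * \<rho> / real m \<le> 16 * R / (64 * R / r)"
      using m r \<rho> \<open>0 < 64 * R / r\<close> by (intro frac_le) (auto simp: \<rho>_def)
    also have "\<dots> = r / 4" using r by simp
    finally have "dist x (c j) \<le> r / 4" using j by linarith
    moreover have "\<exists>i<fst z. snd z i \<in> ball (c j) (r / 4)"
      using that j unfolding F_def by blast
    then obtain i where i: "i < fst z" "snd z i \<in> ball (c j) (r / 4)" by blast
    ultimately have "dist (snd z i) x < r"
      using dist_triangle[of "snd z i" x "c j"] r by (simp add: dist_commute)
    with i show "x \<in> (\<Union>i<fst z. ball (snd z i) r)" by auto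
  qed
  with F show ?thesis
    unfolding \<rho>_def by blast
qed

section \<open>Percolation of annular cluster processes\<close>

text \<open>Moves the argument from the law to the sample space, where goodness of the blocks is an
  event. The inclusion is only almost sure because a law is attached to a version of the random
  measure.\<close>

lemma percolates_of_law:
  assumes M: "prob_space M" and \<Phi>: "\<Phi> \<in> measurable M config_space" and P: "P = distr M config_space \<Phi>"
    and E: "measure M E > 0" "AE \<omega> in M. \<omega> \<in> E \<longrightarrow> (\<exists>U. U \<subseteq> coverage (\<Phi> \<omega>) r \<and> connected U \<and> \<not> bounded U)"
  shows "percolates P r"
proof -
  interpret prob_space M by fact
  let ?p = "\<lambda>N. \<exists>U. U \<subseteq> coverage N r \<and> connected U \<and> \<not> bounded U"
  have "measure P {N \<in> space P. ?p N} = measure M (\<Phi> -` {N \<in> space config_space. ?p N} \<inter> space M)"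
    unfolding P space_distr by (rule measure_distr[OF \<Phi> sets_percolation])
  moreover have "AE \<omega> in M. \<omega> \<in> E \<longrightarrow> \<omega> \<in> \<Phi> -` {N \<in> space config_space. ?p N} \<inter> space M"
    using E(2) AE_space
  proof eventually_elim
    case (elim \<omega>)
    then show ?case using measurable_space[OF \<Phi> elim(2)] by blast
  qed
  then have "measure M E \<le> measure M (\<Phi> -` {N \<in> space config_space. ?p N} \<inter> space M)"
    by (rule finite_measure_mono_AE) (rule measurable_sets[OF \<Phi> sets_percolation])
  ultimately have "measure M E \<le> measure P {N \<in> space P. ?p N}"
    by simp
  with E(1) show ?thesis
    unfolding percolates_def by simp
qed

context marked
begin

lemma prob_not_full_given_centres:
  fixes x :: "nat \<Rightarrow> plane"
  assumes F: "F \<in> sets (mark_law R \<delta> \<mu>)" and A: "finite A"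
  shows "emeasure \<Lambda> {z \<in> space \<Lambda>. \<forall>n\<in>A. z n \<notin> F} = ennreal (1 - measure (mark_law R \<delta> \<mu>) F) ^ card A"
proof -
  let ?L = "mark_law R \<delta> \<mu>"
  interpret L: prob_space ?L by (rule prob_mark)
  have ev: "{z \<in> space \<Lambda>. z n \<notin> F} \<in> sets \<Lambda>" for n
  proof -
    have "{z \<in> space \<Lambda>. z n \<notin> F} = space \<Lambda> - ((\<lambda>z. z n) -` F \<inter> space \<Lambda>)" by auto
    also have "\<dots> \<in> sets \<Lambda>" using measurable_sets[OF component_\<Lambda> F] by blast
    finally show ?thesis .
  qed
  have "emeasure \<Lambda> {z \<in> space \<Lambda>. \<forall>n\<in>A. z n \<notin> F} = (\<integral>\<^sup>+ z. indicator {z \<in> space \<Lambda>. \<forall>n\<in>A. z n \<notin> F} z \<partial>\<Lambda>)"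
    using A ev by (subst nn_integral_indicator) (auto intro!: sets.sets_Collect_finite_All)
  also have "\<dots> = (\<integral>\<^sup>+ z. (\<Prod>n\<in>A. indicator (- F) (z n)) \<partial>\<Lambda>)"
    by (rule nn_integral_cong) (simp add: prod_indicator[OF A] indicator_def A)
  also have "\<dots> = (\<Prod>n\<in>A. \<integral>\<^sup>+ z. indicator (- F) z \<partial>?L)"
  proof -
    have "(indicator (space ?L - F) :: _ \<Rightarrow> ennreal) \<in> borel_measurable ?L"
      using F by (intro borel_measurable_indicator) auto
    moreover have "(indicator (space ?L - F) :: _ \<Rightarrow> ennreal) \<in> borel_measurable ?L \<longleftrightarrow>
        (indicator (- F) :: _ \<Rightarrow> ennreal) \<in> borel_measurable ?L"
      by (rule measurable_cong) (auto simp: indicator_def)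
    ultimately have "(indicator (- F) :: _ \<Rightarrow> ennreal) \<in> borel_measurable ?L"
      by blast
    then show ?thesis
      unfolding \<Lambda>_def by (intro nn_integral_PiM_prod prob_mark A)
  qed
  also have "(\<integral>\<^sup>+ z. indicator (- F) z \<partial>?L) = ennreal (1 - L.prob F)"
  proof -
    have "(\<integral>\<^sup>+ z. indicator (- F) z \<partial>?L) = (\<integral>\<^sup>+ z. indicator (space ?L - F) z \<partial>?L)"
      by (rule nn_integral_cong) (auto simp: indicator_def)
    then show ?thesis
      using F L.prob_compl[OF F] by (simp add: L.emeasure_eq_measure)
  qed
  finally show ?thesis by simp
qed

lemma measurable_no_full:
  assumes F: "F \<in> sets (mark_law R \<delta> \<mu>)" and S: "S \<in> sets borel"
  shows "{(x, z) \<in> space (Seq \<Otimes>\<^sub>M \<Lambda>). \<forall>n. x n \<in> S \<longrightarrow> z n \<notin> F} \<in> sets (Seq \<Otimes>\<^sub>M \<Lambda>)"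
proof -
  have "{p \<in> space (Seq \<Otimes>\<^sub>M \<Lambda>). fst p n \<in> S \<longrightarrow> snd p n \<notin> F} \<in> sets (Seq \<Otimes>\<^sub>M \<Lambda>)" for n
  proof -
    have f: "(\<lambda>p. fst p n) \<in> measurable (Seq \<Otimes>\<^sub>M \<Lambda>) borel"
      by (rule measurable_compose[OF measurable_fst]) simp
    have g: "(\<lambda>p. snd p n) \<in> measurable (Seq \<Otimes>\<^sub>M \<Lambda>) (mark_law R \<delta> \<mu>)"
      by (rule measurable_compose[OF measurable_snd component_\<Lambda>])
    have "{p \<in> space (Seq \<Otimes>\<^sub>M \<Lambda>). fst p n \<in> S \<longrightarrow> snd p n \<notin> F} = space (Seq \<Otimes>\<^sub>M \<Lambda>) -
        (((\<lambda>p. fst p n) -` S \<inter> space (Seq \<Otimes>\<^sub>M \<Lambda>)) \<inter> ((\<lambda>p. snd p n) -` F \<inter> space (Seq \<Otimes>\<^sub>M \<Lambda>)))"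
      by blast
    then show ?thesis
      using sets.compl_sets[OF sets.Int[OF measurable_sets[OF f S] measurable_sets[OF g F]]] by (simp only:)
  qed
  then have "{p \<in> space (Seq \<Otimes>\<^sub>M \<Lambda>). \<forall>n. fst p n \<in> S \<longrightarrow> snd p n \<notin> F} \<in> sets (Seq \<Otimes>\<^sub>M \<Lambda>)"
    by (rule sets.sets_Collect_countable_All)
  then show ?thesis by (simp add: split_beta')
qed

text \<open>Independent thinning: centres whose mark lies in \<open>F\<close> form a Poisson process
  of intensity \<open>\<alpha>\<close> times the mass of \<open>F\<close>, and this is its void
  probability. Given the centres, the probability is a power of \<open>1 - prob F\<close> with the
  number of centres in \<open>S\<close> as exponent, so its mean is the Poisson generating function
  at that argument.\<close>

lemma prob_no_full:
  assumes F: "F \<in> sets (mark_law R \<delta> \<mu>)" and S: "S \<in> sets borel" "bounded S"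
  shows "{\<omega> \<in> space M. \<forall>n. X n \<omega> \<in> S \<longrightarrow> Z n \<omega> \<notin> F} \<in> sets M"
    and "emeasure M {\<omega> \<in> space M. \<forall>n. X n \<omega> \<in> S \<longrightarrow> Z n \<omega> \<notin> F} =
      ennreal (exp (- (measure (mark_law R \<delta> \<mu>) F * (\<alpha> * measure lborel S))))"
proof -
  let ?L = "mark_law R \<delta> \<mu>"
  interpret L: prob_space ?L by (rule prob_mark)
  interpret \<Lambda>: prob_space \<Lambda> by (rule prob_\<Lambda>)
  let ?D = "{(x, z) \<in> space (Seq \<Otimes>\<^sub>M \<Lambda>). \<forall>n. x n \<in> S \<longrightarrow> z n \<notin> F}"
  let ?A = "{\<omega> \<in> space M. \<forall>n. X n \<omega> \<in> S \<longrightarrow> Z n \<omega> \<notin> F}"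
  let ?XZ = "\<lambda>\<omega>. (\<lambda>n. X n \<omega>, \<lambda>n. Z n \<omega>)"
  have D: "?D \<in> sets (Seq \<Otimes>\<^sub>M \<Lambda>)" by (rule measurable_no_full[OF F S(1)])
  have A: "?A = ?XZ -` ?D \<inter> space M"
    using measurable_space[OF XZ_meas] by auto
  show Am: "?A \<in> sets M"
    unfolding A by (rule measurable_sets[OF XZ_meas D])
  define q where "q = 1 - L.prob F"
  have q: "0 \<le> q" by (simp add: q_def)
  have Dm: "(\<lambda>(x, z). indicator ?D (x, z) :: ennreal) \<in> borel_measurable (Seq \<Otimes>\<^sub>M \<Lambda>)"
    using D by simp
  \<comment> \<open>The conditional probability of the event given the sequence \<open>x\<close> of
    centres.\<close>
  define h where "h x = (\<integral>\<^sup>+ z. indicator ?D (x, z) \<partial>\<Lambda>)" for x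
  have hm: "h \<in> borel_measurable Seq"
    unfolding h_def using \<Lambda>.borel_measurable_nn_integral_fst[of "indicator ?D" Seq] D by simp
  have "emeasure M ?A = (\<integral>\<^sup>+ \<omega>. indicator ?A \<omega> \<partial>M)"
    using Am by simp
  also have "\<dots> = (\<integral>\<^sup>+ \<omega>. indicator ?D (?XZ \<omega>) \<partial>M)"
    using measurable_space[OF XZ_meas] by (intro nn_integral_cong) (auto simp: indicator_def)
  also have "\<dots> = (\<integral>\<^sup>+ x. h x \<partial>Q)"
    unfolding h_def by (rule nn_integral_XZ[OF Dm])
  also have "\<dots> = (\<integral>\<^sup>+ \<omega>. h (\<lambda>n. X n \<omega>) \<partial>M)"
    unfolding Q_def by (subst nn_integral_distr[OF X_meas]) (simp_all add: hm)
  finally have eq1: "emeasure M ?A = (\<integral>\<^sup>+ \<omega>. h (\<lambda>n. X n \<omega>) \<partial>M)" .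
  obtain P where P: "homogeneous_poisson \<alpha> P" "law_of M (\<lambda>\<omega>. dirac_sum UNIV (\<lambda>n. X n \<omega>)) P"
    using marked unfolding marked_centres_def by blast
  obtain \<Phi>' where \<Phi>': "\<Phi>' \<in> measurable M config_space" "AE \<omega> in M. \<Phi>' \<omega> = dirac_sum UNIV (\<lambda>n. X n \<omega>)"
    "P = distr M config_space \<Phi>'"
    using P(2) unfolding law_of_def by blast
  have "AE \<omega> in M. h (\<lambda>n. X n \<omega>) = ennreal q ^ npoints S (\<Phi>' \<omega>)"
    using \<Phi>'(2) AE_space
  proof eventually_elim
    case (elim \<omega>)
    let ?I = "{n. X n \<omega> \<in> S}"
    have "dirac_sum UNIV (\<lambda>n. X n \<omega>) \<in> counting_measures"
      using measurable_space[OF \<Phi>'(1) elim(2)] elim(1) by (simp add: space_config_space)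
    then have "emeasure (dirac_sum UNIV (\<lambda>n. X n \<omega>)) S < \<infinity>"
      by (rule counting_measures_finite[OF _ S])
    then have fin: "finite ?I"
      using S(1) by (simp add: emeasure_dirac_sum_card emeasure_count_space vimage_def split: if_splits)
    have c: "npoints S (\<Phi>' \<omega>) = card ?I"
      unfolding elim(1) using fin S(1) by (intro count_eqI) (simp add: emeasure_dirac_sum_card vimage_def)
    have xs: "(\<lambda>n. X n \<omega>) \<in> space Seq"
      using measurable_space[OF X_meas elim(2)] .
    have "h (\<lambda>n. X n \<omega>) = (\<integral>\<^sup>+ z. indicator {z \<in> space \<Lambda>. \<forall>n\<in>?I. z n \<notin> F} z \<partial>\<Lambda>)"
      unfolding h_def using xs by (intro nn_integral_cong) (auto simp: indicator_def space_pair_measure)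
    also have "\<dots> = emeasure \<Lambda> {z \<in> space \<Lambda>. \<forall>n\<in>?I. z n \<notin> F}"
    proof (rule nn_integral_indicator)
      have "(\<lambda>z. z n) -` F \<inter> space \<Lambda> \<in> sets \<Lambda>" for n
        by (rule measurable_sets[OF component_\<Lambda> F])
      then have "space \<Lambda> - ((\<lambda>z. z n) -` F \<inter> space \<Lambda>) \<in> sets \<Lambda>" for n
        by blast
      moreover have "space \<Lambda> - ((\<lambda>z. z n) -` F \<inter> space \<Lambda>) = {z \<in> space \<Lambda>. z n \<notin> F}" for n
        by blast
      ultimately show "{z \<in> space \<Lambda>. \<forall>n\<in>?I. z n \<notin> F} \<in> sets \<Lambda>"
        by (intro sets.sets_Collect_finite_All fin) simp
    qed
    finally show "h (\<lambda>n. X n \<omega>) = ennreal q ^ npoints S (\<Phi>' \<omega>)"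
      unfolding c q_def by (simp only: prob_not_full_given_centres[OF F fin])
  qed
  then have "(\<integral>\<^sup>+ \<omega>. h (\<lambda>n. X n \<omega>) \<partial>M) = (\<integral>\<^sup>+ \<omega>. ennreal q ^ npoints S (\<Phi>' \<omega>) \<partial>M)"
    by (rule nn_integral_cong_AE)
  also have "\<dots> = (\<integral>\<^sup>+ N. ennreal q ^ npoints S N \<partial>P)"
  proof -
    have "(\<lambda>N. ennreal q ^ npoints S N) \<in> borel_measurable config_space"
      by (rule measurable_compose[OF measurable_count[OF S(1)]]) simp
    then show ?thesis
      unfolding \<Phi>'(3) by (subst nn_integral_distr[OF \<Phi>'(1)]) simp_all
  qed
  also have "\<dots> = ennreal (exp (- (\<alpha> * measure lborel S * (1 - q))))"
    by (rule poisson_count_pgf[OF P(1) S \<alpha> q])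
  finally show "emeasure M ?A = ennreal (exp (- (L.prob F * (\<alpha> * measure lborel S))))"
    unfolding eq1 by (simp add: q_def mult.commute)
qed

text \<open>The condition \<open>3 * s \<le> 2 * \<rho>\<close> makes the circles around centres of
  adjacent squares meet, wherever the centres lie in their squares; \<open>small\<close> is the
  threshold of the block recursion for a single square.\<close>

lemma cluster_percolates:
  assumes F: "F \<in> sets (mark_law R \<delta> \<mu>)" and r: "0 < r" and \<rho>: "0 \<le> \<rho>"
    and full: "\<And>z. z \<in> F \<Longrightarrow> sphere 0 \<rho> \<subseteq> (\<Union>i<fst z. ball (snd z i) r)"
    and s: "0 < s" "3 * s \<le> 2 * \<rho>"
    and small: "exp (- (measure (mark_law R \<delta> \<mu>) F * (\<alpha> * s\<^sup>2))) \<le> 1 / 144"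
    and P: "law_of M (cluster_points X Z) P"
  shows "percolates P r"
proof -
  interpret prob_space M by (rule prob_M)
  define G where "G \<omega> b \<longleftrightarrow> (\<exists>n. X n \<omega> \<in> square s b \<and> Z n \<omega> \<in> F)" for \<omega> b
  let ?p = "measure (mark_law R \<delta> \<mu>) F"
  let ?q = "exp (- (?p * (\<alpha> * s\<^sup>2)))"
  have notG: "{\<omega> \<in> space M. \<forall>b\<in>T. \<not> G \<omega> b} = {\<omega> \<in> space M. \<forall>n. X n \<omega> \<in> (\<Union>b\<in>T. square s b) \<longrightarrow> Z n \<omega> \<notin> F}" for T
    by (auto simp: G_def)
  have bS: "(\<Union>b\<in>T. square s b) \<in> sets borel" "bounded (\<Union>b\<in>T. square s b)" if "finite T" for T
    using that by auto
  have ev: "{\<omega> \<in> space M. G \<omega> b} \<in> events" for b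
  proof -
    have "{\<omega> \<in> space M. G \<omega> b} = space M - {\<omega> \<in> space M. \<forall>b\<in>{b}. \<not> G \<omega> b}" by auto
    also have "\<dots> \<in> events"
      unfolding notG using prob_no_full(1)[OF F bS[of "{b}"]] by blast
    finally show ?thesis .
  qed
  have "prob {\<omega> \<in> space M. \<forall>n. good_block (G \<omega>) n (0, 0)} > 0"
  proof (rule prob_all_blocks_good[OF ev _ small])
    fix T :: "site set" assume T: "finite T"
    \<comment> \<open>The void probability depends only on the total area, which is additive over
      squares; so badness of all sites of \<open>T\<close> has exactly the probability
      \<open>?q ^ card T\<close>.\<close>
    have "emeasure M {\<omega> \<in> space M. \<forall>b\<in>T. \<not> G \<omega> b} = ennreal (exp (- (?p * (\<alpha> * (real (card T) * s\<^sup>2)))))"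
      unfolding notG prob_no_full(2)[OF F bS[OF T]] measure_squares[OF s(1) T] ..
    also have "exp (- (?p * (\<alpha> * (real (card T) * s\<^sup>2)))) = ?q ^ card T"
      by (simp add: exp_of_nat_mult[symmetric] algebra_simps)
    finally show "prob {\<omega> \<in> space M. \<forall>b\<in>T. \<not> G \<omega> b} \<le> ?q ^ card T"
      by (simp add: emeasure_eq_measure)
  qed simp
  moreover obtain \<Phi>' where \<Phi>': "\<Phi>' \<in> measurable M config_space" "AE \<omega> in M. \<Phi>' \<omega> = cluster_points X Z \<omega>"
    "P = distr M config_space \<Phi>'"
    using P unfolding law_of_def by blast
  moreover have "AE \<omega> in M. \<omega> \<in> {\<omega> \<in> space M. \<forall>n. good_block (G \<omega>) n (0, 0)} \<longrightarrow>
      (\<exists>U. U \<subseteq> coverage (\<Phi>' \<omega>) r \<and> connected U \<and> \<not> bounded U)"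
    using \<Phi>'(2)
  proof eventually_elim
    case (elim \<omega>)
    show ?case
    proof
      assume "\<omega> \<in> {\<omega> \<in> space M. \<forall>n. good_block (G \<omega>) n (0, 0)}"
      then have good: "good_block (G \<omega>) n (0, 0)" for n by blast
      define c where "c b = (SOME n. X n \<omega> \<in> square s b \<and> Z n \<omega> \<in> F)" for b
      have c: "X (c b) \<omega> \<in> square s b" "Z (c b) \<omega> \<in> F" if "G \<omega> b" for b
        using someI_ex[of "\<lambda>n. X n \<omega> \<in> square s b \<and> Z n \<omega> \<in> F"] that unfolding G_def c_def by blast+
      show "\<exists>U. U \<subseteq> coverage (\<Phi>' \<omega>) r \<and> connected U \<and> \<not> bounded U"
      proof (rule good_blocks_unbounded[OF _ _ _ s(1) good, where C = "\<lambda>b. sphere (X (c b) \<omega>) \<rho>" and D = \<rho>])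
        fix b assume b: "G \<omega> b"
        have "sphere (X (c b) \<omega>) \<rho> \<subseteq> coverage (\<Phi>' \<omega>) r"
        proof
          fix y assume "y \<in> sphere (X (c b) \<omega>) \<rho>"
          then have "y - X (c b) \<omega> \<in> sphere 0 \<rho>" by (simp add: dist_norm norm_minus_commute)
          then obtain i where i: "i < fst (Z (c b) \<omega>)" "y - X (c b) \<omega> \<in> ball (snd (Z (c b) \<omega>) i) r"
            using full[OF c(2)[OF b]] by blast
          have "emeasure (\<Phi>' \<omega>) {X (c b) \<omega> + snd (Z (c b) \<omega>) i} > 0"
            unfolding elim cluster_points_def dirac_sum_atom using i(1)
            by (intro image_eqI[of _ _ "(c b, i)"]) simp_all
          moreover have "y \<in> ball (X (c b) \<omega> + snd (Z (c b) \<omega>) i) r"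
            using i(2) by (simp add: dist_norm algebra_simps)
          ultimately show "y \<in> coverage (\<Phi>' \<omega>) r"
            unfolding coverage_def by blast
        qed
        moreover have "connected (sphere (X (c b) \<omega>) \<rho>)"
          by (rule connected_sphere) simp
        moreover have "sphere (X (c b) \<omega>) \<rho> \<noteq> {}"
          using \<rho> by simp
        ultimately show "connected (sphere (X (c b) \<omega>) \<rho>) \<and> sphere (X (c b) \<omega>) \<rho> \<noteq> {} \<and>
            sphere (X (c b) \<omega>) \<rho> \<subseteq> coverage (\<Phi>' \<omega>) r"
          by blast
      next
        fix b b' assume "G \<omega> b" "G \<omega> b'" "next_to b b'"
        then have "dist (X (c b) \<omega>) (X (c b') \<omega>) < 3 * s"
          using c by (intro dist_next_squares) auto
        with s show "sphere (X (c b) \<omega>) \<rho> \<inter> sphere (X (c b') \<omega>) \<rho> \<noteq> {}"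
          by (intro spheres_intersect \<rho>) simp
      next
        fix b x assume b: "G \<omega> b" and x: "x \<in> sphere (X (c b) \<omega>) \<rho>"
        have "s * real (fst b) \<le> norm (X (c b) \<omega>)"
          by (rule norm_ge_square[OF c(1)[OF b]])
        moreover have "norm (X (c b) \<omega>) \<le> norm x + \<rho>"
          using x norm_triangle_ineq2[of "X (c b) \<omega>" x] by (simp add: dist_norm)
        ultimately show "s * real (fst b) - \<rho> \<le> norm x" by simp
      qed
    qed
  qed
  ultimately show ?thesis
    by (intro percolates_of_law[OF prob_M, of \<Phi>' P _ r])
qed

end

section \<open>Uniqueness of the npoints vectors of a Poisson process\<close>

text \<open>The sets \<open>B i\<close> may overlap; their counts are sums of the independent counts of the disjoint atoms of
  the algebra they generate.\<close>

definition atom :: "nat \<Rightarrow> (nat \<Rightarrow> plane set) \<Rightarrow> nat set \<Rightarrow> plane set" where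
  "atom k B I = {x. (\<forall>i<k. x \<in> B i \<longleftrightarrow> i \<in> I)} \<inter> (\<Union>i<k. B i)"

lemma sets_atom:
  assumes B: "\<And>i. i < k \<Longrightarrow> B i \<in> sets borel"
  shows "atom k B I \<in> sets borel"
proof -
  have "{x \<in> space borel. \<forall>i\<in>{..<k}. x \<in> B i \<longleftrightarrow> i \<in> I} \<in> sets borel"
  proof (rule sets.sets_Collect_finite_All)
    fix i assume "i \<in> {..<k}"
    then have "B i \<in> sets borel" using B by simp
    moreover have "{x \<in> space borel. x \<in> B i \<longleftrightarrow> i \<in> I} = (if i \<in> I then B i else space borel - B i)"
      by auto
    ultimately show "{x \<in> space borel. x \<in> B i \<longleftrightarrow> i \<in> I} \<in> sets borel"
      by (simp only: if_split sets.compl_sets) simp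
  qed simp
  moreover have "atom k B I = {x \<in> space borel. \<forall>i\<in>{..<k}. x \<in> B i \<longleftrightarrow> i \<in> I} \<inter> (\<Union>i<k. B i)"
    by (auto simp: atom_def)
  ultimately show ?thesis using B by auto
qed

text \<open>Intersecting with the union of the \<open>B i\<close> makes the atom of the empty index
  set empty; otherwise it would be the unbounded complement.\<close>

lemma bounded_atom:
  assumes "\<And>i. i < k \<Longrightarrow> bounded (B i)"
  shows "bounded (atom k B I)"
  by (rule bounded_subset[of "\<Union>i<k. B i"]) (use assms in \<open>auto simp: atom_def\<close>)

lemma disjoint_atoms:
  assumes e: "bij_betw e J (Pow {..<k})"
  shows "disjoint_family_on (\<lambda>j. atom k B (e j)) J"
  unfolding disjoint_family_on_def
proof (intro ballI impI equals0I)
  fix j j' x assume j: "j \<in> J" "j' \<in> J" "j \<noteq> j'" and x: "x \<in> atom k B (e j) \<inter> atom k B (e j')"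
  have "e j \<subseteq> {..<k}" "e j' \<subseteq> {..<k}" using e j by (auto simp: bij_betw_def)
  then have "e j = e j'" using x by (auto simp: atom_def)
  with e j show False by (auto simp: bij_betw_def dest: inj_onD)
qed

lemma count_atoms:
  assumes N: "N \<in> counting_measures" and B: "\<And>i. i < k \<Longrightarrow> B i \<in> sets borel \<and> bounded (B i)"
    and e: "bij_betw e {..<n::nat} (Pow {..<k})" and i: "i < k"
  shows "measure N (B i) = (\<Sum>j\<in>{j\<in>{..<n}. i \<in> e j}. real (npoints (atom k B (e j)) N))"
proof -
  have Am: "atom k B I \<in> sets borel" for I
    using sets_atom[of k B] B by blast
  have Ab: "bounded (atom k B I)" for I
    using bounded_atom[of k B] B by blast
  have "B i = (\<Union>j\<in>{j\<in>{..<n}. i \<in> e j}. atom k B (e j))"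
  proof (intro equalityI subsetI)
    fix x assume x: "x \<in> B i"
    let ?I = "{i'. i' < k \<and> x \<in> B i'}"
    have "?I \<in> e ` {..<n}" using e by (auto simp: bij_betw_def)
    then obtain j where j: "j < n" "e j = ?I" by auto
    then have "x \<in> atom k B (e j)" using x i by (auto simp: atom_def)
    with j x i show "x \<in> (\<Union>j\<in>{j\<in>{..<n}. i \<in> e j}. atom k B (e j))" by auto
  qed (use i in \<open>auto simp: atom_def\<close>)
  moreover have "measure N (\<Union>j\<in>{j\<in>{..<n}. i \<in> e j}. atom k B (e j)) =
      (\<Sum>j\<in>{j\<in>{..<n}. i \<in> e j}. measure N (atom k B (e j)))"
  proof (rule measure_finite_Union)
    show "disjoint_family_on (\<lambda>j. atom k B (e j)) {j \<in> {..<n}. i \<in> e j}"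
      by (rule disjoint_family_on_mono[OF _ disjoint_atoms[OF e]]) auto
    show "finite {j \<in> {..<n}. i \<in> e j}" by (rule finite_subset[of _ "{..<n}"]) auto
    show "emeasure N (atom k B (e j)) \<noteq> \<infinity>" for j
      using counting_measures_finite[OF N Am Ab] by (simp add: less_top)
  qed (use Am counting_measuresD(1)[OF N] in auto)
  ultimately show ?thesis
    using measure_count[OF N Am Ab] by simp
qed

lemma distr_count_cong:
  assumes P: "homogeneous_poisson a P" and P': "homogeneous_poisson a P'"
    and B: "B \<in> sets borel" "bounded B"
  shows "distr P (count_space UNIV) (npoints B) = distr P' (count_space UNIV) (npoints B)"
proof (rule measure_eqI_countable[of _ UNIV])
  have *: "emeasure (distr P (count_space UNIV) (npoints B)) {n} = ennreal (pois (a * measure lborel B) n)"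
    if P: "homogeneous_poisson a P" for P and n
  proof -
    have m: "npoints B \<in> measurable P (count_space UNIV)"
      using measurable_count[OF B(1)] measurable_cong_sets[OF homogeneous_poissonD(3)[OF P] refl] by blast
    have "emeasure (distr P (count_space UNIV) (npoints B)) {n} = emeasure P (npoints B -` {n} \<inter> space P)"
      by (rule emeasure_distr[OF m]) simp
    also have "npoints B -` {n} \<inter> space P = {N \<in> space P. npoints B N = n}" by auto
    finally show ?thesis using homogeneous_poisson_count[OF P B] by simp
  qed
  show "emeasure (distr P (count_space UNIV) (npoints B)) {n} = emeasure (distr P' (count_space UNIV) (npoints B)) {n}" for n
    using *[OF P] *[OF P'] by simp
qed simp_all

lemma distr_count_vector:
  assumes P: "homogeneous_poisson a P" and A: "\<And>j. j < n \<Longrightarrow> A j \<in> sets borel \<and> bounded (A j)"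
    and disj: "disjoint_family_on A {..<n}" and n: "0 < (n::nat)"
  shows "distr P (PiM {..<n} (\<lambda>_. count_space UNIV)) (\<lambda>N. \<lambda>j\<in>{..<n}. npoints (A j) N) =
    PiM {..<n} (\<lambda>j. distr P (count_space UNIV) (npoints (A j)))"
proof -
  interpret prob_space P by (rule homogeneous_poissonD(2)[OF P])
  have "indep_vars (\<lambda>_. borel) (\<lambda>j N. emeasure N (A j)) {..<n}"
    using P A disj unfolding homogeneous_poisson_def by blast
  then have "indep_vars (\<lambda>_. count_space UNIV) (\<lambda>j N. nat \<lfloor>enn2real (emeasure N (A j))\<rfloor>) {..<n}"
  proof (rule indep_vars_compose2)
    have "(\<lambda>x. \<lfloor>enn2real x\<rfloor>) \<in> measurable borel (count_space UNIV)"
      by (rule measurable_compose[OF _ measurable_real_floor]) measurable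
    then show "(\<lambda>x. nat \<lfloor>enn2real x\<rfloor>) \<in> measurable borel (count_space UNIV)"
      by (rule measurable_compose) simp
  qed
  then have ind: "indep_vars (\<lambda>_. count_space UNIV) (\<lambda>j. npoints (A j)) {..<n}"
    by (simp only: npoints_def[abs_def] measure_def)
  have m: "npoints (A j) \<in> measurable P (count_space UNIV)" if "j \<in> {..<n}" for j
    using measurable_count[of "A j"] A[of j] that measurable_cong_sets[OF homogeneous_poissonD(3)[OF P] refl] by blast
  show ?thesis
    using ind n by (subst (asm) indep_vars_iff_distr_eq_PiM') (use m in auto)
qed

text \<open>The mixture is built from one fixed Poisson process, while the comparison is claimed for
  all of them. Counts of overlapping sets are a fixed function of the independent counts of the
  atoms, so their law depends on \<open>a\<close> alone.\<close>

lemma counts_law_unique: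
  assumes P: "homogeneous_poisson a P" and P': "homogeneous_poisson a P'"
    and B: "\<And>i. i < k \<Longrightarrow> B i \<in> sets borel \<and> bounded (B i)"
    and int: "integrable P (\<lambda>N. f (counts k B N) :: real)"
  shows "integrable P' (\<lambda>N. f (counts k B N))"
    and "(\<integral>N. f (counts k B N) \<partial>P) = (\<integral>N. f (counts k B N) \<partial>P')"
proof -
  define n where "n = card (Pow {..<k})"
  obtain e where e: "bij_betw e {..<n} (Pow {..<k})"
    unfolding n_def using ex_bij_betw_nat_finite[of "Pow {..<k}"] by (auto simp: atLeast0LessThan)
  \<comment> \<open>The empty set is always in the power set, so the index set of atoms is nonempty
    even for \<open>k = 0\<close>; the product description of independence requires this.\<close>
  have n: "0 < n" by (simp add: n_def card_Pow)
  define A where "A j = atom k B (e j)" for j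
  have A: "A j \<in> sets borel \<and> bounded (A j)" for j
    unfolding A_def using sets_atom[of k B] bounded_atom[of k B] B by blast
  have disj: "disjoint_family_on A {..<n}"
    unfolding A_def by (rule disjoint_atoms[OF e])
  let ?T = "PiM {..<n} (\<lambda>_. count_space (UNIV :: nat set))"
  define T where "T N = (\<lambda>j\<in>{..<n}. npoints (A j) N)" for N
  define \<phi> where "\<phi> v = f (\<lambda>i\<in>{..<k}. \<Sum>j\<in>{j\<in>{..<n}. i \<in> e j}. real (v j))" for v :: "nat \<Rightarrow> nat"
  \<comment> \<open>Vectors of natural numbers form a discrete space, on which any function is
    measurable.\<close>
  have \<phi>: "\<phi> \<in> borel_measurable ?T"
    by (subst count_space_PiM_finite) auto
  have T: "T \<in> measurable Q ?T" if "homogeneous_poisson a Q" for Q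
  proof -
    have "T \<in> measurable config_space ?T"
      unfolding T_def[abs_def] using A by (intro measurable_restrict measurable_count) blast
    then show ?thesis
      using measurable_cong_sets[OF homogeneous_poissonD(3)[OF that] refl] by blast
  qed
  have law: "distr P ?T T = distr P' ?T T"
  proof -
    have "distr P ?T T = PiM {..<n} (\<lambda>j. distr P (count_space UNIV) (npoints (A j)))"
      unfolding T_def[abs_def] using A by (intro distr_count_vector[OF P _ disj n]) blast
    also have "\<dots> = PiM {..<n} (\<lambda>j. distr P' (count_space UNIV) (npoints (A j)))"
      using A by (intro PiM_cong refl distr_count_cong[OF P P']) blast+
    also have "\<dots> = distr P' ?T T"
      unfolding T_def[abs_def] using A by (intro distr_count_vector[OF P' _ disj n, symmetric]) blast
    finally show ?thesis .
  qed
  have eq: "f (counts k B N) = \<phi> (T N)" if "N \<in> space Q" "homogeneous_poisson a Q" for N Q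
  proof -
    have N: "N \<in> counting_measures" using that homogeneous_poissonD(4) by blast
    have "counts k B N = (\<lambda>i\<in>{..<k}. \<Sum>j\<in>{j\<in>{..<n}. i \<in> e j}. real (T N j))"
      unfolding counts_def
    proof (rule restrict_ext)
      fix i assume "i \<in> {..<k}"
      then have "measure N (B i) = (\<Sum>j\<in>{j\<in>{..<n}. i \<in> e j}. real (npoints (atom k B (e j)) N))"
        using count_atoms[OF N B e] by simp
      also have "\<dots> = (\<Sum>j\<in>{j\<in>{..<n}. i \<in> e j}. real (T N j))"
        by (intro sum.cong refl) (simp add: T_def A_def)
      finally show "measure N (B i) = (\<Sum>j\<in>{j\<in>{..<n}. i \<in> e j}. real (T N j))" .
    qed
    then show ?thesis by (simp only: \<phi>_def)
  qed
  have iP: "integrable Q (\<lambda>N. f (counts k B N)) \<longleftrightarrow> integrable (distr Q ?T T) \<phi>" if Q: "homogeneous_poisson a Q" for Q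
  proof -
    have "integrable Q (\<lambda>N. f (counts k B N)) \<longleftrightarrow> integrable Q (\<lambda>N. \<phi> (T N))"
      by (rule Bochner_Integration.integrable_cong[OF refl]) (rule eq[OF _ Q])
    also have "\<dots> \<longleftrightarrow> integrable (distr Q ?T T) \<phi>"
      by (rule integrable_distr_eq[OF T[OF Q] \<phi>, symmetric])
    finally show ?thesis .
  qed
  have vP: "(\<integral>N. f (counts k B N) \<partial>Q) = (\<integral>v. \<phi> v \<partial>distr Q ?T T)" if Q: "homogeneous_poisson a Q" for Q
  proof -
    have "(\<integral>N. f (counts k B N) \<partial>Q) = (\<integral>N. \<phi> (T N) \<partial>Q)"
      by (rule Bochner_Integration.integral_cong[OF refl]) (rule eq[OF _ Q])
    also have "\<dots> = (\<integral>v. \<phi> v \<partial>distr Q ?T T)"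
      by (rule integral_distr[OF T[OF Q] \<phi>, symmetric])
    finally show ?thesis .
  qed
  show "integrable P' (\<lambda>N. f (counts k B N))"
    using int unfolding iP[OF P] iP[OF P'] law .
  show "(\<integral>N. f (counts k B N) \<partial>P) = (\<integral>N. f (counts k B N) \<partial>P')"
    unfolding vP[OF P] vP[OF P'] law ..
qed

section \<open>Superposition of independent copies\<close>

definition superpos :: "nat \<Rightarrow> (nat \<Rightarrow> plane measure) \<Rightarrow> plane measure" where
  "superpos m N = measure_of UNIV (sets borel) (\<lambda>B. \<Sum>j<m. emeasure (N j) B)"

lemma sets_superpos [simp]: "sets (superpos m N) = sets borel"
  unfolding superpos_def by (metis sets.sigma_sets_eq sets_measure_of_conv space_borel subset_Pow_Union
      Pow_UNIV top_greatest)

lemma emeasure_superpos: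
  assumes N: "\<And>j. sets (N j) = sets borel" and B: "B \<in> sets borel"
  shows "emeasure (superpos m N) B = (\<Sum>j<m. emeasure (N j) B)"
  unfolding superpos_def
proof (rule emeasure_measure_of_sigma)
  show "sigma_algebra UNIV (sets (borel :: plane measure))"
    using sets.sigma_algebra_axioms[of "borel :: plane measure"] by simp
  show "positive (sets borel) (\<lambda>B. \<Sum>j<m. emeasure (N j) B)"
    by (simp add: positive_def)
  show "countably_additive (sets borel) (\<lambda>B. \<Sum>j<m. emeasure (N j) B)"
    unfolding countably_additive_def
  proof (intro allI impI)
    fix A :: "nat \<Rightarrow> plane set" assume A: "range A \<subseteq> sets borel" "disjoint_family A"
    have "(\<Sum>i. \<Sum>j<m. emeasure (N j) (A i)) = (\<Sum>j<m. \<Sum>i. emeasure (N j) (A i))"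
      by (rule suminf_sum) simp
    also have "\<dots> = (\<Sum>j<m. emeasure (N j) (\<Union>i. A i))"
      using A N by (intro sum.cong refl suminf_emeasure) auto
    finally show "(\<Sum>i. \<Sum>j<m. emeasure (N j) (A i)) = (\<Sum>j<m. emeasure (N j) (\<Union>i. A i))" .
  qed
qed (rule B)

lemma superpos_counting:
  assumes N: "\<And>j. N j \<in> counting_measures"
  shows "superpos m N \<in> counting_measures"
  unfolding counting_measures_def
proof (intro CollectI conjI ballI impI)
  fix B :: "plane set" assume B: "B \<in> sets borel" "bounded B"
  have "emeasure (superpos m N) B = (\<Sum>j<m. of_nat (npoints B (N j)))"
    using emeasure_superpos[OF counting_measuresD(1)[OF N] B(1)] emeasure_count[OF N B] by simp
  then show "\<exists>n::nat. emeasure (superpos m N) B = of_nat n"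
    by (intro exI[of _ "\<Sum>j<m. npoints B (N j)"]) simp
qed simp

lemma measure_superpos:
  assumes N: "\<And>j. N j \<in> counting_measures" and B: "B \<in> sets borel" "bounded B"
  shows "measure (superpos m N) B = (\<Sum>j<m. measure (N j) B)"
proof -
  have "emeasure (superpos m N) B = of_nat (\<Sum>j<m. npoints B (N j))"
    using emeasure_superpos[OF counting_measuresD(1)[OF N] B(1)] emeasure_count[OF N B] by simp
  then show ?thesis
    by (simp add: measure_count[OF N B] measure_def[of "superpos m N"] ennreal_of_nat_eq_real_of_nat flip: of_nat_sum)
qed

lemma counts_superpos:
  assumes N: "\<And>j. N j \<in> counting_measures" and B: "\<And>i. i < k \<Longrightarrow> B i \<in> sets borel \<and> bounded (B i)"
  shows "i < k \<Longrightarrow> counts k B (superpos m N) i = (\<Sum>j<m. measure (N j) (B i))"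
  using measure_superpos[OF N] B by (simp add: counts_def)

locale mixture =
  fixes a :: real and P\<^sub>0 :: "plane measure measure"
  assumes a: "0 < a" and P0: "homogeneous_poisson a P\<^sub>0"
begin

abbreviation "K \<equiv> measure_pmf (poisson_pmf 1)"

definition Copies :: "(nat \<Rightarrow> plane measure) measure" where
  "Copies = (\<Pi>\<^sub>M j\<in>UNIV. P\<^sub>0)"

text \<open>A mixed Poisson process: conditionally on \<open>m\<close> it is a superposition of
  \<open>m\<close> independent copies. The mixing variable has mean 1, which preserves the
  intensity, and charges every natural number, which provides arbitrarily dense
  configurations.\<close>

definition Mix :: "plane measure measure" where
  "Mix = distr (K \<Otimes>\<^sub>M Copies) config_space (\<lambda>(m, N). superpos m N)"

lemma prob_P0: "prob_space P\<^sub>0" and sets_P0: "sets P\<^sub>0 = sets config_space" and space_P0: "space P\<^sub>0 = counting_measures"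
  using homogeneous_poissonD[OF P0] by auto

lemma prob_Copies: "prob_space Copies"
  unfolding Copies_def by (intro prob_space_PiM prob_P0)

lemma pair_prob: "pair_prob_space K Copies"
  by (intro pair_prob_space.intro pair_sigma_finite.intro prob_space_imp_sigma_finite prob_Copies
      measure_pmf.prob_space_axioms)

lemma component: "(\<lambda>N. N j) \<in> measurable Copies P\<^sub>0"
  unfolding Copies_def by (rule measurable_component_singleton) simp

lemma component_counting: "N \<in> space Copies \<Longrightarrow> N j \<in> counting_measures"
  using measurable_space[OF component] space_P0 by simp

lemma component_config: "(\<lambda>N. N j) \<in> measurable Copies config_space"
  using component measurable_cong_sets[OF refl sets_P0] by blast

lemma measurable_emeasure_component:
  "B \<in> sets borel \<Longrightarrow> (\<lambda>N. emeasure (N j) B) \<in> borel_measurable Copies"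
  by (rule measurable_compose[OF component_config measurable_emeasure_config])

lemma measurable_superpos: "superpos m \<in> measurable Copies config_space"
proof (rule measurable_into_config)
  show "superpos m N \<in> counting_measures" if "N \<in> space Copies" for N
    using component_counting[OF that] by (rule superpos_counting)
  fix B :: "plane set" assume B: "B \<in> sets borel"
  have "(\<lambda>N. emeasure (superpos m N) B) \<in> borel_measurable Copies \<longleftrightarrow>
      (\<lambda>N. \<Sum>j<m. emeasure (N j) B) \<in> borel_measurable Copies"
    using component_counting by (intro measurable_cong emeasure_superpos B counting_measuresD(1))
  moreover have "(\<lambda>N. \<Sum>j<m. emeasure (N j) B) \<in> borel_measurable Copies"
    by (intro borel_measurable_sum measurable_emeasure_component B)
  ultimately show "(\<lambda>N. emeasure (superpos m N) B) \<in> borel_measurable Copies" by blast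
qed

lemma measurable_mix: "(\<lambda>(m, N). superpos m N) \<in> measurable (K \<Otimes>\<^sub>M Copies) config_space"
proof -
  have "(\<lambda>p. superpos (fst p) (snd p)) \<in> measurable (K \<Otimes>\<^sub>M Copies) config_space"
  proof (rule measurable_compose_countable[where f = "\<lambda>m p. superpos m (snd p)" and g = fst])
    show "(\<lambda>p. superpos m (snd p)) \<in> measurable (K \<Otimes>\<^sub>M Copies) config_space" for m
      by (rule measurable_compose[OF measurable_snd measurable_superpos])
    have "fst \<in> measurable (K \<Otimes>\<^sub>M Copies) K" by (rule measurable_fst)
    then show "fst \<in> measurable (K \<Otimes>\<^sub>M Copies) (count_space UNIV)" by simp
  qed
  then show ?thesis by (simp add: split_beta')
qed

lemma Mix_prob: "prob_space Mix" "sets Mix = sets config_space"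
proof -
  interpret pair_prob_space K Copies by (rule pair_prob)
  show "prob_space Mix" unfolding Mix_def by (rule prob_space_distr[OF measurable_mix])
  show "sets Mix = sets config_space" by (simp add: Mix_def)
qed

lemma Mix_mean:
  assumes B: "B \<in> sets borel"
  shows "mean_measure Mix B = ennreal a * emeasure lborel B"
proof -
  interpret pair_prob_space K Copies by (rule pair_prob)
  have m: "(\<lambda>(m, N). emeasure (superpos m N) B) \<in> borel_measurable (K \<Otimes>\<^sub>M Copies)"
    using measurable_compose[OF measurable_mix measurable_emeasure_config[OF B]] by (simp add: split_beta')
  have mean1: "(\<integral>\<^sup>+ N. emeasure (N j) B \<partial>Copies) = ennreal a * emeasure lborel B" for j
  proof -
    have "(\<integral>\<^sup>+ N. emeasure (N j) B \<partial>Copies) = (\<integral>\<^sup>+ N. emeasure N B \<partial>distr Copies P\<^sub>0 (\<lambda>N. N j))"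
      using measurable_emeasure_config[OF B] measurable_cong_sets[OF sets_P0 refl]
      by (subst nn_integral_distr[OF component]) auto
    also have "distr Copies P\<^sub>0 (\<lambda>N. N j) = P\<^sub>0"
      unfolding Copies_def using prob_P0 by (intro distr_PiM_component) auto
    also have "(\<integral>\<^sup>+ N. emeasure N B \<partial>P\<^sub>0) = ennreal a * emeasure lborel B"
      using homogeneous_poisson_intensity[OF P0 a] B by (simp add: has_intensity_def mean_measure_def)
    finally show ?thesis .
  qed
  have "mean_measure Mix B = (\<integral>\<^sup>+ p. (case p of (m, N) \<Rightarrow> emeasure (superpos m N) B) \<partial>(K \<Otimes>\<^sub>M Copies))"
    unfolding mean_measure_def Mix_def
    by (subst nn_integral_distr[OF measurable_mix]) (simp_all add: measurable_emeasure_config B split_beta')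
  also have "\<dots> = (\<integral>\<^sup>+ m. \<integral>\<^sup>+ N. emeasure (superpos m N) B \<partial>Copies \<partial>K)"
    by (subst M2.nn_integral_fst[OF m, symmetric]) simp
  also have "\<dots> = (\<integral>\<^sup>+ m. of_nat m * (ennreal a * emeasure lborel B) \<partial>K)"
  proof (intro nn_integral_cong)
    fix m
    have "(\<integral>\<^sup>+ N. emeasure (superpos m N) B \<partial>Copies) = (\<integral>\<^sup>+ N. (\<Sum>j<m. emeasure (N j) B) \<partial>Copies)"
      using component_counting by (intro nn_integral_cong emeasure_superpos B counting_measuresD(1))
    also have "\<dots> = (\<Sum>j<m. \<integral>\<^sup>+ N. emeasure (N j) B \<partial>Copies)"
      by (intro nn_integral_sum measurable_emeasure_component B)
    also have "\<dots> = of_nat m * (ennreal a * emeasure lborel B)"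
      by (simp add: mean1)
    finally show "(\<integral>\<^sup>+ N. emeasure (superpos m N) B \<partial>Copies) = of_nat m * (ennreal a * emeasure lborel B)" .
  qed
  also have "\<dots> = (\<integral>\<^sup>+ m. of_nat m \<partial>K) * (ennreal a * emeasure lborel B)"
    by (rule nn_integral_multc) simp
  also have "(\<integral>\<^sup>+ m. of_nat m \<partial>K) = (\<Sum>n. of_nat n * ennreal (pois 1 n))"
    by (simp add: nn_integral_measure_pmf nn_integral_count_space_nat pois_def mult.commute)
  also have "\<dots> = 1"
    using suminf_pois_mean[of 1] by simp
  finally show ?thesis by simp
qed

lemma Mix_point_process: "point_process Mix" "has_intensity Mix a"
  using Mix_prob Mix_mean by (auto simp: point_process_def has_intensity_def bounded_borel_finite ennreal_mult_less_top)

text \<open>A positive probability is enough, so one sufficiently large \<open>m\<close> can be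
  fixed; it has positive weight, and given \<open>m\<close> a square is empty with probability
  \<open>exp (- (m * a * s ^ 2))\<close>.\<close>

lemma Mix_percolates:
  assumes r: "0 < r"
  shows "percolates Mix r"
proof -
  interpret pair_prob_space K Copies by (rule pair_prob)
  \<comment> \<open>Points of adjacent squares are then less than \<open>3 * r / 2\<close> apart, so
    the balls of radius \<open>r\<close> around them both contain the midpoint.\<close>
  define s where "s = r / 2"
  have s: "0 < s" using r by (simp add: s_def)
  \<comment> \<open>Makes the probability of an empty square at most 1/144.\<close>
  obtain m :: nat where m: "real m > ln 144 / (a * s\<^sup>2)"
    using reals_Archimedean2 by blast
  let ?q = "exp (- (real m * (a * s\<^sup>2)))"
  have "ln 144 < real m * (a * s\<^sup>2)"
    using m a s by (simp add: divide_less_eq)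
  then have "- (real m * (a * s\<^sup>2)) \<le> - ln 144" by simp
  then have "?q \<le> exp (- ln 144)" by (simp only: exp_le_cancel_iff)
  also have "\<dots> = 1 / 144" by (simp add: exp_minus inverse_eq_divide)
  finally have q: "?q \<le> 1 / 144" .
  define G where "G N b \<longleftrightarrow> (\<exists>j<m. emeasure (N j) (square s b) > 0)" for N :: "nat \<Rightarrow> plane measure" and b
  have bS: "(\<Union>b\<in>T. square s b) \<in> sets borel" "bounded (\<Union>b\<in>T. square s b)" if "finite T" for T
    using that by auto
  have ev1: "{N \<in> space Copies. emeasure (N j) S = 0} \<in> sets Copies" if "S \<in> sets borel" for j S
  proof -
    have "(\<lambda>N. emeasure (N j) S) -` {0} \<inter> space Copies \<in> sets Copies"
      by (rule measurable_sets[OF measurable_emeasure_component[OF that]]) simp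
    moreover have "(\<lambda>N. emeasure (N j) S) -` {0} \<inter> space Copies = {N \<in> space Copies. emeasure (N j) S = 0}" by auto
    ultimately show ?thesis by simp
  qed
  have zero: "(\<forall>b\<in>T. emeasure N (square s b) = 0) \<longleftrightarrow> emeasure N (\<Union>b\<in>T. square s b) = 0"
    if "N \<in> counting_measures" "finite T" for N T
  proof
    assume *: "\<forall>b\<in>T. emeasure N (square s b) = 0"
    have "emeasure N (\<Union>b\<in>T. square s b) \<le> (\<Sum>b\<in>T. emeasure N (square s b))"
      by (rule emeasure_subadditive_finite[OF that(2)]) (simp add: counting_measuresD(1)[OF that(1)] image_subset_iff)
    with * show "emeasure N (\<Union>b\<in>T. square s b) = 0" by simp
  next
    assume *: "emeasure N (\<Union>b\<in>T. square s b) = 0"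
    show "\<forall>b\<in>T. emeasure N (square s b) = 0"
    proof
      fix b assume "b \<in> T"
      then have "emeasure N (square s b) \<le> emeasure N (\<Union>b\<in>T. square s b)"
        by (intro emeasure_mono UN_upper) (simp_all add: counting_measuresD(1)[OF that(1)] bS(1)[OF that(2)])
      with * show "emeasure N (square s b) = 0" by simp
    qed
  qed
  have notG: "{N \<in> space Copies. \<forall>b\<in>T. \<not> G N b} = {N \<in> space Copies. \<forall>j\<in>{..<m}. emeasure (N j) (\<Union>b\<in>T. square s b) = 0}"
    if "finite T" for T
    using zero[OF component_counting that] by (auto simp: G_def)
  have ev2: "{N \<in> space Copies. \<forall>j\<in>{..<m}. emeasure (N j) S = 0} \<in> sets Copies" if "S \<in> sets borel" for S
    by (intro sets.sets_Collect_finite_All ev1 that finite_lessThan)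
  have ev: "{N \<in> space Copies. G N b} \<in> sets Copies" for b
  proof -
    have "{N \<in> space Copies. G N b} = space Copies - {N \<in> space Copies. \<forall>c\<in>{b}. \<not> G N c}" by auto
    also have "\<dots> \<in> sets Copies"
      using notG[of "{b}"] ev2[of "square s b"] by auto
    finally show ?thesis .
  qed
  have good: "M2.prob {N \<in> space Copies. \<forall>n. good_block (G N) n (0, 0)} > 0"
  proof (rule M2.prob_all_blocks_good[OF ev _ q])
    fix T :: "site set" assume T: "finite T"
    let ?S = "\<Union>b\<in>T. square s b"
    let ?Z = "{N \<in> space P\<^sub>0. emeasure N ?S = 0}"
    have Z: "?Z \<in> sets P\<^sub>0"
    proof -
      have em: "(\<lambda>N. emeasure N ?S) \<in> borel_measurable P\<^sub>0"
        using measurable_emeasure_config[OF bS(1)[OF T]] measurable_cong_sets[OF sets_P0 refl] by blast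
      have "(\<lambda>N. emeasure N ?S) -` {0} \<inter> space P\<^sub>0 \<in> sets P\<^sub>0"
        by (rule measurable_sets[OF em]) simp
      moreover have "(\<lambda>N. emeasure N ?S) -` {0} \<inter> space P\<^sub>0 = ?Z" by auto
      ultimately show ?thesis by simp
    qed
    have "emeasure Copies {N \<in> space Copies. \<forall>b\<in>T. \<not> G N b} =
        (\<integral>\<^sup>+ N. indicator {N \<in> space Copies. \<forall>j\<in>{..<m}. emeasure (N j) ?S = 0} N \<partial>Copies)"
      unfolding notG[OF T] by (rule nn_integral_indicator[symmetric]) (rule ev2[OF bS(1)[OF T]])
    also have "\<dots> \<le> (\<integral>\<^sup>+ N. (\<Prod>j\<in>{..<m}. indicator ?Z (N j)) \<partial>Copies)"
    proof (intro nn_integral_mono)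
      fix N assume "N \<in> space Copies"
      then show "indicator {N \<in> space Copies. \<forall>j\<in>{..<m}. emeasure (N j) ?S = 0} N \<le> (\<Prod>j\<in>{..<m}. indicator ?Z (N j) :: ennreal)"
        using component_counting[of N] by (simp add: indicator_def space_P0)
    qed
    also have "\<dots> = (\<Prod>j\<in>{..<m}. \<integral>\<^sup>+ N. indicator ?Z N \<partial>P\<^sub>0)"
      unfolding Copies_def using Z by (intro nn_integral_PiM_prod prob_P0) auto
    also have "\<dots> = ennreal (exp (- (a * measure lborel ?S))) ^ m"
      using Z poisson_void_probability[OF P0 bS[OF T]] by simp
    also have "\<dots> = ennreal (?q ^ card T)"
      unfolding measure_squares[OF s T]
      by (simp add: ennreal_power exp_of_nat_mult[symmetric] algebra_simps)
    finally show "M2.prob {N \<in> space Copies. \<forall>b\<in>T. \<not> G N b} \<le> ?q ^ card T"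
      by (simp add: M2.emeasure_eq_measure)
  qed simp
  have goodm: "{N \<in> space Copies. \<forall>n. good_block (G N) n (0, 0)} \<in> sets Copies"
    by (intro sets.sets_Collect_countable_All M2.sets_good_block ev)
  \<comment> \<open>The slice with the chosen number of copies; its probability is the product of
    the weight of \<open>m\<close> and the probability of good blocks.\<close>
  let ?E = "{m} \<times> {N \<in> space Copies. \<forall>n. good_block (G N) n (0, 0)}"
  show ?thesis
  proof (rule percolates_of_law[OF prob_space_axioms measurable_mix Mix_def])
    have "emeasure (K \<Otimes>\<^sub>M Copies) ?E = emeasure K {m} * emeasure Copies {N \<in> space Copies. \<forall>n. good_block (G N) n (0, 0)}"
      by (rule M2.emeasure_pair_measure_Times) (use goodm in auto)
    also have "\<dots> = ennreal (pmf (poisson_pmf 1) m * M2.prob {N \<in> space Copies. \<forall>n. good_block (G N) n (0, 0)})"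
      by (simp only: emeasure_pmf_single M2.emeasure_eq_measure ennreal_mult' pmf_nonneg measure_nonneg ennreal_mult)
    finally have "prob ?E = pmf (poisson_pmf 1) m * M2.prob {N \<in> space Copies. \<forall>n. good_block (G N) n (0, 0)}"
      unfolding emeasure_eq_measure by (subst (asm) ennreal_inj) simp_all
    moreover have "pmf (poisson_pmf 1) m > 0"
      by (rule pmf_positive) simp
    ultimately show "prob ?E > 0"
      using good by (simp only: mult_pos_pos)
    have perc: "\<exists>U. U \<subseteq> coverage (superpos m N) r \<and> connected U \<and> \<not> bounded U"
      if N: "N \<in> space Copies" "\<forall>n. good_block (G N) n (0, 0)" for N
    proof -
      have sN: "sets (N j) = sets borel" for j
        using counting_measuresD(1)[OF component_counting[OF N(1)]] .
      have ex: "\<exists>x\<in>square s b. emeasure (superpos m N) {x} > 0" if b: "G N b" for b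
      proof -
        obtain j where j: "j < m" "emeasure (N j) (square s b) > 0"
          using b by (auto simp: G_def)
        then obtain x where x: "x \<in> square s b" "emeasure (N j) {x} > 0"
          using counting_measures_atom[OF component_counting[OF N(1)] sets_square bounded_square] by blast
        have "emeasure (N j) {x} \<le> (\<Sum>j<m. emeasure (N j) {x})"
          by (rule member_le_sum) (use j in auto)
        with x have "emeasure (superpos m N) {x} > 0"
          using emeasure_superpos[OF sN, of "{x}" m] by (simp add: order_less_le_trans)
        with x show ?thesis by blast
      qed
      define x where "x b = (SOME x. x \<in> square s b \<and> emeasure (superpos m N) {x} > 0)" for b
      have x: "x b \<in> square s b" "emeasure (superpos m N) {x b} > 0" if "G N b" for b
        using someI_ex[of "\<lambda>x. x \<in> square s b \<and> emeasure (superpos m N) {x} > 0"] ex[OF that]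
        unfolding x_def by blast+
      show ?thesis
      proof (rule good_blocks_unbounded[where G = "G N" and C = "\<lambda>b. ball (x b) r" and s = s and D = r])
        fix b assume b: "G N b"
        show "connected (ball (x b) r) \<and> ball (x b) r \<noteq> {} \<and> ball (x b) r \<subseteq> coverage (superpos m N) r"
          using x(2)[OF b] r unfolding coverage_def by auto
      next
        fix b c assume bc: "G N b" "G N c" "next_to b c"
        have "dist (x b) (x c) < 3 * s"
          by (rule dist_next_squares[OF x(1)[OF bc(1)] x(1)[OF bc(2)] bc(3)])
        then have "midpoint (x b) (x c) \<in> ball (x b) r \<inter> ball (x c) r"
          using r by (simp add: dist_midpoint s_def)
        then show "ball (x b) r \<inter> ball (x c) r \<noteq> {}" by blast
      next
        fix b y assume b: "G N b" and y: "y \<in> ball (x b) r"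
        have "s * real (fst b) \<le> norm (x b)" by (rule norm_ge_square[OF x(1)[OF b]])
        moreover have "norm (x b) \<le> norm y + r"
          using y norm_triangle_ineq2[of "x b" y] by (simp add: dist_norm)
        ultimately show "s * real (fst b) - r \<le> norm y" by simp
      qed (use s N(2) in auto)
    qed
    show "AE \<omega> in K \<Otimes>\<^sub>M Copies. \<omega> \<in> ?E \<longrightarrow>
       (\<exists>U. U \<subseteq> coverage (case \<omega> of (m, N) \<Rightarrow> superpos m N) r \<and> connected U \<and> \<not> bounded U)"
      by (rule AE_I2) (use perc in auto)
  qed
qed

text \<open>Jensen's inequality on the naturals: a convex \<open>h\<close> lies above the line
  through its values at 0 and 1, and the average of this line over a variable of mean 1 is
  \<open>h 1\<close>.\<close>

lemma Mix_dcx: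
  assumes P: "homogeneous_poisson a P"
  shows "P \<le>\<^sub>d\<^sub>c\<^sub>x Mix"
  unfolding dcx_le_def
proof (intro allI impI)
  fix k :: nat and B :: "nat \<Rightarrow> plane set" and f
  assume "1 \<le> k" and B: "\<forall>i<k. B i \<in> sets borel \<and> bounded (B i)" and f: "dcx k f"
    and intP: "integrable P (\<lambda>N. f (counts k B N))" and intM: "integrable Mix (\<lambda>N. f (counts k B N))"
  interpret pair_prob_space K Copies by (rule pair_prob)
  define F where "F N = f (counts k B N)" for N
  \<comment> \<open>Taken from integrability under \<open>Mix\<close>: \<open>f\<close> itself is
    only Lebesgue measurable, which does not make its composition with the counts
    measurable.\<close>
  have Fm: "F \<in> borel_measurable config_space"
    using borel_measurable_integrable[OF intM] measurable_cong_sets[OF Mix_prob(2) refl]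
    unfolding F_def by blast
  have int0: "integrable P\<^sub>0 F" and eq0: "(\<integral>N. F N \<partial>P) = (\<integral>N. F N \<partial>P\<^sub>0)"
    unfolding F_def using counts_law_unique[OF P P0 _ intP] B by blast+
  define h where "h m = (\<integral>N. F (superpos m N) \<partial>Copies)" for m
  have intKC: "integrable (K \<Otimes>\<^sub>M Copies) (\<lambda>(m, N). F (superpos m N))"
    using intM unfolding Mix_def F_def[symmetric]
    by (subst (asm) integrable_distr_eq[OF measurable_mix Fm]) (simp add: split_beta')
  \<comment> \<open>Fubini gives integrability for almost every \<open>m\<close>; as the Poisson law
    charges every natural number, this means for every \<open>m\<close>.\<close>
  have "AE m in K. integrable Copies (\<lambda>N. F (superpos m N))"
    using AE_integrable_fst'[OF intKC] by simp
  then have intC: "integrable Copies (\<lambda>N. F (superpos m N))" for m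
    by (simp add: AE_measure_pmf_iff)
  have inth: "integrable K h"
    using integrable_fst'[OF intKC] by (simp add: h_def[abs_def])
  have valM: "(\<integral>N. F N \<partial>Mix) = (\<integral>m. h m \<partial>K)"
  proof -
    have "(\<integral>N. F N \<partial>Mix) = (\<integral>p. (case p of (m, N) \<Rightarrow> F (superpos m N)) \<partial>(K \<Otimes>\<^sub>M Copies))"
      unfolding Mix_def by (subst integral_distr[OF measurable_mix Fm]) (simp add: split_beta')
    also have "\<dots> = (\<integral>m. \<integral>N. F (superpos m N) \<partial>Copies \<partial>K)"
      using integral_fst'[OF intKC] by simp
    finally show ?thesis by (simp add: h_def[abs_def])
  qed
  have h1: "h 1 = (\<integral>N. F N \<partial>P\<^sub>0)"
  proof -
    have "h 1 = (\<integral>N. F (N 0) \<partial>Copies)"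
      unfolding h_def
    proof (rule Bochner_Integration.integral_cong[OF refl])
      fix N assume "N \<in> space Copies"
      then have N: "N j \<in> counting_measures" for j by (rule component_counting)
      have "counts k B (superpos 1 N) = counts k B (N 0)"
        unfolding counts_def by (rule restrict_ext) (use measure_superpos[OF N] B in simp)
      then show "F (superpos 1 N) = F (N 0)" by (simp add: F_def)
    qed
    also have "\<dots> = (\<integral>N. F N \<partial>distr Copies P\<^sub>0 (\<lambda>N. N 0))"
      using Fm measurable_cong_sets[OF sets_P0 refl] by (subst integral_distr[OF component]) auto
    also have "distr Copies P\<^sub>0 (\<lambda>N. N 0) = P\<^sub>0"
      unfolding Copies_def using prob_P0 by (intro distr_PiM_component) auto
    finally show ?thesis .
  qed
  \<comment> \<open>Exchanging the copies \<open>m\<close> and \<open>m + 1\<close> preserves the law, and the counts of the first \<open>m\<close> copies,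
    of these together with either or both of the next two, form a configuration as in
    the definition of directional convexity.\<close>
  have convex: "h (Suc m) - h m \<le> h (Suc (Suc m)) - h (Suc m)" for m
  proof -
    define \<sigma> where "\<sigma> = Transposition.transpose m (Suc m)"
    let ?s = "\<lambda>N j. N (\<sigma> j) :: plane measure"
    have \<sigma>: "\<sigma> j = j" if "j < m" for j
      using that by (simp add: \<sigma>_def transpose_def)
    have \<sigma>m: "\<sigma> m = Suc m" by (simp add: \<sigma>_def)
    have sw: "distr Copies Copies ?s = Copies"
    proof -
      have "inj_on \<sigma> UNIV"
        by (rule inj_on_inverseI[of _ \<sigma>]) (simp add: \<sigma>_def)
      then have "distr (\<Pi>\<^sub>M j\<in>UNIV. P\<^sub>0) (\<Pi>\<^sub>M j\<in>UNIV. P\<^sub>0) (\<lambda>N. \<lambda>j\<in>UNIV. N (\<sigma> j)) = (\<Pi>\<^sub>M j\<in>UNIV. P\<^sub>0)"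
        by (intro distr_PiM_reindex prob_P0) auto
      then show ?thesis
        unfolding Copies_def by (simp only: restrict_UNIV)
    qed
    have swm: "?s \<in> measurable Copies Copies"
      unfolding Copies_def by (intro measurable_abs_UNIV measurable_component_singleton) simp
    have Fsm: "(\<lambda>N. F (superpos n N)) \<in> borel_measurable Copies" for n
      by (rule measurable_compose[OF measurable_superpos Fm])
    have ints: "integrable Copies (\<lambda>N. F (superpos (Suc m) (?s N)))"
      using intC[of "Suc m"] integrable_distr_eq[OF swm Fsm[of "Suc m"]] by (simp add: sw)
    have vals: "(\<integral>N. F (superpos (Suc m) (?s N)) \<partial>Copies) = h (Suc m)"
      using integral_distr[OF swm Fsm[of "Suc m"]] by (simp add: sw h_def)
    have le: "F (superpos (Suc m) N) + F (superpos (Suc m) (?s N)) \<le> F (superpos m N) + F (superpos (Suc (Suc m)) N)"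
      if "N \<in> space Copies" for N
    proof -
      have N: "N j \<in> counting_measures" for j using that by (rule component_counting)
      have ev: "counts k B (superpos n L) i = (\<Sum>j<n. measure (L j) (B i))" if "i < k" "\<And>j. L j \<in> counting_measures" for n L i
        using counts_superpos[of L k B i n] that B by simp
      have ss: "(\<Sum>j<m. measure (?s N j) (B i)) = (\<Sum>j<m. measure (N j) (B i))" for i
        using \<sigma> by (intro sum.cong refl) simp
      have ext: "counts k B L \<in> extensional {..<k}" for L by (simp add: counts_def)
      have dcxD: "(\<forall>i<k. p i \<le> x i \<and> x i \<le> q i \<and> p i \<le> y i \<and> y i \<le> q i \<and> x i + y i = p i + q i) \<Longrightarrow>
          f x + f y \<le> f p + f q" if "x \<in> extensional {..<k}" "y \<in> extensional {..<k}" "p \<in> extensional {..<k}" "q \<in> extensional {..<k}" for x y p q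
        using f that unfolding dcx_def by blast
      show ?thesis
        unfolding F_def
        by (rule dcxD[OF ext ext ext ext]) (simp add: ev N ss \<sigma>m)
    qed
    have "h (Suc m) + h (Suc m) = (\<integral>N. F (superpos (Suc m) N) + F (superpos (Suc m) (?s N)) \<partial>Copies)"
      using Bochner_Integration.integral_add[OF intC[of "Suc m"] ints] vals by (simp add: h_def)
    also have "\<dots> \<le> (\<integral>N. F (superpos m N) + F (superpos (Suc (Suc m)) N) \<partial>Copies)"
      using intC ints le by (intro integral_mono Bochner_Integration.integrable_add)
    also have "\<dots> = h m + h (Suc (Suc m))"
      using Bochner_Integration.integral_add[OF intC[of m] intC[of "Suc (Suc m)"]] by (simp add: h_def)
    finally show ?thesis by simp
  qed
  \<comment> \<open>The increments of \<open>h\<close> are nondecreasing, so none is below the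
    first.\<close>
  have incr: "h 1 - h 0 \<le> h (Suc m) - h m" for m
  proof (induction m)
    case (Suc m)
    then show ?case using convex[of m] by simp
  qed simp
  \<comment> \<open>At \<open>m = 0\<close> both sides equal \<open>h 0\<close>; summing increments
    does the rest.\<close>
  have line: "h 1 + (real m - 1) * (h 1 - h 0) \<le> h m" for m
  proof (induction m)
    case (Suc m)
    then show ?case using incr[of m] by (simp add: algebra_simps)
  qed simp
  have "(\<integral>\<^sup>+ m. ennreal (real m) \<partial>K) = (\<Sum>n. of_nat n * ennreal (pois 1 n))"
    by (simp add: nn_integral_measure_pmf nn_integral_count_space_nat pois_def mult.commute ennreal_of_nat_eq_real_of_nat)
  then have nn1: "(\<integral>\<^sup>+ m. ennreal (real m) \<partial>K) = ennreal 1"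
    using suminf_pois_mean[of 1] by simp
  have intid: "integrable K real"
    by (rule integrableI_nonneg) (simp_all add: nn1)
  have mean1: "(\<integral>m. real m \<partial>K) = 1"
    by (rule integral_eq_nn_integral[THEN trans]) (simp_all add: nn1)
  have "h 1 = (\<integral>m. h 1 + (real m - 1) * (h 1 - h 0) \<partial>K)"
    using intid mean1 by (simp add: measure_pmf.prob_space[simplified])
  also have "\<dots> \<le> (\<integral>m. h m \<partial>K)"
    using intid by (intro integral_mono inth line Bochner_Integration.integrable_add Bochner_Integration.integrable_diff
        integrable_mult_left measure_pmf.integrable_const)
  finally show "(\<integral>N. f (counts k B N) \<partial>P) \<le> (\<integral>N. f (counts k B N) \<partial>Mix)"
    using eq0 h1 valM unfolding F_def by simp
qed

end

section \<open>Choice of the parameters\<close>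

text \<open>After cancellation both exponents are linear in \<open>t\<close>:
  \<open>t * r / 32\<close> for hitting one target, and \<open>t * a / 18\<close> for a full centre
  in a square of side \<open>t ^ 2 / 3\<close>. The exponential beats the quadratic number of
  targets, so a mark is full with probability at least 1/2, the factor appearing in the second
  bound.\<close>

lemma annular_parameters:
  fixes a r :: real
  assumes "0 < a" "0 < r"
  obtains t :: real where "0 < t" "r \<le> t\<^sup>2" "(64 * t\<^sup>2 / r + 1) * exp (- (t ^ 3 * (r / (32 * t\<^sup>2)))) \<le> 1 / 2"
    "exp (- (1 / 2 * (a / t ^ 3 * (t\<^sup>2 / 3)\<^sup>2))) \<le> 1 / 144"
proof -
  define c where "c = r / 32"
  define d where "d = a / 18"
  have cd: "0 < c" "0 < d" using assms by (simp_all add: c_def d_def)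
  have 1: "((\<lambda>t. (64 * t\<^sup>2 / r + 1) * exp (- (t * c))) \<longlongrightarrow> 0) at_top"
    using cd assms by real_asymp
  have 2: "((\<lambda>t. exp (- (t * d))) \<longlongrightarrow> 0) at_top"
    using cd by real_asymp
  have 3: "filterlim (\<lambda>t::real. t\<^sup>2) at_top at_top"
    by real_asymp
  have "\<forall>\<^sub>F t in at_top. (64 * t\<^sup>2 / r + 1) * exp (- (t * c)) < 1 / 2"
    by (rule order_tendstoD(2)[OF 1]) simp
  moreover have "\<forall>\<^sub>F t in at_top. exp (- (t * d)) < 1 / 144"
    by (rule order_tendstoD(2)[OF 2]) simp
  moreover have "\<forall>\<^sub>F t::real in at_top. r \<le> t\<^sup>2"
    using 3 by (simp add: filterlim_at_top)
  moreover have "\<forall>\<^sub>F t::real in at_top. 0 < t"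
    by (rule eventually_gt_at_top)
  ultimately have "\<forall>\<^sub>F t in at_top. (64 * t\<^sup>2 / r + 1) * exp (- (t * c)) < 1 / 2 \<and> exp (- (t * d)) < 1 / 144 \<and> r \<le> t\<^sup>2 \<and> 0 < t"
    by eventually_elim simp
  then obtain t where t: "(64 * t\<^sup>2 / r + 1) * exp (- (t * c)) < 1 / 2" "exp (- (t * d)) < 1 / 144" "r \<le> t\<^sup>2" "0 < t"
    using eventually_happens'[OF trivial_limit_at_top_linorder] by blast
  have "t ^ 3 * (r / (32 * t\<^sup>2)) = t * c"
    using t(4) by (simp add: c_def power2_eq_square power3_eq_cube)
  moreover have "1 / 2 * (a / t ^ 3 * (t\<^sup>2 / 3)\<^sup>2) = t * d"
    using t(4) by (simp add: d_def power2_eq_square power3_eq_cube)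
  ultimately show ?thesis
    using t by (intro that[of t]) simp_all
qed

lemma annular_percolation:
  fixes a r :: real
  assumes a: "0 < a" and r: "0 < r"
  shows "\<exists>\<alpha> \<mu> \<delta> R :: real.
            0 < \<alpha> \<and> 0 < \<mu> \<and> 0 < \<delta> \<and> \<delta> \<le> R \<and> \<alpha> * \<mu> = a \<and>
            (\<exists>P. annular_cluster_process \<alpha> R \<delta> \<mu> P) \<and>
            (\<forall>P. annular_cluster_process \<alpha> R \<delta> \<mu> P \<longrightarrow>
                 point_process P \<and> has_intensity P a \<and> critical_radius P \<le> ereal r)"
proof -
  obtain t where t: "0 < t" "r \<le> t\<^sup>2" "(64 * t\<^sup>2 / r + 1) * exp (- (t ^ 3 * (r / (32 * t\<^sup>2)))) \<le> 1 / 2"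
    "exp (- (1 / 2 * (a / t ^ 3 * (t\<^sup>2 / 3)\<^sup>2))) \<le> 1 / 144"
    using annular_parameters[OF a r] .
  define R where "R = t\<^sup>2"
  define \<mu> where "\<mu> = t ^ 3"
  define \<alpha> where "\<alpha> = a / t ^ 3"
  define s where "s = t\<^sup>2 / 3"
  have pos: "0 < \<alpha>" "0 < \<mu>" "r \<le> R" "0 < s" "\<alpha> * \<mu> = a"
    using t a by (simp_all add: \<alpha>_def \<mu>_def R_def s_def)
  have mark: "mark R r \<mu>"
    by unfold_locales (use pos r in auto)
  obtain F where F: "F \<in> sets (mark_law R r \<mu>)"
    "1 - (64 * R / r + 1) * exp (- (\<mu> * (r / (32 * R)))) \<le> measure (mark_law R r \<mu>) F"
    "\<And>z. z \<in> F \<Longrightarrow> sphere 0 (R - r / 2) \<subseteq> (\<Union>i<fst z. ball (snd z i) r)"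
    using full_marks_exist[OF r pos(3) pos(2)] by blast
  have half: "1 / 2 \<le> measure (mark_law R r \<mu>) F"
    using F(2) t(3) unfolding R_def \<mu>_def by linarith
  have "1 / 2 * (\<alpha> * s\<^sup>2) \<le> measure (mark_law R r \<mu>) F * (\<alpha> * s\<^sup>2)"
    using half pos by (intro mult_right_mono) simp_all
  then have "exp (- (measure (mark_law R r \<mu>) F * (\<alpha> * s\<^sup>2))) \<le> exp (- (1 / 2 * (\<alpha> * s\<^sup>2)))"
    by simp
  also have "\<dots> \<le> 1 / 144"
    using t(4) by (simp only: \<alpha>_def s_def)
  finally have small: "exp (- (measure (mark_law R r \<mu>) F * (\<alpha> * s\<^sup>2))) \<le> 1 / 144" .
  \<comment> \<open>Existence keeps the claim about all laws of the process from being
    vacuous.\<close>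
  have ex: "\<exists>P. annular_cluster_process \<alpha> R r \<mu> P"
  proof -
    obtain M :: "(nat \<Rightarrow> plane \<times> (nat \<times> (nat \<Rightarrow> plane))) measure" and X Z
      where MXZ: "marked_centres \<alpha> R r \<mu> M X Z"
      using marked_centres_exist[OF pos(1) r pos(3) pos(2)] by blast
    interpret marked R r \<mu> \<alpha> M X Z
      by (intro marked.intro marked_axioms.intro mark pos(1) MXZ)
    show ?thesis
      using cluster_law_exists MXZ unfolding annular_cluster_process_def by blast
  qed
  have all: "point_process P \<and> has_intensity P a \<and> critical_radius P \<le> ereal r"
    if P: "annular_cluster_process \<alpha> R r \<mu> P" for P
  proof -
    obtain M :: "(nat \<Rightarrow> plane \<times> (nat \<times> (nat \<Rightarrow> plane))) measure" and X Z
      where MXZ: "marked_centres \<alpha> R r \<mu> M X Z" "law_of M (cluster_points X Z) P"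
      using P unfolding annular_cluster_process_def by blast
    interpret marked R r \<mu> \<alpha> M X Z
      by (intro marked.intro marked_axioms.intro mark pos(1) MXZ(1))
    have "percolates P r"
    proof (rule cluster_percolates[OF F(1) r _ F(3) pos(4) _ small MXZ(2)])
      \<comment> \<open>Here \<open>3 * s = R\<close>, and \<open>r \<le> R\<close> gives
        \<open>R \<le> 2 * R - r\<close>.\<close>
      show "0 \<le> R - r / 2" "3 * s \<le> 2 * (R - r / 2)"
        using pos(3) r by (simp_all add: s_def R_def)
    qed
    then have "critical_radius P \<le> ereal r"
      unfolding critical_radius_def using r by (intro INF_lower) simp
    with cluster_point_process[OF MXZ(2)] show ?thesis
      unfolding pos(5) by blast
  qed
  show ?thesis
    by (intro exI[of _ \<alpha>] exI[of _ \<mu>] exI[of _ r] exI[of _ R] conjI allI pos r ex) (use all in blast)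
qed

lemma percolating_dcx_larger:
  fixes a :: real
  assumes a: "0 < a"
  shows "\<exists>P. point_process P \<and> has_intensity P a \<and>
            (\<exists>P\<^sub>0. homogeneous_poisson a P\<^sub>0) \<and>
            (\<forall>P\<^sub>0. homogeneous_poisson a P\<^sub>0 \<longrightarrow> P\<^sub>0 \<le>\<^sub>d\<^sub>c\<^sub>x P) \<and>
            (\<forall>r>0. percolates P r) \<and> critical_radius P = 0"
proof -
  \<comment> \<open>Supplies the Poisson process whose copies are superposed.\<close>
  interpret poisson_cells a by unfold_locales (rule a)
  obtain P\<^sub>0 where P0: "homogeneous_poisson a P\<^sub>0"
    using centres_law by blast
  interpret mixture a P\<^sub>0 by unfold_locales (use a P0 in auto)
  have "critical_radius Mix = 0"
  proof (rule antisym)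
    show "critical_radius Mix \<le> 0"
    proof (rule ereal_le_epsilon2)
      fix e :: real assume "0 < e"
      then have "critical_radius Mix \<le> ereal e"
        unfolding critical_radius_def using Mix_percolates by (intro INF_lower) simp
      then show "critical_radius Mix \<le> 0 + ereal e" by simp
    qed
    show "0 \<le> critical_radius Mix"
      unfolding critical_radius_def by (intro INF_greatest) simp
  qed
  with Mix_point_process Mix_dcx Mix_percolates P0 show ?thesis by blast
qed

theorem proposition6p7:
  shows "(\<forall>a>0. \<forall>r>0. \<exists>\<alpha> \<mu> \<delta> R :: real.
            0 < \<alpha> \<and> 0 < \<mu> \<and> 0 < \<delta> \<and> \<delta> \<le> R \<and> \<alpha> * \<mu> = a \<and>
            (\<exists>P. annular_cluster_process \<alpha> R \<delta> \<mu> P) \<and>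
            (\<forall>P. annular_cluster_process \<alpha> R \<delta> \<mu> P \<longrightarrow>
                 point_process P \<and> has_intensity P a \<and> critical_radius P \<le> ereal r)) \<and>
         (\<forall>a>0. \<exists>P. point_process P \<and> has_intensity P a \<and>
            (\<exists>P\<^sub>0. homogeneous_poisson a P\<^sub>0) \<and>
            (\<forall>P\<^sub>0. homogeneous_poisson a P\<^sub>0 \<longrightarrow> P\<^sub>0 \<le>\<^sub>d\<^sub>c\<^sub>x P) \<and>
            (\<forall>r>0. percolates P r) \<and> critical_radius P = 0)"
  using annular_percolation percolating_dcx_larger by blast

end
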